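(* Let $1<p<2$, $\alpha>0$, let $g$ be an entire function on $\mathbb{C}$, and let $X$ be a complex infinite-dimensional Banach space. Then the following assertions hold. (1) $J_g:wF^p_{\alpha}(X)\to F^p_{\alpha}(X)$ is bounded if and only if $g$ is constant. (2) $F^p_{\alpha}(X)\subsetneq wF^p_{\alpha}(X)$.
   Context: $dA$ is Lebesgue measure on $\mathbb{C}$. $F^p_\alpha$ is the space of scalar entire functions $f$ with $\|f\|^p_{F^p_{\alpha}}:=\int_{\mathbb{C}}|f(z)|^pe^{-\frac{p\alpha}{2}|z|^2}dA(z)<\infty$. $F^p_{\alpha}(X)$ is the space of $X$-valued entire functions $f$ with $\|f\|^p_{F^p_{\alpha}(X)}:=\int_{\mathbb{C}}\|f(z)\|^p_Xe^{-\frac{p\alpha}{2}|z|^2}dA(z)<\infty$. $wF^p_{\alpha}(X)$ is the space of $X$-valued entire functions $f$ with $\|f\|_{wF^p_{\alpha}(X)}:=\sup_{x^*\in B_{X^*}}\|x^*\circ f\|_{F^p_{\alpha}}<\infty$, where $B_{X^*}$ is the unit ball of $X^*$. For $X$-valued entire $f$, $J_gf(z):=\int_0^zf(\zeta)g'(\zeta)d\zeta$, $z\in\mathbb{C}$. *)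

theory Defs
  imports "HOL-Analysis.Analysis"
begin

section \<open>Complex Banach spaces\<close>

class scaleC = scaleR +
  fixes scaleC :: "complex \<Rightarrow> 'a \<Rightarrow> 'a" (infixr "*\<^sub>C" 75)
  assumes scaleR_scaleC: "scaleR r x = scaleC (complex_of_real r) x"

class complex_normed_vector = scaleC + real_normed_vector +
  assumes scaleC_add_right: "a *\<^sub>C (x + y) = a *\<^sub>C x + a *\<^sub>C y"
    and scaleC_add_left: "(a + b) *\<^sub>C x = a *\<^sub>C x + b *\<^sub>C x"
    and scaleC_scaleC: "a *\<^sub>C (b *\<^sub>C x) = (a * b) *\<^sub>C x"
    and scaleC_one: "1 *\<^sub>C x = x"
    and norm_scaleC: "norm (a *\<^sub>C x) = cmod a * norm x"

class complex_banach = complex_normed_vector + complete_space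

subclass (in complex_banach) banach ..

instantiation complex :: complex_banach
begin

definition scaleC_complex :: "complex \<Rightarrow> complex \<Rightarrow> complex"
  where "scaleC_complex a x = a * x"

instance
  by standard
    (simp_all add: scaleC_complex_def scaleR_conv_of_real algebra_simps norm_mult)

end

interpretation complex_vector:
  vector_space "scaleC :: complex \<Rightarrow> 'a \<Rightarrow> 'a :: complex_normed_vector"
  by standard
    (simp_all add: scaleC_add_right scaleC_add_left scaleC_scaleC scaleC_one)

definition dual_unit_ball :: "('a :: complex_normed_vector \<Rightarrow> complex) set"
  where "dual_unit_ball =
    {\<phi>. bounded_linear \<phi> \<and> (\<forall>c x. \<phi> (c *\<^sub>C x) = c * \<phi> x) \<and> onorm \<phi> \<le> 1}"


section \<open>Vector-valued entire functions and path integrals\<close>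

definition entire :: "(complex \<Rightarrow> 'a :: complex_normed_vector) \<Rightarrow> bool"
  where "entire f \<longleftrightarrow>
    (\<forall>z. \<exists>D. ((\<lambda>w. inverse (w - z) *\<^sub>C (f w - f z)) \<longlongrightarrow> D) (at z))"

text \<open>The library's \<open>contour_integral\<close> only takes complex-valued integrands; this is the
  same formula for integrands with values in a complex Banach space.\<close>

definition path_integral ::
    "(real \<Rightarrow> complex) \<Rightarrow> (complex \<Rightarrow> 'a :: complex_banach) \<Rightarrow> 'a"
  where "path_integral \<gamma> F =
    integral {0..1} (\<lambda>t. vector_derivative \<gamma> (at t within {0..1}) *\<^sub>C F (\<gamma> t))"

text \<open>For entire \<open>f\<close> and \<open>g\<close> the integral from \<open>0\<close> to \<open>z\<close> does not depend on the path;
  the straight segment is used.\<close>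

definition J :: "(complex \<Rightarrow> complex) \<Rightarrow> (complex \<Rightarrow> 'a :: complex_banach) \<Rightarrow> complex \<Rightarrow> 'a"
  where "J g f z = path_integral (linepath 0 z) (\<lambda>\<zeta>. deriv g \<zeta> *\<^sub>C f \<zeta>)"


section \<open>Fock spaces\<close>

text \<open>The norms take values in the extended nonnegative reals, so that they are defined for
  every function and the spaces consist of the entire functions of finite norm.\<close>

definition fock_integral :: "real \<Rightarrow> real \<Rightarrow> (complex \<Rightarrow> 'a :: real_normed_vector) \<Rightarrow> ennreal"
  where "fock_integral p \<alpha> f =
    (\<integral>\<^sup>+ z. ennreal (norm (f z) powr p * exp (- (p * \<alpha> / 2) * (cmod z)\<^sup>2)) \<partial>lborel)"

definition fock_norm :: "real \<Rightarrow> real \<Rightarrow> (complex \<Rightarrow> 'a :: real_normed_vector) \<Rightarrow> ennreal"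
  where "fock_norm p \<alpha> f =
    (if fock_integral p \<alpha> f = \<infinity> then \<infinity>
     else ennreal (enn2real (fock_integral p \<alpha> f) powr (1 / p)))"

definition fock :: "real \<Rightarrow> real \<Rightarrow> (complex \<Rightarrow> 'a :: complex_banach) set"
  where "fock p \<alpha> = {f. entire f \<and> fock_norm p \<alpha> f < \<infinity>}"

definition weak_fock_norm ::
    "real \<Rightarrow> real \<Rightarrow> (complex \<Rightarrow> 'a :: complex_banach) \<Rightarrow> ennreal"
  where "weak_fock_norm p \<alpha> f = (SUP \<phi>\<in>dual_unit_ball. fock_norm p \<alpha> (\<phi> \<circ> f))"

definition weak_fock :: "real \<Rightarrow> real \<Rightarrow> (complex \<Rightarrow> 'a :: complex_banach) set"
  where "weak_fock p \<alpha> = {f. entire f \<and> weak_fock_norm p \<alpha> f < \<infinity>}"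

definition bounded_operator ::
    "('f \<Rightarrow> 'h) \<Rightarrow> 'f set \<Rightarrow> ('f \<Rightarrow> ennreal) \<Rightarrow> 'h set \<Rightarrow> ('h \<Rightarrow> ennreal) \<Rightarrow> bool"
  where "bounded_operator T V normV W normW \<longleftrightarrow>
    T ` V \<subseteq> W \<and> (\<exists>C::real. \<forall>f\<in>V. normW (T f) \<le> ennreal C * normV f)"

end

theory Submission
  imports Defs "HOL-Complex_Analysis.Complex_Analysis" "HOL-Probability.Distributions"
begin

text \<open>
  By the Dvoretzky--Rogers lemma \<open>X\<close> contains, for every \<open>n\<close>, vectors \<open>x\<^sub>1, \<dots>, x\<^sub>n\<close> of norm at
  least \<open>2/5\<close> with \<open>\<Sum> |x\<^sup>*(x\<^sub>i)|\<^sup>2 \<le> 1\<close> for all \<open>x\<^sup>*\<close> in the dual unit ball. Normalised reproducing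
  kernels \<open>F\<^sub>w\<close> at separated points \<open>w\<close> behave in \<open>F\<^sup>p\<close> like the unit vectors of \<open>\<ell>\<^sup>p\<close>, so functions
  \<open>\<Sum> c\<^sub>i F\<^sub>w x\<^sub>i\<close> with \<open>w = w\<^sub>i\<close> have much smaller weak than strong norm; gluing such blocks gives a
  function in \<open>wF\<^sup>p(X)\<close> outside \<open>F\<^sup>p(X)\<close>.

  Near \<open>w\<close> the function \<open>J\<^sub>g F\<^sub>w\<close> has size at least \<open>\<rho>(w) = |g'(w)| / (\<alpha>|w| + 4)\<close> up to a constant.
  With random signs and the weights \<open>c\<^sub>i = \<rho>(w\<^sub>i) powr ((2 - p) / p)\<close>, boundedness of \<open>J\<^sub>g\<close> bounds
  \<open>\<Sum> \<rho>(w)\<^sup>2\<close> uniformly over all finite separated sets. Hence \<open>\<rho>(w) \<rightarrow> 0\<close>, so \<open>g'\<close> is constant by Cauchy's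
  estimate, and it vanishes because \<open>\<Sum> 1 / (1 + |w|)\<^sup>2\<close> diverges over a planar lattice.
\<close>

section \<open>The Dvoretzky--Rogers lemma\<close>

text \<open>The primitive of \<open>g' F_w\<close> need not be concentrated near \<open>w\<close>,
  although \<open>F_w\<close> is; this obstacle shapes the treatment of \<open>J_g\<close>. The
  lower bound near \<open>w\<close> is therefore purely local: it uses the differential equation
  satisfied by \<open>J_g F_w / F_w\<close> and not the path from 0, and the term
  \<open>\<alpha>|w|\<close> in the denominator is the modulus of the logarithmic derivative of the
  kernel in that equation. The primitives belonging to the other points cannot be estimated there,
  so they are removed by averaging over signs. For the strict inclusion no primitive occurs, and
  kernels at sparse points are isolated by Gaussian decay alone. The hypothesis \<open>p < 2\<close>
  enters through Hoelder's inequality with exponents \<open>2 / (2 - p)\<close> and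
  \<open>2 / p\<close>, applied to the square-summable values \<open>x\<^sup>*(x\<^sub>i)\<close>;
  the weights \<open>c\<^sub>i\<close> are the extremal choice for it. The lower bound
  \<open>2/5\<close> only has to be independent of \<open>n\<close>.\<close>

lemma bounded_linear_scaleC_left: "bounded_linear (\<lambda>s. s *\<^sub>C (x :: 'a :: complex_normed_vector))"
  by (rule bounded_linear_intro[where K = "norm x"])
    (simp_all add: scaleC_add_left norm_scaleC scaleR_scaleC scaleC_scaleC scaleC_complex_def)

text \<open>Finite-dimensional spans are complete. In the induction, if combinations from
  \<open>B\<close> came arbitrarily close to \<open>- b\<close>, the bound for \<open>B\<close>
  would make their coefficients Cauchy, and the limit would put \<open>b\<close> into the span of
  \<open>B\<close>. In the Dvoretzky-Rogers argument this keeps volumes finite.\<close>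

lemma finite_independent_coord_bound:
  fixes B :: "'a :: complex_normed_vector set"
  assumes "finite B" "complex_vector.independent B"
  shows "\<exists>K>0. \<forall>u. \<forall>b\<in>B. cmod (u b) \<le> K * norm (\<Sum>b\<in>B. u b *\<^sub>C b)"
  using assms
proof (induction B rule: finite_induct)
  case empty
  then show ?case by (auto intro: exI[of _ 1])
next
  case (insert b B)
  have indep: "complex_vector.independent B" and nb: "b \<notin> complex_vector.span B"
    using insert.prems insert.hyps by (auto simp: complex_vector.independent_insert)
  obtain K where K: "K > 0" "\<And>u c. c \<in> B \<Longrightarrow> cmod (u c) \<le> K * norm (\<Sum>b\<in>B. u b *\<^sub>C b)"
    using insert.IH[OF indep] by blast
  have "\<exists>d>0. \<forall>u. d \<le> norm (b + (\<Sum>c\<in>B. u c *\<^sub>C c))"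
  proof (rule ccontr)
    assume "\<not> ?thesis"
    then have "\<forall>n. \<exists>u. norm (b + (\<Sum>c\<in>B. u c *\<^sub>C c)) < 1 / real (Suc n)"
      by (metis not_le of_nat_0_less_iff zero_less_Suc zero_less_divide_1_iff)
    then obtain u where u: "\<And>n. norm (b + (\<Sum>c\<in>B. u n c *\<^sub>C c)) < 1 / real (Suc n)"
      by metis
    have "convergent (\<lambda>n. u n c)" if c: "c \<in> B" for c
    proof -
      have "Cauchy (\<lambda>n. u n c)"
      proof (rule CauchyI)
        fix e :: real assume "e > 0"
        then obtain M :: nat where M: "M > 0" "1 / real M < e / (2 * K)"
          using K(1) by (metis ex_inverse_of_nat_less half_gt_zero divide_pos_pos inverse_eq_divide zero_less_numeral mult_pos_pos)
        have "cmod (u m c - u n c) < e" if "m \<ge> M" "n \<ge> M" for m n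
        proof -
          have "cmod (u m c - u n c) \<le> K * norm (\<Sum>b\<in>B. (u m b - u n b) *\<^sub>C b)"
            using K(2)[OF c, of "\<lambda>b. u m b - u n b"] .
          also have "(\<Sum>b\<in>B. (u m b - u n b) *\<^sub>C b) = (b + (\<Sum>c\<in>B. u m c *\<^sub>C c)) - (b + (\<Sum>c\<in>B. u n c *\<^sub>C c))"
            by (simp add: sum_subtractf complex_vector.scale_left_diff_distrib)
          also have "norm \<dots> \<le> norm (b + (\<Sum>c\<in>B. u m c *\<^sub>C c)) + norm (b + (\<Sum>c\<in>B. u n c *\<^sub>C c))"
            by (rule norm_triangle_ineq4)
          also have "\<dots> \<le> 1 / real M + 1 / real M"
          proof (intro add_mono)
            show "norm (b + (\<Sum>c\<in>B. u m c *\<^sub>C c)) \<le> 1 / real M"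
              by (rule order_trans[OF less_imp_le[OF u]]) (use that M in \<open>auto simp: field_simps\<close>)
            show "norm (b + (\<Sum>c\<in>B. u n c *\<^sub>C c)) \<le> 1 / real M"
              by (rule order_trans[OF less_imp_le[OF u]]) (use that M in \<open>auto simp: field_simps\<close>)
          qed
          also have "\<dots> < e / K" using M(2) K(1) by (simp add: field_simps)
          finally show ?thesis using K(1) by (simp add: field_simps)
        qed
        then show "\<exists>M. \<forall>m\<ge>M. \<forall>n\<ge>M. norm (u m c - u n c) < e" by blast
      qed
      then show ?thesis by (rule Cauchy_convergent)
    qed
    then obtain L where L: "\<And>c. c \<in> B \<Longrightarrow> (\<lambda>n. u n c) \<longlonglongrightarrow> L c"
      unfolding convergent_def by metis
    have "(\<lambda>n. b + (\<Sum>c\<in>B. u n c *\<^sub>C c)) \<longlonglongrightarrow> b + (\<Sum>c\<in>B. L c *\<^sub>C c)"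
      by (intro tendsto_intros bounded_linear.tendsto[OF bounded_linear_scaleC_left] L)
    moreover have "(\<lambda>n. b + (\<Sum>c\<in>B. u n c *\<^sub>C c)) \<longlonglongrightarrow> 0"
      by (rule Lim_null_comparison[OF _ LIMSEQ_inverse_real_of_nat])
        (use u in \<open>auto intro!: always_eventually less_imp_le simp: inverse_eq_divide\<close>)
    ultimately have "b + (\<Sum>c\<in>B. L c *\<^sub>C c) = 0"
      using LIMSEQ_unique by blast
    then have "b = - (\<Sum>c\<in>B. L c *\<^sub>C c)" by (simp add: eq_neg_iff_add_eq_0)
    moreover have "- (\<Sum>c\<in>B. L c *\<^sub>C c) \<in> complex_vector.span B"
      by (intro complex_vector.span_neg complex_vector.span_sum complex_vector.span_scale complex_vector.span_base)
    ultimately show False using nb by simp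
  qed
  then obtain d where d: "d > 0" "\<And>u. d \<le> norm (b + (\<Sum>c\<in>B. u c *\<^sub>C c))" by blast
  have 1: "cmod (u b) * d \<le> norm (\<Sum>c\<in>insert b B. u c *\<^sub>C c)" for u
  proof (cases "u b = 0")
    case False
    have "(\<Sum>c\<in>insert b B. u c *\<^sub>C c) = u b *\<^sub>C (b + (\<Sum>c\<in>B. (u c / u b) *\<^sub>C c))"
      using False insert.hyps by (simp add: scaleC_add_right complex_vector.scale_sum_right scaleC_scaleC)
    then show ?thesis using d(2)[of "\<lambda>c. u c / u b"] by (simp add: norm_scaleC mult_left_mono)
  qed simp
  \<comment> \<open>The first entry serves the new coefficient, the second the old ones, after
    \<open>u b *\<^sub>C b\<close> has been subtracted from the whole sum.\<close>
  define K' where "K' = max (1 / d) (K * (1 + norm b / d))"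
  have "cmod (u c) \<le> K' * norm (\<Sum>c\<in>insert b B. u c *\<^sub>C c)" if "c \<in> insert b B" for u c
  proof (cases "c = b")
    case True
    have "cmod (u c) \<le> (1 / d) * norm (\<Sum>c\<in>insert b B. u c *\<^sub>C c)"
      using 1[of u] d(1) True by (simp add: field_simps)
    also have "\<dots> \<le> K' * norm (\<Sum>c\<in>insert b B. u c *\<^sub>C c)"
      by (intro mult_right_mono) (auto simp: K'_def)
    finally show ?thesis .
  next
    case False
    let ?s = "\<Sum>c\<in>insert b B. u c *\<^sub>C c"
    have "cmod (u c) \<le> K * norm (\<Sum>b\<in>B. u b *\<^sub>C b)" using K(2) that False by blast
    also have "(\<Sum>b\<in>B. u b *\<^sub>C b) = ?s - u b *\<^sub>C b" using insert.hyps by simp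
    also have "norm (?s - u b *\<^sub>C b) \<le> norm ?s + cmod (u b) * norm b"
      by (metis norm_triangle_ineq4 norm_scaleC)
    also have "cmod (u b) \<le> norm ?s / d" using 1[of u] d(1) by (simp add: field_simps)
    finally have "cmod (u c) \<le> K * (norm ?s + norm ?s / d * norm b)"
      using K(1) by (simp add: mult_left_mono mult_right_mono)
    also have "\<dots> = (K * (1 + norm b / d)) * norm ?s" by (simp add: field_simps)
    also have "\<dots> \<le> K' * norm ?s"
      by (intro mult_right_mono) (auto simp: K'_def)
    finally show ?thesis .
  qed
  moreover have "K' > 0" using d(1) by (simp add: K'_def less_max_iff_disj)
  ultimately show ?case by blast
qed

text \<open>A determinant for tuples of vectors, given coordinate functionals \<open>\<phi>\<close>; the Leibniz
  formula allows the size \<open>N\<close> to vary inside a proof.\<close>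

definition tuple_det :: "nat \<Rightarrow> (nat \<Rightarrow> 'a \<Rightarrow> complex) \<Rightarrow> (nat \<Rightarrow> 'a) \<Rightarrow> complex"
  where "tuple_det N \<phi> x =
    (\<Sum>p | p permutes {..<N}. of_int (sign p) * (\<Prod>i<N. \<phi> (p i) (x i)))"

lemma tuple_det_linear:
  fixes \<phi> :: "nat \<Rightarrow> 'a :: complex_normed_vector \<Rightarrow> complex"
  assumes "k < N" "\<And>i a b u v. \<phi> i (a *\<^sub>C u + b *\<^sub>C v) = a * \<phi> i u + b * \<phi> i v"
  shows "tuple_det N \<phi> (x(k := a *\<^sub>C u + b *\<^sub>C v)) =
    a * tuple_det N \<phi> (x(k := u)) + b * tuple_det N \<phi> (x(k := v))"
proof -
  have "(\<Prod>i<N. \<phi> (p i) ((x(k := w)) i)) = \<phi> (p k) w * (\<Prod>i\<in>{..<N}-{k}. \<phi> (p i) (x i))" for p w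
    using assms(1) by (subst prod.remove[of _ k]) (auto intro!: prod.cong)
  then show ?thesis unfolding tuple_det_def
    by (simp add: assms(2) sum_distrib_left sum.distrib[symmetric] algebra_simps)
qed

lemma tuple_det_swap:
  assumes "k < N" "l < N" "k \<noteq> l"
  shows "tuple_det N \<phi> (x \<circ> Transposition.transpose k l) = - tuple_det N \<phi> x"
proof -
  let ?t = "Transposition.transpose k l"
  have t: "?t permutes {..<N}" using assms by (intro permutes_swap_id) auto
  have "tuple_det N \<phi> (x \<circ> ?t) =
    (\<Sum>p | p permutes {..<N}. of_int (sign (p \<circ> ?t)) * (\<Prod>i<N. \<phi> ((p \<circ> ?t) i) ((x \<circ> ?t) i)))"
    unfolding tuple_det_def by (rule sum_permutations_compose_right[OF t])
  also have "\<dots> = (\<Sum>p | p permutes {..<N}. - (of_int (sign p) * (\<Prod>i<N. \<phi> (p i) (x i))))"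
  proof (rule sum.cong[OF refl])
    fix p assume "p \<in> {p. p permutes {..<N}}"
    then have p: "permutation p" by (auto simp: permutation_permutes)
    have "sign (p \<circ> ?t) = - sign p"
      using p assms(3) by (simp add: sign_compose permutation_swap_id sign_swap_id)
    moreover have "(\<Prod>i<N. \<phi> ((p \<circ> ?t) i) ((x \<circ> ?t) i)) = (\<Prod>i<N. \<phi> (p i) (x i))"
      using prod.permute[OF t, of "\<lambda>i. \<phi> (p i) (x i)"] by (simp add: o_def)
    ultimately show "of_int (sign (p \<circ> ?t)) * (\<Prod>i<N. \<phi> ((p \<circ> ?t) i) ((x \<circ> ?t) i)) =
      - (of_int (sign p) * (\<Prod>i<N. \<phi> (p i) (x i)))" by simp
  qed
  finally show ?thesis by (simp add: tuple_det_def sum_negf)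
qed

text \<open>For \<open>|a|^2 + |b|^2 = 1\<close> the matrix with rows \<open>(a, b)\<close> and
  \<open>(- cnj b, cnj a)\<close> is unitary with determinant 1. Such rotations move vectors of a
  tuple without affecting its volume or its Hilbertian bound.\<close>

definition rotate_pair :: "nat \<Rightarrow> nat \<Rightarrow> complex \<Rightarrow> complex \<Rightarrow> (nat \<Rightarrow> 'a) \<Rightarrow> nat \<Rightarrow> 'a :: complex_normed_vector"
  where "rotate_pair k l a b x = x(k := a *\<^sub>C x k + b *\<^sub>C x l, l := (- cnj b) *\<^sub>C x k + cnj a *\<^sub>C x l)"

text \<open>In the slots \<open>k\<close> and \<open>l\<close> the determinant is an alternating
  bilinear form \<open>E\<close>, so the rotation multiplies it by
  \<open>a * cnj a + b * cnj b = 1\<close>.\<close>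

lemma tuple_det_rotate_pair:
  fixes \<phi> :: "nat \<Rightarrow> 'a :: complex_normed_vector \<Rightarrow> complex"
  assumes "k < N" "l < N" "k \<noteq> l" "\<And>i a b u v. \<phi> i (a *\<^sub>C u + b *\<^sub>C v) = a * \<phi> i u + b * \<phi> i v"
    and ab: "(cmod a)\<^sup>2 + (cmod b)\<^sup>2 = 1"
  shows "tuple_det N \<phi> (rotate_pair k l a b x) = tuple_det N \<phi> x"
proof -
  define E where "E u v = tuple_det N \<phi> (x(k := u, l := v))" for u v
  have E2: "E u (c *\<^sub>C v + d *\<^sub>C w) = c * E u v + d * E u w" for u v w c d
    unfolding E_def by (rule tuple_det_linear[OF assms(2,4)])
  have E1: "E (c *\<^sub>C v + d *\<^sub>C w) u = c * E v u + d * E w u" for u v w c d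
    unfolding E_def using tuple_det_linear[where \<phi> = \<phi> and x = "x(l := u)", OF assms(1,4)]
    by (simp add: fun_upd_twist[OF assms(3)])
  have Es: "E v u = - E u v" for u v
  proof -
    have "x(k := u, l := v) \<circ> Transposition.transpose k l = x(k := v, l := u)"
      using assms(3) by (auto simp: fun_eq_iff Transposition.transpose_def)
    then show ?thesis unfolding E_def using tuple_det_swap[OF assms(1-3), of \<phi> "x(k := u, l := v)"] by simp
  qed
  have E0: "E u u = 0" for u using Es[of u u] by (simp add: eq_neg_iff_add_eq_0)
  have 1: "a * cnj a + b * cnj b = 1"
    using ab by (metis complex_norm_square of_real_1 of_real_add)
  have "tuple_det N \<phi> (rotate_pair k l a b x) = E (a *\<^sub>C x k + b *\<^sub>C x l) ((- cnj b) *\<^sub>C x k + cnj a *\<^sub>C x l)"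
    by (simp add: E_def rotate_pair_def)
  also have "\<dots> = (a * cnj a + b * cnj b) * E (x k) (x l)"
    unfolding E1 E2 using Es[of "x l" "x k"] by (simp add: E0 algebra_simps)
  also have "E (x k) (x l) = tuple_det N \<phi> x" by (simp add: E_def)
  finally show ?thesis using 1 by simp
qed

lemma tuple_det_scale:
  fixes \<phi> :: "nat \<Rightarrow> 'a :: complex_normed_vector \<Rightarrow> complex"
  assumes "\<And>i a u. \<phi> i (a *\<^sub>C u) = a * \<phi> i u"
  shows "tuple_det N \<phi> (\<lambda>i. s i *\<^sub>C x i) = (\<Prod>i<N. s i) * tuple_det N \<phi> x"
  unfolding tuple_det_def by (simp add: assms prod.distrib sum_distrib_left mult_ac)

text \<open>Each of the \<open>fact N\<close> Leibniz terms has modulus at most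
  \<open>K ^ N\<close>. The crude bound is enough to make the supremum of the volumes
  finite.\<close>

lemma tuple_det_bound:
  assumes "\<And>i j. i < N \<Longrightarrow> j < N \<Longrightarrow> cmod (\<phi> i (x j)) \<le> K"
  shows "cmod (tuple_det N \<phi> x) \<le> fact N * K ^ N"
proof -
  have "cmod (tuple_det N \<phi> x) \<le> (\<Sum>p | p permutes {..<N}. K ^ N)"
    unfolding tuple_det_def
  proof (rule sum_norm_le)
    fix p assume "p \<in> {p. p permutes {..<N}}"
    then have p: "p permutes {..<N}" by simp
    have "cmod (\<Prod>i<N. \<phi> (p i) (x i)) \<le> (\<Prod>i<N. K)"
      unfolding prod_norm[symmetric]
      by (intro prod_mono) (use assms permutes_in_image[OF p] in auto)
    then show "cmod (of_int (sign p) * (\<Prod>i<N. \<phi> (p i) (x i))) \<le> K ^ N"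
      by (simp add: norm_mult sign_def)
  qed
  also have "\<dots> = fact N * K ^ N"
    by (simp add: card_permutations[of "{..<N}" N])
  finally show ?thesis .
qed

lemma tuple_det_dual_basis:
  assumes "\<And>i j. i < N \<Longrightarrow> j < N \<Longrightarrow> \<phi> i (x j) = (if i = j then 1 else 0)"
  shows "tuple_det N \<phi> x = 1"
proof -
  have "(\<Prod>i<N. \<phi> (p i) (x i)) = (if p = id then 1 else 0)" if p: "p permutes {..<N}" for p
  proof (cases "p = id")
    case False
    then obtain i where i: "p i \<noteq> i" by (auto simp: fun_eq_iff)
    then have "i < N" using p by (auto simp: permutes_def)
    moreover have "p i < N" using \<open>i < N\<close> permutes_in_image[OF p] by auto
    ultimately have "\<phi> (p i) (x i) = 0" using i assms by auto
    then show ?thesis using \<open>i < N\<close> False by (auto intro!: prod_zero)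
  qed (simp add: assms)
  then have "tuple_det N \<phi> x = (\<Sum>p | p permutes {..<N}. if p = id then 1 else 0)"
    unfolding tuple_det_def by (intro sum.cong) auto
  also have "\<dots> = 1" by (subst sum.delta) (auto simp: finite_permutations permutes_id)
  finally show ?thesis .
qed

text \<open>The tuple is the image of an orthonormal basis under a linear map of norm at most 1.\<close>

definition hilbertian :: "nat \<Rightarrow> (nat \<Rightarrow> 'a :: complex_normed_vector) \<Rightarrow> bool"
  where "hilbertian N x \<longleftrightarrow> (\<forall>a. norm (\<Sum>i<N. a i *\<^sub>C x i) \<le> L2_set (\<lambda>i. cmod (a i)) {..<N})"

section \<open>Unitary invariance of Hilbertian tuples\<close>

lemma hilbertian_norm_le:
  assumes "hilbertian N x" "k < N"
  shows "norm (x k) \<le> 1"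
proof -
  have "norm (\<Sum>i<N. (if i = k then 1 else 0) *\<^sub>C x i) \<le> L2_set (\<lambda>i. cmod (if i = k then 1 else 0)) {..<N}"
    using assms(1) unfolding hilbertian_def by (rule spec)
  moreover have "(\<Sum>i<N. (if i = k then 1 else 0) *\<^sub>C x i) = (\<Sum>i<N. if i = k then x i else 0)"
    by (intro sum.cong) auto
  moreover have "L2_set (\<lambda>i. cmod (if i = k then 1 else 0)) {..<N} = 1"
    using assms(2) unfolding L2_set_def by (simp add: if_distrib[of cmod] if_distrib[of "\<lambda>t. t\<^sup>2"] cong: if_cong)
  ultimately show ?thesis using assms(2) by simp
qed

text \<open>The coefficients of a combination change by the transposed rotation, which preserves
  their l2 norm.\<close>

lemma hilbertian_rotate_pair:
  assumes "k < N" "l < N" "k \<noteq> l" and ab: "(cmod a)\<^sup>2 + (cmod b)\<^sup>2 = 1" and x: "hilbertian N x"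
  shows "hilbertian N (rotate_pair k l a b x)"
  unfolding hilbertian_def
proof
  fix c
  define d where "d = c(k := c k * a - c l * cnj b, l := c k * b + c l * cnj a)"
  define R where "R = {..<N} - {k} - {l}"
  have split: "sum f {..<N} = f k + (f l + sum f R)" for f :: "nat \<Rightarrow> 'b :: ab_group_add"
    unfolding R_def using assms(1-3) by (simp add: sum.remove[of "{..<N}" k] sum.remove[of "{..<N} - {k}" l])
  have "(\<Sum>i\<in>R. c i *\<^sub>C rotate_pair k l a b x i) = (\<Sum>i\<in>R. d i *\<^sub>C x i)"
    by (intro sum.cong) (auto simp: R_def rotate_pair_def d_def)
  then have "(\<Sum>i<N. c i *\<^sub>C rotate_pair k l a b x i) = (\<Sum>i<N. d i *\<^sub>C x i)"
    unfolding split using assms(3)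
    by (simp add: rotate_pair_def d_def scaleC_add_right scaleC_scaleC scaleC_add_left
        complex_vector.scale_left_diff_distrib complex_vector.scale_minus_left algebra_simps)
  moreover have "(\<Sum>i<N. (cmod (d i))\<^sup>2) = (\<Sum>i<N. (cmod (c i))\<^sup>2)"
  proof -
    have "(\<Sum>i\<in>R. (cmod (d i))\<^sup>2) = (\<Sum>i\<in>R. (cmod (c i))\<^sup>2)"
      by (intro sum.cong) (auto simp: R_def d_def)
    moreover have "(cmod (c k * a - c l * cnj b))\<^sup>2 + (cmod (c k * b + c l * cnj a))\<^sup>2 =
        ((cmod (c k))\<^sup>2 + (cmod (c l))\<^sup>2) * ((cmod a)\<^sup>2 + (cmod b)\<^sup>2)"
      unfolding cmod_power2 by (simp add: power2_eq_square algebra_simps)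
    ultimately show ?thesis unfolding split using assms(3) ab by (simp add: d_def)
  qed
  ultimately show "norm (\<Sum>i<N. c i *\<^sub>C rotate_pair k l a b x i) \<le> L2_set (\<lambda>i. cmod (c i)) {..<N}"
    using x unfolding hilbertian_def L2_set_def by metis
qed

text \<open>Givens rotations in the planes \<open>(k, M)\<close> merge the coefficients from
  \<open>k\<close> on into slot \<open>k\<close>, the last one first. In this way the size of a
  whole combination becomes the size of the single vector \<open>y k\<close>.\<close>

lemma hilbertian_rotate_to:
  fixes \<phi> :: "nat \<Rightarrow> 'a :: complex_normed_vector \<Rightarrow> complex"
  assumes lin: "\<And>i a b u v. \<phi> i (a *\<^sub>C u + b *\<^sub>C v) = a * \<phi> i u + b * \<phi> i v"
    and "Suc k \<le> M" "M \<le> N" "hilbertian N x" "\<And>i. i < N \<Longrightarrow> x i \<in> complex_vector.span S"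
  shows "\<exists>y. hilbertian N y \<and> (\<forall>i<N. y i \<in> complex_vector.span S) \<and> (\<forall>i<k. y i = x i) \<and>
    tuple_det N \<phi> y = tuple_det N \<phi> x \<and>
    norm (\<Sum>i=k..<M. a i *\<^sub>C x i) = L2_set (\<lambda>i. cmod (a i)) {k..<M} * norm (y k)"
  using assms(2-)
proof (induction M arbitrary: x a rule: dec_induct)
  case base
  then show ?case by (intro exI[of _ x]) (auto simp: norm_scaleC L2_set_def)
next
  case (step M)
  define r where "r = sqrt ((cmod (a k))\<^sup>2 + (cmod (a M))\<^sup>2)"
  have kM: "k < N" "M < N" "k \<noteq> M" using step by auto
  show ?case
  proof (cases "r = 0")
    case True
    then have "a M = 0" by (auto simp: r_def add_nonneg_eq_0_iff)
    then show ?thesis using step.IH[of x a] step.prems step.hyps by (auto simp: L2_set_def)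
  next
    case False
    define x1 where "x1 = rotate_pair k M (a k / r) (a M / r) x"
    \<comment> \<open>After the rotation
      \<open>r *\<^sub>C x1 k = a k *\<^sub>C x k + a M *\<^sub>C x M\<close>, so \<open>a1\<close>
      describes the same vector on the shorter range below \<open>M\<close>, with the same l2
      norm.\<close>
    define a1 where "a1 = a(k := complex_of_real r)"
    have r: "r\<^sup>2 = (cmod (a k))\<^sup>2 + (cmod (a M))\<^sup>2" by (simp add: r_def)
    have "(cmod (a k / r))\<^sup>2 + (cmod (a M / r))\<^sup>2 = ((cmod (a k))\<^sup>2 + (cmod (a M))\<^sup>2) / r\<^sup>2"
      by (simp add: norm_divide power_divide add_divide_distrib)
    then have ab: "(cmod (a k / r))\<^sup>2 + (cmod (a M / r))\<^sup>2 = 1"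
      using False by (simp flip: r)
    have 1: "hilbertian N x1" unfolding x1_def
      by (rule hilbertian_rotate_pair[OF kM ab]) (use step in auto)
    have 2: "x1 i \<in> complex_vector.span S" if "i < N" for i
      using step.prems kM that unfolding x1_def rotate_pair_def
      by (auto intro!: complex_vector.span_add complex_vector.span_diff complex_vector.span_scale)
    have 3: "tuple_det N \<phi> x1 = tuple_det N \<phi> x" unfolding x1_def
      by (rule tuple_det_rotate_pair[OF kM lin ab])
    obtain y where y: "hilbertian N y" "\<forall>i<N. y i \<in> complex_vector.span S" "\<forall>i<k. y i = x1 i"
      "tuple_det N \<phi> y = tuple_det N \<phi> x1"
      "norm (\<Sum>i=k..<M. a1 i *\<^sub>C x1 i) = L2_set (\<lambda>i. cmod (a1 i)) {k..<M} * norm (y k)"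
      using step.IH[of x1 a1] step.prems step.hyps 1 2 by auto
    have split: "sum f {k..<Suc M} = f k + f M + sum f {Suc k..<M}" for f :: "nat \<Rightarrow> 'b :: ab_group_add"
      using step.hyps by (simp add: sum.atLeast_Suc_lessThan)
    have split': "sum f {k..<M} = f k + sum f {Suc k..<M}" for f :: "nat \<Rightarrow> 'b :: ab_group_add"
      using step.hyps by (simp add: sum.atLeast_Suc_lessThan)
    have "complex_of_real r *\<^sub>C x1 k = a k *\<^sub>C x k + a M *\<^sub>C x M"
      using False kM by (simp add: x1_def rotate_pair_def scaleC_add_right scaleC_scaleC)
    moreover have "(\<Sum>i=Suc k..<M. a1 i *\<^sub>C x1 i) = (\<Sum>i=Suc k..<M. a i *\<^sub>C x i)"
      by (intro sum.cong) (auto simp: x1_def a1_def rotate_pair_def)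
    ultimately have 4: "(\<Sum>i=k..<M. a1 i *\<^sub>C x1 i) = (\<Sum>i=k..<Suc M. a i *\<^sub>C x i)"
      unfolding split split' by (simp add: a1_def)
    have "(\<Sum>i=Suc k..<M. (cmod (a1 i))\<^sup>2) = (\<Sum>i=Suc k..<M. (cmod (a i))\<^sup>2)"
      by (intro sum.cong) (auto simp: a1_def)
    then have 5: "L2_set (\<lambda>i. cmod (a1 i)) {k..<M} = L2_set (\<lambda>i. cmod (a i)) {k..<Suc M}"
      unfolding L2_set_def split split' using r by (simp add: a1_def)
    have "\<forall>i<k. y i = x i" using y(3) step.hyps by (auto simp: x1_def rotate_pair_def)
    then show ?thesis using y 3 4 5 by metis
  qed
qed

section \<open>Tuples of nearly maximal volume\<close>

lemma exists_independent_card: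
  assumes "\<nexists>B :: 'a :: complex_banach set. finite B \<and> complex_vector.span B = UNIV"
  shows "\<exists>B :: 'a set. finite B \<and> card B = N \<and> complex_vector.independent B"
proof -
  let ?B = "complex_vector.extend_basis ({} :: 'a set)"
  have i: "complex_vector.independent {}" by (rule complex_vector.independent_empty)
  have "infinite ?B" using assms complex_vector.span_extend_basis[OF i] by blast
  then obtain B where "B \<subseteq> ?B" "finite B" "card B = N"
    by (meson infinite_arbitrarily_large)
  then show ?thesis
    using complex_vector.independent_mono[OF complex_vector.independent_extend_basis[OF i]] by blast
qed

text \<open>Doubling the vectors \<open>x\<^sub>k, x\<^sub>k\<^sub>+\<^sub>1, \<dots>\<close> costs at most a factor \<open>7/5\<close> in norm, but gains at least
  \<open>2 ^ (n + 1)\<close> in volume, while \<open>(7/5)\<^sup>2 < 2\<close>. For a tuple of nearly maximal volume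
  some combination of these vectors therefore has to be large.\<close>

lemma hilbertian_enlarge:
  fixes \<phi> :: "nat \<Rightarrow> 'a :: complex_normed_vector \<Rightarrow> complex"
  assumes x: "hilbertian (2 * n) x" and k: "k < n"
    and small: "\<And>a. norm (\<Sum>i=k..<2 * n. a i *\<^sub>C x i) \<le> 2/5 * L2_set (\<lambda>i. cmod (a i)) {k..<2 * n}"
    and lin: "\<And>i a u. \<phi> i (a *\<^sub>C u) = a * \<phi> i u"
  shows "\<exists>s. hilbertian (2 * n) (\<lambda>i. s i *\<^sub>C x i) \<and>
    2 * cmod (tuple_det (2 * n) \<phi> x) \<le> cmod (tuple_det (2 * n) \<phi> (\<lambda>i. s i *\<^sub>C x i))"
proof (intro exI conjI)
  define N where "N = 2 * n"
  \<comment> \<open>Doubling the tail costs \<open>1 + 2/5 = 7/5\<close>, so everything is divided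
    by \<open>7/5\<close>. As \<open>2 * n - k\<close> is at least \<open>n + 1\<close>, the volume
    grows at least by the factor \<open>(25/49) ^ n * 2 ^ (n + 1) = 2 * (50/49) ^ n\<close>.\<close>
  define s where "s i = (if i < k then 5/7 else 10/7 :: complex)" for i :: nat
  have un: "{..<N} = {..<k} \<union> {k..<N}" "{..<k} \<inter> {k..<N} = {}" using k by (auto simp: N_def)
  show "hilbertian (2 * n) (\<lambda>i. s i *\<^sub>C x i)"
    unfolding hilbertian_def N_def[symmetric]
  proof
    fix a
    let ?L = "L2_set (\<lambda>i. cmod (a i)) {..<N}"
    have *: "(\<Sum>i<N. a i *\<^sub>C s i *\<^sub>C x i) = (5/7) *\<^sub>C ((\<Sum>i<N. a i *\<^sub>C x i) + (\<Sum>i=k..<N. a i *\<^sub>C x i))"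
    proof -
      have "(\<Sum>i<k. a i *\<^sub>C s i *\<^sub>C x i) = (5/7) *\<^sub>C (\<Sum>i<k. a i *\<^sub>C x i)"
        by (simp add: s_def complex_vector.scale_sum_right scaleC_scaleC mult_ac)
      moreover have "(\<Sum>i=k..<N. a i *\<^sub>C s i *\<^sub>C x i) = (5/7) *\<^sub>C ((\<Sum>i=k..<N. a i *\<^sub>C x i) + (\<Sum>i=k..<N. a i *\<^sub>C x i))"
        unfolding sum.distrib[symmetric] complex_vector.scale_sum_right
        by (intro sum.cong) (auto simp: s_def scaleC_scaleC scaleC_add_left[symmetric])
      ultimately show ?thesis unfolding un(1)
        by (simp add: sum.union_disjoint[OF _ _ un(2)] scaleC_add_right)
    qed
    have "norm (\<Sum>i<N. a i *\<^sub>C s i *\<^sub>C x i) \<le> 5/7 * (?L + 2/5 * L2_set (\<lambda>i. cmod (a i)) {k..<N})"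
      unfolding * norm_scaleC using norm_triangle_mono[OF x[unfolded hilbertian_def, rule_format, of a] small[of a]]
      by (simp add: N_def)
    also have "L2_set (\<lambda>i. cmod (a i)) {k..<N} \<le> ?L"
      unfolding L2_set_def by (intro real_sqrt_le_mono sum_mono2) auto
    finally show "norm (\<Sum>i<N. a i *\<^sub>C s i *\<^sub>C x i) \<le> ?L" by simp
  qed
  have "cmod (\<Prod>i<N. s i) = (\<Prod>i<N. cmod (s i))" by (simp add: prod_norm)
  also have "\<dots> = (5/7) ^ k * (10/7) ^ (N - k)"
    unfolding un(1) by (simp add: prod.union_disjoint[OF _ _ un(2)] s_def norm_divide)
  also have "\<dots> = (5/7) ^ N * 2 ^ (N - k)"
  proof -
    have "(10/7 :: real) ^ (N - k) = (5/7) ^ (N - k) * 2 ^ (N - k)" by (simp flip: power_mult_distrib)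
    then show ?thesis using k by (simp add: N_def power_add[symmetric])
  qed
  also have "\<dots> \<ge> (5/7) ^ N * 2 ^ (Suc n)"
    using k by (intro mult_left_mono power_increasing) (auto simp: N_def)
  moreover have "(5/7 :: real) ^ N * 2 ^ (Suc n) = 2 * (50/49) ^ n"
    by (simp add: N_def power_mult power2_eq_square flip: power_mult_distrib)
  moreover have "(1 :: real) \<le> (50/49) ^ n" by (rule one_le_power) simp
  ultimately have "2 \<le> cmod (\<Prod>i<N. s i)" by linarith
  then show "2 * cmod (tuple_det (2 * n) \<phi> x) \<le> cmod (tuple_det (2 * n) \<phi> (\<lambda>i. s i *\<^sub>C x i))"
    unfolding tuple_det_scale[OF lin] norm_mult N_def by (intro mult_right_mono) auto
qed

text \<open>Vectors are made long one slot at a time. If every combination of the slots from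
  \<open>k\<close> on were short, enlarging them would double a volume already above half of the
  supremum. So some combination is long, and rotations place it in slot \<open>k\<close> while
  keeping the volume and the earlier slots. Working above half of the supremum avoids the choice of
  a maximiser.\<close>

theorem dvoretzky_rogers:
  assumes inf: "\<nexists>B :: 'a :: complex_banach set. finite B \<and> complex_vector.span B = UNIV"
  shows "\<exists>x :: nat \<Rightarrow> 'a. hilbertian n x \<and> (\<forall>i<n. 2/5 \<le> norm (x i))"
proof -
  \<comment> \<open>Twice the length asked for, so that more than \<open>n\<close> slots are free at
    each of the \<open>n\<close> stages, as \<open>hilbertian_enlarge\<close> demands.\<close>
  define N where "N = 2 * n"
  obtain B :: "'a set" where B: "finite B" "card B = N" "complex_vector.independent B"
    using exists_independent_card[OF inf] by blast
  obtain e where e: "bij_betw e {..<N} B"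
    using ex_bij_betw_nat_finite[OF B(1)] B(2) by (auto simp: atLeast0LessThan)
  \<comment> \<open>The coordinate functionals come from a basis of the whole space, so they are
    linear everywhere; on the span of \<open>B\<close> they agree with the coordinates relative to
    \<open>B\<close> and are bounded there.\<close>
  define E where "E = complex_vector.extend_basis B"
  have E: "complex_vector.independent E" "complex_vector.span E = UNIV" "B \<subseteq> E"
    unfolding E_def using complex_vector.independent_extend_basis[OF B(3)]
      complex_vector.span_extend_basis[OF B(3)] complex_vector.extend_basis_superset[OF B(3)] by simp_all
  define \<phi> where "\<phi> i u = complex_vector.representation E u (e i)" for i u
  have lin: "\<phi> i (a *\<^sub>C u + b *\<^sub>C v) = a * \<phi> i u + b * \<phi> i v" for i a b u v
    unfolding \<phi>_def using E(1,2)
    by (simp add: complex_vector.representation_add complex_vector.representation_scale)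
  have lin1: "\<phi> i (a *\<^sub>C u) = a * \<phi> i u" for i a u
    using lin[of i a u 0 u] by simp
  have dual: "\<phi> i (e j) = (if i = j then 1 else 0)" if "i < N" "j < N" for i j
  proof -
    have "e j \<in> B" using e that by (auto simp: bij_betw_def)
    then have "e j \<in> E" using E by auto
    moreover have "e i = e j \<longleftrightarrow> i = j" using e that by (auto simp: bij_betw_def inj_on_def)
    ultimately show ?thesis
      by (simp add: \<phi>_def complex_vector.representation_basis[OF E(1)] eq_commute)
  qed
  obtain K where K: "K > 0" "\<And>u c. c \<in> B \<Longrightarrow> cmod (u c) \<le> K * norm (\<Sum>b\<in>B. u b *\<^sub>C b)"
    using finite_independent_coord_bound[OF B(1,3)] by blast
  have bound: "cmod (\<phi> i u) \<le> K * norm u" if "u \<in> complex_vector.span B" "i < N" for i u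
  proof -
    have "e i \<in> B" using e that by (auto simp: bij_betw_def)
    have "complex_vector.representation E u = complex_vector.representation B u"
      by (rule complex_vector.representation_extend[OF E(1) that(1) E(3)])
    then have "cmod (\<phi> i u) \<le> K * norm (\<Sum>b\<in>B. complex_vector.representation B u b *\<^sub>C b)"
      unfolding \<phi>_def using K(2)[OF \<open>e i \<in> B\<close>] by simp
    also have "(\<Sum>b\<in>B. complex_vector.representation B u b *\<^sub>C b) = u"
      by (rule complex_vector.sum_representation_eq[OF B(3) that(1) B(1) order_refl])
    finally show ?thesis .
  qed
  define T where "T = {x. hilbertian N x \<and> (\<forall>i<N. x i \<in> complex_vector.span B)}"
  define D where "D x = cmod (tuple_det N \<phi> x)" for x
  define M where "M = Sup (D ` T)"
  have "D x \<le> fact N * K ^ N" if "x \<in> T" for x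
    unfolding D_def
  proof (rule tuple_det_bound)
    fix i j assume "i < N" "j < N"
    then have "cmod (\<phi> i (x j)) \<le> K * norm (x j)" using that bound by (auto simp: T_def)
    also have "\<dots> \<le> K * 1" using that \<open>j < N\<close> K(1) hilbertian_norm_le by (auto simp: T_def)
    finally show "cmod (\<phi> i (x j)) \<le> K" by simp
  qed
  then have bdd: "bdd_above (D ` T)" by (auto intro!: bdd_aboveI)
  \<comment> \<open>Dividing by \<open>s\<close> makes the basis Hilbertian by the triangle
    inequality, since every coefficient is at most the l2 norm. The summand 1 keeps \<open>s\<close>
    positive for \<open>n = 0\<close>. The resulting tuple shows that the supremum is
    positive.\<close>
  define s where "s = 1 + (\<Sum>i<N. norm (e i))"
  have s: "s > 0" unfolding s_def by (simp add: add_pos_nonneg sum_nonneg)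
  define x0 where "x0 i = complex_of_real (1 / s) *\<^sub>C e i" for i
  have x0T: "x0 \<in> T"
  proof -
    have "norm (\<Sum>i<N. a i *\<^sub>C x0 i) \<le> L2_set (\<lambda>i. cmod (a i)) {..<N}" for a
    proof -
      let ?L = "L2_set (\<lambda>i. cmod (a i)) {..<N}"
      have "norm (\<Sum>i<N. a i *\<^sub>C x0 i) \<le> (\<Sum>i<N. ?L * (norm (e i) / s))"
      proof (rule sum_norm_le)
        fix i assume "i \<in> {..<N}"
        then have "cmod (a i) \<le> ?L" by (intro member_le_L2_set) auto
        then show "norm (a i *\<^sub>C x0 i) \<le> ?L * (norm (e i) / s)"
          using s by (simp add: x0_def norm_scaleC norm_divide mult_right_mono divide_right_mono)
      qed
      also have "\<dots> = ?L * ((\<Sum>i<N. norm (e i)) / s)"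
        by (simp add: sum_distrib_left sum_divide_distrib)
      also have "\<dots> \<le> ?L * 1" using s
        by (intro mult_left_mono) (auto simp: s_def field_simps)
      finally show ?thesis by simp
    qed
    moreover have "x0 i \<in> complex_vector.span B" if "i < N" for i
      using e that unfolding x0_def bij_betw_def
      by (intro complex_vector.span_scale complex_vector.span_base) auto
    ultimately show ?thesis by (auto simp: T_def hilbertian_def)
  qed
  have "D x0 = (1 / s) ^ N"
    using tuple_det_scale[where \<phi> = \<phi> and N = N and s = "\<lambda>i. complex_of_real (1 / s)" and x = e, OF lin1] s
      tuple_det_dual_basis[where \<phi> = \<phi> and x = e and N = N, OF dual]
    by (simp add: D_def x0_def[abs_def] norm_power norm_divide)
  then have "D x0 > 0" using s by simp
  then have M: "M > 0" unfolding M_def using cSup_upper[OF imageI[OF x0T] bdd] by linarith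
  have "\<exists>x\<in>T. M / 2 < D x \<and> (\<forall>i<k. 2/5 \<le> norm (x i))" if "k \<le> n" for k
    using that
  proof (induction k)
    case 0
    have "M / 2 < Sup (D ` T)" using M by (simp add: M_def)
    then show ?case using less_cSup_iff[OF _ bdd, of "M / 2"] x0T by auto
  next
    case (Suc k)
    then obtain x where x: "x \<in> T" "M / 2 < D x" "\<forall>i<k. 2/5 \<le> norm (x i)" by auto
    have "\<exists>a. norm (\<Sum>i=k..<N. a i *\<^sub>C x i) > 2/5 * L2_set (\<lambda>i. cmod (a i)) {k..<N}"
    proof (rule ccontr)
      assume "\<not> ?thesis"
      then have "norm (\<Sum>i=k..<2 * n. a i *\<^sub>C x i) \<le> 2/5 * L2_set (\<lambda>i. cmod (a i)) {k..<2 * n}" for a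
        by (auto simp: N_def not_less)
      then obtain t where t: "hilbertian N (\<lambda>i. t i *\<^sub>C x i)" "2 * D x \<le> D (\<lambda>i. t i *\<^sub>C x i)"
        using hilbertian_enlarge[where \<phi> = \<phi> and n = n and x = x and k = k, OF _ _ _ lin1] x Suc.prems
        unfolding N_def D_def T_def by auto
      have "(\<lambda>i. t i *\<^sub>C x i) \<in> T" using t(1) x(1)
        by (auto simp: T_def intro!: complex_vector.span_scale)
      then have "D (\<lambda>i. t i *\<^sub>C x i) \<le> M" unfolding M_def by (intro cSup_upper bdd imageI)
      then show False using t(2) x(2) by linarith
    qed
    then obtain a where a: "norm (\<Sum>i=k..<N. a i *\<^sub>C x i) > 2/5 * L2_set (\<lambda>i. cmod (a i)) {k..<N}" by blast
    have "Suc k \<le> N" using Suc.prems by (simp add: N_def)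
    then obtain y where y: "hilbertian N y" "\<forall>i<N. y i \<in> complex_vector.span B" "\<forall>i<k. y i = x i"
      "tuple_det N \<phi> y = tuple_det N \<phi> x"
      "norm (\<Sum>i=k..<N. a i *\<^sub>C x i) = L2_set (\<lambda>i. cmod (a i)) {k..<N} * norm (y k)"
      using hilbertian_rotate_to[where \<phi> = \<phi> and k = k and N = N and x = x and S = B and a = a, OF lin _ order_refl] x(1) by (auto simp: T_def)
    have "L2_set (\<lambda>i. cmod (a i)) {k..<N} * (2/5) < L2_set (\<lambda>i. cmod (a i)) {k..<N} * norm (y k)"
      using a y(5) by (simp add: mult.commute)
    then have "2/5 \<le> norm (y k)"
      using L2_set_nonneg[of "\<lambda>i. cmod (a i)" "{k..<N}"] unfolding mult_less_cancel_left by linarith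
    then show ?case using y x by (intro bexI[of _ y]) (auto simp: T_def D_def less_Suc_eq)
  qed
  then obtain x where x: "x \<in> T" "\<forall>i<n. 2/5 \<le> norm (x i)" by blast
  have "hilbertian n x" unfolding hilbertian_def
  proof
    fix a :: "nat \<Rightarrow> complex"
    define b where "b i = (if i < n then a i else 0)" for i
    have "norm (\<Sum>i<N. b i *\<^sub>C x i) \<le> L2_set (\<lambda>i. cmod (b i)) {..<N}"
      using x(1) by (auto simp: T_def hilbertian_def)
    moreover have "(\<Sum>i<N. b i *\<^sub>C x i) = (\<Sum>i<n. a i *\<^sub>C x i)"
      by (rule sum.mono_neutral_cong_right) (auto simp: b_def N_def)
    moreover have "(\<Sum>i<N. (cmod (b i))\<^sup>2) = (\<Sum>i<n. (cmod (a i))\<^sup>2)"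
      by (rule sum.mono_neutral_cong_right) (auto simp: b_def N_def)
    ultimately show "norm (\<Sum>i<n. a i *\<^sub>C x i) \<le> L2_set (\<lambda>i. cmod (a i)) {..<n}"
      by (simp add: L2_set_def)
  qed
  then show ?thesis using x(2) by blast
qed

text \<open>Duality: with the coefficients \<open>cnj (\<phi> (x i))\<close> the functional
  evaluates to the square of the l2 norm \<open>L\<close> of its values, and the Hilbertian bound
  turns this into \<open>L\<^sup>2 \<le> L\<close>.\<close>

lemma hilbertian_dual_bound:
  assumes x: "hilbertian n x" and \<phi>: "\<phi> \<in> dual_unit_ball"
  shows "(\<Sum>i<n. (cmod (\<phi> (x i)))\<^sup>2) \<le> 1"
proof -
  let ?L = "L2_set (\<lambda>i. cmod (\<phi> (x i))) {..<n}"
  from \<phi> have lin: "bounded_linear \<phi>" "\<And>c x. \<phi> (c *\<^sub>C x) = c * \<phi> x" "onorm \<phi> \<le> 1"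
    by (auto simp: dual_unit_ball_def)
  have "\<phi> (\<Sum>i<n. cnj (\<phi> (x i)) *\<^sub>C x i) = (\<Sum>i<n. cnj (\<phi> (x i)) * \<phi> (x i))"
    by (simp add: linear_sum[OF bounded_linear.linear[OF lin(1)]] lin(2))
  also have "\<dots> = of_real (?L\<^sup>2)"
    by (simp add: L2_set_def sum_nonneg complex_norm_square mult.commute flip: complex_norm_square)
  finally have "?L\<^sup>2 = cmod (\<phi> (\<Sum>i<n. cnj (\<phi> (x i)) *\<^sub>C x i))"
    by (simp only: norm_of_real) simp
  also have "\<dots> \<le> onorm \<phi> * norm (\<Sum>i<n. cnj (\<phi> (x i)) *\<^sub>C x i)"
    by (rule onorm[OF lin(1)])
  also have "\<dots> \<le> 1 * L2_set (\<lambda>i. cmod (cnj (\<phi> (x i)))) {..<n}"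
    using x[unfolded hilbertian_def, rule_format, of "\<lambda>i. cnj (\<phi> (x i))"] lin(3)
    by (intro mult_mono) (auto simp: L2_set_nonneg)
  finally have "?L * ?L \<le> 1 * ?L" by (simp add: power2_eq_square)
  then have "?L \<le> 1" by (metis L2_set_nonneg le_numeral_extra(1) less_eq_real_def mult_le_cancel_right not_le)
  then have "?L\<^sup>2 \<le> 1" by (simp add: L2_set_nonneg power_le_one)
  then show ?thesis by (simp add: L2_set_def sum_nonneg)
qed


section \<open>Area integrals in the plane\<close>

text \<open>Both measures agree on boxes. The identification gives plane integrals access to Fubini
  in the real and imaginary parts.\<close>

lemma lborel_complex_eq_distr:
  "(lborel :: complex measure) = distr (lborel \<Otimes>\<^sub>M lborel) borel (\<lambda>(x, y). Complex x y)"
proof (rule lborel_eqI)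
  fix l u :: complex
  assume le: "\<And>b. b \<in> Basis \<Longrightarrow> l \<bullet> b \<le> u \<bullet> b"
  have meas[measurable]: "(\<lambda>(x, y). Complex x y) \<in> borel \<Otimes>\<^sub>M borel \<rightarrow>\<^sub>M borel"
    unfolding borel_prod by (intro borel_measurable_continuous_onI)
      (auto simp: Complex_eq case_prod_beta intro!: continuous_intros)
  have "(\<lambda>(x, y). Complex x y) -` box l u = {Re l<..<Re u} \<times> {Im l<..<Im u}"
    by (auto simp: box_def Basis_complex_def)
  then have "emeasure (distr (lborel \<Otimes>\<^sub>M lborel) borel (\<lambda>(x, y). Complex x y)) (box l u) =
      emeasure (lborel \<Otimes>\<^sub>M lborel) ({Re l<..<Re u} \<times> {Im l<..<Im u})"
    by (subst emeasure_distr) (auto simp: space_pair_measure)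
  also have "\<dots> = emeasure lborel {Re l<..<Re u} * emeasure lborel {Im l<..<Im u}"
    by (intro lborel.emeasure_pair_measure_Times) auto
  also have "\<dots> = (\<Prod>b\<in>Basis. (u - l) \<bullet> b)"
    using le[of 1] le[of \<i>] by (simp add: Basis_complex_def ennreal_mult')
  finally show "emeasure (distr (lborel \<Otimes>\<^sub>M lborel) borel (\<lambda>(x, y). Complex x y)) (box l u) =
    (\<Prod>b\<in>Basis. (u - l) \<bullet> b)" .
qed simp

lemma measurable_Complex[measurable (raw)]:
  assumes "f \<in> borel_measurable M" "g \<in> borel_measurable M"
  shows "(\<lambda>x. Complex (f x) (g x)) \<in> borel_measurable M"
  using assms unfolding Complex_eq by measurable

lemma nn_integral_lborel_complex:
  assumes [measurable]: "f \<in> borel_measurable borel"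
  shows "(\<integral>\<^sup>+z. f z \<partial>lborel) = (\<integral>\<^sup>+x. \<integral>\<^sup>+y. f (Complex x y) \<partial>lborel \<partial>lborel)"
  unfolding lborel_complex_eq_distr
  by (subst nn_integral_distr) (auto simp: lborel.nn_integral_fst[symmetric] case_prod_beta)

lemma nn_integral_lborel_complex_swap:
  assumes [measurable]: "f \<in> borel_measurable borel"
  shows "(\<integral>\<^sup>+z. f z \<partial>lborel) = (\<integral>\<^sup>+y. \<integral>\<^sup>+x. f (Complex x y) \<partial>lborel \<partial>lborel)"
  unfolding nn_integral_lborel_complex[OF assms]
  by (rule lborel_pair.Fubini'[symmetric]) simp

lemma nn_integral_lborel_translate:
  fixes c :: "'a :: euclidean_space"
  assumes [measurable]: "f \<in> borel_measurable borel"
  shows "(\<integral>\<^sup>+z. f (c + z) \<partial>lborel) = (\<integral>\<^sup>+z. f z \<partial>lborel)"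
  by (subst lborel_distr_plus[symmetric, of c], subst nn_integral_distr) auto

section \<open>Rotation invariance of area\<close>

lemma nn_integral_complex_shear:
  assumes [measurable]: "f \<in> borel_measurable borel"
  shows "(\<integral>\<^sup>+z. f (Complex (Re z + u * Im z) (Im z)) \<partial>lborel) = (\<integral>\<^sup>+z. f z \<partial>lborel)"
    and "(\<integral>\<^sup>+z. f (Complex (Re z) (Im z + u * Re z)) \<partial>lborel) = (\<integral>\<^sup>+z. f z \<partial>lborel)"
proof -
  have "(\<integral>\<^sup>+x. f (Complex (x + u * y) y) \<partial>lborel) = (\<integral>\<^sup>+x. f (Complex x y) \<partial>lborel)" for y
    using nn_integral_lborel_translate[of "\<lambda>x. f (Complex x y)" "u * y"] by (simp add: add.commute)
  then show "(\<integral>\<^sup>+z. f (Complex (Re z + u * Im z) (Im z)) \<partial>lborel) = (\<integral>\<^sup>+z. f z \<partial>lborel)"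
    by (simp add: nn_integral_lborel_complex_swap)
  have "(\<integral>\<^sup>+y. f (Complex x (y + u * x)) \<partial>lborel) = (\<integral>\<^sup>+y. f (Complex x y) \<partial>lborel)" for x
    using nn_integral_lborel_translate[of "\<lambda>y. f (Complex x y)" "u * x"] by (simp add: add.commute)
  then show "(\<integral>\<^sup>+z. f (Complex (Re z) (Im z + u * Re z)) \<partial>lborel) = (\<integral>\<^sup>+z. f z \<partial>lborel)"
    by (simp add: nn_integral_lborel_complex)
qed

text \<open>A rotation other than \<open>z \<mapsto> -z\<close> is a product of three shears, each of which
  preserves area by Fubini.\<close>

lemma nn_integral_complex_rotate:
  assumes [measurable]: "f \<in> borel_measurable borel" and a: "cmod a = 1"
  shows "(\<integral>\<^sup>+z. f (a * z) \<partial>lborel) = (\<integral>\<^sup>+z. f z \<partial>lborel)"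
proof -
  have main: "(\<integral>\<^sup>+z. f (a * z) \<partial>lborel) = (\<integral>\<^sup>+z. f z \<partial>lborel)"
    if [measurable]: "f \<in> borel_measurable borel" and a: "cmod a = 1" "a \<noteq> -1" for a f
  proof -
    define c s where "c = Re a" and "s = Im a"
    have cs: "c\<^sup>2 + s\<^sup>2 = 1" using a(1) by (simp add: c_def s_def cmod_power2[symmetric])
    have "c \<noteq> -1"
    proof
      assume "c = -1"
      then have "s = 0" using cs by simp
      then show False using a(2) \<open>c = -1\<close> by (auto simp: c_def s_def complex_eq_iff)
    qed
    then have c: "1 + c \<noteq> 0" by linarith
    \<comment> \<open>For \<open>a = cis t\<close> this is \<open>- tan (t / 2)\<close>: the
      rotation is a horizontal shear by \<open>u\<close>, a vertical shear by
      \<open>s = sin t\<close>, and again the first one. The denominator vanishes only at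
      \<open>a = -1\<close>, which is treated below as two quarter turns.\<close>
    define u where "u = - (s / (1 + c))"
    have us: "1 + u * s = c"
    proof -
      have "(1 + c) * (1 + u * s) = (1 + c) - s\<^sup>2" using c by (simp add: u_def field_simps power2_eq_square)
      also have "\<dots> = (1 + c) * c" using cs by (simp add: algebra_simps power2_eq_square)
      finally show ?thesis using c by simp
    qed
    have uc: "u * (1 + c) = - s" using c by (simp add: u_def)
    define h1 h2 where "h1 z = Complex (Re z + u * Im z) (Im z)"
      and "h2 z = Complex (Re z) (Im z + s * Re z)" for z
    have [measurable]: "h1 \<in> borel_measurable borel" "h2 \<in> borel_measurable borel"
      unfolding h1_def h2_def by measurable
    have "h1 (h2 (h1 z)) = a * z" for z
    proof -
      let ?x = "Re z" and ?y = "Im z"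
      have "?x + u * ?y + u * (?y + s * (?x + u * ?y)) = (1 + u * s) * ?x + u * (1 + (1 + u * s)) * ?y"
        by (simp add: algebra_simps)
      also have "\<dots> = c * ?x - s * ?y" unfolding us uc by simp
      finally have 1: "?x + u * ?y + u * (?y + s * (?x + u * ?y)) = c * ?x - s * ?y" .
      have "?y + s * (?x + u * ?y) = (1 + u * s) * ?y + s * ?x" by (simp add: algebra_simps)
      then have 2: "?y + s * (?x + u * ?y) = c * ?y + s * ?x" unfolding us .
      show ?thesis using 1 2 by (simp add: h1_def h2_def complex_eq_iff c_def s_def)
    qed
    then have "(\<integral>\<^sup>+z. f (a * z) \<partial>lborel) = (\<integral>\<^sup>+z. f (h1 (h2 (h1 z))) \<partial>lborel)" by simp
    also have "\<dots> = (\<integral>\<^sup>+z. f (h1 (h2 z)) \<partial>lborel)"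
      using nn_integral_complex_shear(1)[of "\<lambda>z. f (h1 (h2 z))" u] by (simp add: h1_def[symmetric])
    also have "\<dots> = (\<integral>\<^sup>+z. f (h1 z) \<partial>lborel)"
      using nn_integral_complex_shear(2)[of "\<lambda>z. f (h1 z)" s] by (simp add: h2_def[symmetric])
    also have "\<dots> = (\<integral>\<^sup>+z. f z \<partial>lborel)"
      using nn_integral_complex_shear(1)[of f u] by (simp add: h1_def[symmetric])
    finally show ?thesis .
  qed
  show ?thesis
  proof (cases "a = -1")
    case True
    have "(\<integral>\<^sup>+z. f (\<i> * (\<i> * z)) \<partial>lborel) = (\<integral>\<^sup>+z. f (\<i> * z) \<partial>lborel)"
      by (rule main) (auto simp: complex_eq_iff)
    also have "\<dots> = (\<integral>\<^sup>+z. f z \<partial>lborel)"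
      by (rule main) (auto simp: complex_eq_iff)
    finally show ?thesis using True by (simp add: mult.assoc[symmetric])
  qed (use main[of f a] a in auto)
qed

lemma nn_integral_gaussian_complex_finite:
  assumes "\<beta> > 0"
  shows "(\<integral>\<^sup>+z. ennreal (exp (- \<beta> * (cmod z)\<^sup>2)) \<partial>lborel) < \<infinity>"
proof -
  \<comment> \<open>With this variance the Gaussian is a multiple of a normal density.\<close>
  define \<sigma> where "\<sigma> = sqrt (1 / (2 * \<beta>))"
  have \<sigma>: "\<sigma> > 0" "\<sigma>\<^sup>2 = 1 / (2 * \<beta>)" using assms by (auto simp: \<sigma>_def)
  have eq: "exp (- (\<beta> * x\<^sup>2)) = sqrt (2 * pi * \<sigma>\<^sup>2) * normal_density 0 \<sigma> x" for x
    using \<sigma> assms by (simp add: normal_density_def field_simps)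
  interpret prob_space "density lborel (normal_density 0 \<sigma>)"
    by (rule prob_space_normal_density[OF \<sigma>(1)])
  have "(\<integral>\<^sup>+x. ennreal (normal_density 0 \<sigma> x) \<partial>lborel) = 1"
    using emeasure_space_1 by (simp add: emeasure_density)
  then have 1: "(\<integral>\<^sup>+x. ennreal (exp (- (\<beta> * x\<^sup>2))) \<partial>lborel) = ennreal (sqrt (2 * pi * \<sigma>\<^sup>2))"
    unfolding eq by (simp add: ennreal_mult nn_integral_cmult)
  have "(\<integral>\<^sup>+z. ennreal (exp (- \<beta> * (cmod z)\<^sup>2)) \<partial>lborel) =
    (\<integral>\<^sup>+x. \<integral>\<^sup>+y. ennreal (exp (- \<beta> * x\<^sup>2)) * ennreal (exp (- \<beta> * y\<^sup>2)) \<partial>lborel \<partial>lborel)"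
    by (subst nn_integral_lborel_complex)
      (auto simp: cmod_power2 ennreal_mult'[symmetric] exp_add[symmetric] algebra_simps intro!: nn_integral_cong)
  also have "\<dots> = ennreal (sqrt (2 * pi * \<sigma>\<^sup>2)) * ennreal (sqrt (2 * pi * \<sigma>\<^sup>2))"
    by (simp add: nn_integral_cmult nn_integral_multc 1)
  finally show ?thesis by (simp add: ennreal_mult_less_top)
qed

text \<open>Linear in \<open>x powr p\<close>, hence stable under sums and integrals; choosing \<open>l\<close> afterwards
  yields Jensen's and Hoelder's inequality up to a constant.\<close>

lemma le_powr_add:
  fixes x l p :: real
  assumes "0 \<le> x" "0 < l" "1 \<le> p"
  shows "x \<le> l powr (1 - p) * x powr p + l"
proof (cases "x \<le> l")
  case False
  then have "x powr (p - 1) \<ge> l powr (p - 1)" using assms by (intro powr_mono2) auto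
  then have "l powr (1 - p) * l powr (p - 1) \<le> l powr (1 - p) * x powr (p - 1)"
    by (intro mult_left_mono) auto
  moreover have "l powr (1 - p) * l powr (p - 1) = 1"
    using assms by (simp add: powr_add[symmetric])
  ultimately have "1 \<le> l powr (1 - p) * x powr (p - 1)" by simp
  then have "x * 1 \<le> x * (l powr (1 - p) * x powr (p - 1))"
    using assms by (intro mult_left_mono) auto
  also have "\<dots> = l powr (1 - p) * x powr p" using False assms by (simp add: powr_diff)
  finally show ?thesis using assms by simp
qed (use assms in \<open>simp add: add_increasing\<close>)

section \<open>Mean value estimates on circles and annuli\<close>

lemma unit_circle_mean_bound:
  assumes K: "K holomorphic_on UNIV"
  shows "cmod (K 0) \<le> integral {0..1} (\<lambda>t. cmod (K (cis (2 * pi * t))))"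
    and "cmod (deriv K 0) \<le> integral {0..1} (\<lambda>t. cmod (K (cis (2 * pi * t))))"
proof -
  have cK: "continuous_on A K" for A using K holomorphic_on_imp_continuous_on continuous_on_subset by blast
  have ci: "continuous_on {0..1} (\<lambda>t. K (cis (2 * pi * t)))"
    by (intro continuous_on_compose2[OF cK[of UNIV]]) (auto intro!: continuous_intros)
  \<comment> \<open>Cauchy's integral formula for the \<open>k\<close>-th derivative, with absolute
    values taken inside; the cases \<open>k = 0\<close> and \<open>k = 1\<close> give the two
    claims.\<close>
  have main: "cmod ((deriv ^^ k) K 0) / fact k \<le> integral {0..1} (\<lambda>t. cmod (K (cis (2 * pi * t))))" for k
  proof -
    have vd: "vector_derivative (circlepath 0 1) (at t) = 2 * pi * \<i> * cis (2 * pi * t)" for t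
      using vector_derivative_circlepath[of 0 1 t] by (simp add: cis_conv_exp mult_ac)
    have cp: "circlepath 0 1 t = cis (2 * pi * t)" for t
      by (simp add: circlepath cis_conv_exp mult_ac)
    have "2 * pi * \<i> * (deriv ^^ k) K 0 / fact k = contour_integral (circlepath 0 1) (\<lambda>u. K u / (u - 0) ^ Suc k)"
      by (subst Cauchy_contour_integral_circlepath) (auto intro: cK holomorphic_on_subset[OF K])
    also have "\<dots> = integral {0..1} (\<lambda>t. 2 * pi * \<i> * (K (cis (2 * pi * t)) / cis (2 * pi * t) ^ k))"
      unfolding contour_integral_integral by (rule integral_cong) (simp add: vd cp)
    also have "\<dots> = 2 * pi * \<i> * integral {0..1} (\<lambda>t. K (cis (2 * pi * t)) / cis (2 * pi * t) ^ k)"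
      by (rule integral_mult_right)
    finally have "2 * pi * \<i> * ((deriv ^^ k) K 0 / fact k) =
        2 * pi * \<i> * integral {0..1} (\<lambda>t. K (cis (2 * pi * t)) / cis (2 * pi * t) ^ k)"
      by simp
    then have "(deriv ^^ k) K 0 / fact k = integral {0..1} (\<lambda>t. K (cis (2 * pi * t)) / cis (2 * pi * t) ^ k)"
      by (rule mult_left_cancel[THEN iffD1, rotated]) simp
    also have "cmod \<dots> \<le> integral {0..1} (\<lambda>t. cmod (K (cis (2 * pi * t))))"
      by (rule integral_norm_bound_integral)
        (auto intro!: integrable_continuous_real continuous_intros ci simp: norm_divide norm_power)
    finally show ?thesis by (simp add: norm_divide)
  qed
  show "cmod (K 0) \<le> integral {0..1} (\<lambda>t. cmod (K (cis (2 * pi * t))))"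
    using main[of 0] by simp
  show "cmod (deriv K 0) \<le> integral {0..1} (\<lambda>t. cmod (K (cis (2 * pi * t))))"
    using main[of 1] by simp
qed

lemma emeasure_annulus_pos:
  "\<exists>m>0. emeasure lborel {z :: complex. 1/4 < cmod z \<and> cmod z < 1/2} = ennreal m"
proof -
  let ?S = "{z :: complex. 1/4 < cmod z \<and> cmod z < 1/2}"
  \<comment> \<open>Midway between the two radii, so that the ball of radius 1/8 about it stays
    inside the annulus.\<close>
  obtain c :: complex where c: "cmod c = 3/8"
    by (metis norm_of_real abs_of_nonneg zero_le_divide_iff zero_le_numeral)
  let ?B = "ball c (1/8)"
  have "?B \<subseteq> ?S"
  proof
    fix z assume "z \<in> ?B"
    then show "z \<in> ?S"
      using norm_triangle_ineq3[of c z] by (simp add: dist_norm c) linarith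
  qed
  then have "emeasure lborel ?B \<le> emeasure lborel ?S" by (intro emeasure_mono) auto
  moreover have "0 < emeasure lborel ?B"
    by (subst emeasure_ball) (auto intro!: mult_pos_pos simp: unit_ball_vol_pos)
  ultimately have "0 < emeasure lborel ?S" by (rule less_le_trans[rotated])
  moreover have "emeasure lborel ?S < \<infinity>"
    by (rule emeasure_bounded_finite) (auto intro!: boundedI[where B = 1])
  ultimately show ?thesis
    by (intro exI[of _ "enn2real (emeasure lborel ?S)"]) (auto simp: enn2real_positive_iff ennreal_enn2real_if)
qed

text \<open>The mean value property on the circles \<open>\<bar>z\<bar> = r\<close>, \<open>1/4 < r < 1/2\<close>; averaging over
  \<open>z\<close> in the annulus and using rotation invariance replaces polar coordinates.\<close>

lemma annulus_lower_bound:
  fixes p :: real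
  assumes p: "1 < p" and H: "H holomorphic_on UNIV" 
    and m: "emeasure lborel {z :: complex. 1/4 < cmod z \<and> cmod z < 1/2} = ennreal m" "m > 0"
  shows "ennreal (m * ((cmod (c * H w + deriv H w) / (cmod c + 4)) / 2) powr p) \<le>
    (\<integral>\<^sup>+z\<in>{z. 1/4 < cmod z \<and> cmod z < 1/2}. ennreal (cmod (H (w + z)) powr p) \<partial>lborel)"
proof (cases "c * H w + deriv H w = 0")
  case False
  define \<rho> where "\<rho> = cmod (c * H w + deriv H w) / (cmod c + 4)"
  have \<rho>: "\<rho> > 0" using False by (simp add: \<rho>_def divide_pos_pos add_nonneg_pos)
  let ?S = "{z :: complex. 1/4 < cmod z \<and> cmod z < 1/2}"
  have cH: "continuous_on X H" for X
    using H holomorphic_on_imp_continuous_on continuous_on_subset by blast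
  have [measurable]: "H \<in> borel_measurable borel" by (intro borel_measurable_continuous_onI cH)
  have cis[measurable]: "(\<lambda>t. cis (2 * pi * t)) \<in> borel_measurable borel"
    by (intro borel_measurable_continuous_onI continuous_intros)
  have ci: "continuous_on X (\<lambda>t. cmod (H (w + z * cis (2 * pi * t))))" for X z
    by (intro continuous_intros continuous_on_compose2[OF cH[of UNIV]]) auto
  have cip: "continuous_on X (\<lambda>t. cmod (H (w + z * cis (2 * pi * t))) powr p)" for X z
    using p by (intro continuous_on_powr' ci continuous_intros) auto
  have 1: "ennreal ((\<rho> / 2) powr p) \<le> (\<integral>\<^sup>+t\<in>{0..1}. ennreal (cmod (H (w + z * cis (2 * pi * t))) powr p) \<partial>lborel)"
    if z: "z \<in> ?S" for z
  proof -
    let ?M = "integral {0..1} (\<lambda>t. cmod (H (w + z * cis (2 * pi * t))))"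
    let ?P = "integral {0..1} (\<lambda>t. cmod (H (w + z * cis (2 * pi * t))) powr p)"
    \<comment> \<open>The unit circle is carried to the circle of radius \<open>cmod z\<close> about
      \<open>w\<close>. Since \<open>deriv K 0 = deriv H w * z\<close>, the inner radius 1/4 of the
      annulus accounts for the 4 in the denominator of \<open>\<rho>\<close>; near the centre of a
      full disc this control of the derivative would degenerate.\<close>
    define K where "K \<zeta> = H (w + z * \<zeta>)" for \<zeta>
    have K: "K holomorphic_on UNIV" unfolding K_def
      by (intro holomorphic_on_compose_gen[OF _ H, unfolded o_def]) (auto intro!: holomorphic_intros)
    have "(H has_field_derivative deriv H w) (at (w + z * 0))"
      using H by (simp add: holomorphic_derivI)
    then have "(K has_field_derivative deriv H w * z) (at 0)"
      unfolding K_def by (rule DERIV_chain2) (auto intro!: derivative_eq_intros)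
    then have dK: "deriv K 0 = deriv H w * z" by (rule DERIV_imp_deriv)
    have M1: "cmod (H w) \<le> ?M" using unit_circle_mean_bound(1)[OF K] by (simp add: K_def)
    have "cmod (deriv H w) * cmod z \<le> ?M"
      using unit_circle_mean_bound(2)[OF K] by (simp add: dK norm_mult) (simp add: K_def)
    moreover have "cmod (deriv H w) * (1/4) \<le> cmod (deriv H w) * cmod z"
      using z by (intro mult_left_mono) auto
    ultimately have M2: "cmod (deriv H w) \<le> 4 * ?M" by linarith
    have "cmod (c * H w + deriv H w) \<le> cmod c * cmod (H w) + cmod (deriv H w)"
      by (metis norm_triangle_ineq norm_mult)
    also have "\<dots> \<le> cmod c * ?M + 4 * ?M"
      using M1 M2 by (intro add_mono mult_left_mono) auto
    finally have "cmod (c * H w + deriv H w) \<le> ?M * (cmod c + 4)" by (simp add: algebra_simps)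
    moreover have "cmod c + 4 \<noteq> 0" using norm_ge_zero[of c] by linarith
    ultimately have "\<rho> * (cmod c + 4) \<le> ?M * (cmod c + 4)" by (simp add: \<rho>_def)
    then have "\<rho> \<le> ?M" by (rule mult_right_le_imp_le) (simp add: add_nonneg_pos)
    \<comment> \<open>Jensen's inequality with threshold \<open>\<rho> / 2\<close>: the additive
      term is half of \<open>\<rho>\<close> and moves to the left side.\<close>
    also have "?M \<le> integral {0..1} (\<lambda>t. (\<rho> / 2) powr (1 - p) * cmod (H (w + z * cis (2 * pi * t))) powr p + \<rho> / 2)"
      using \<rho> p by (intro integral_le integrable_continuous_real ci cip continuous_intros le_powr_add) auto
    also have "\<dots> = (\<rho> / 2) powr (1 - p) * ?P + \<rho> / 2"
      by (subst integral_add) (auto intro!: integrable_continuous_real cip continuous_intros)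
    finally have "\<rho> / 2 \<le> (\<rho> / 2) powr (1 - p) * ?P" by simp
    then have "(\<rho> / 2) powr p \<le> ?P"
      using \<rho> by (simp add: powr_diff field_simps)
    moreover have "(\<integral>\<^sup>+t\<in>{0..1}. ennreal (cmod (H (w + z * cis (2 * pi * t))) powr p) \<partial>lborel) = ennreal ?P"
      by (intro nn_integral_has_integral_lebesgue' integrable_integral integrable_continuous_real cip) auto
    ultimately show ?thesis by (simp add: ennreal_leI)
  qed
  have S[measurable]: "?S \<in> sets borel" by measurable
  have "ennreal (m * (\<rho> / 2) powr p) = (\<integral>\<^sup>+z\<in>?S. ennreal ((\<rho> / 2) powr p) \<partial>lborel)"
    using m by (simp add: nn_integral_cmult_indicator ennreal_mult mult.commute)
  also have "\<dots> \<le> (\<integral>\<^sup>+z. (\<integral>\<^sup>+t. ennreal (cmod (H (w + z * cis (2 * pi * t))) powr p) * indicator {0..1} t * indicator ?S z \<partial>lborel) \<partial>lborel)"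
    using 1 by (intro nn_integral_mono) (auto simp: nn_integral_multc indicator_def)
  also have "\<dots> = (\<integral>\<^sup>+t. (\<integral>\<^sup>+z. ennreal (cmod (H (w + z * cis (2 * pi * t))) powr p) * indicator {0..1} t * indicator ?S z \<partial>lborel) \<partial>lborel)"
    by (rule lborel_pair.Fubini') measurable
  also have "\<dots> = (\<integral>\<^sup>+t. (\<integral>\<^sup>+z\<in>?S. ennreal (cmod (H (w + z)) powr p) \<partial>lborel) * indicator {0..1} t \<partial>(lborel :: real measure))"
  proof (rule nn_integral_cong)
    fix t :: real
    have "(\<integral>\<^sup>+z. ennreal (cmod (H (w + z * cis (2 * pi * t))) powr p) * indicator {0..1} t * indicator ?S z \<partial>lborel) =
      (\<integral>\<^sup>+z. (ennreal (cmod (H (w + cis (2 * pi * t) * z)) powr p) * indicator ?S (cis (2 * pi * t) * z)) * indicator {0..1} t \<partial>lborel)"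
      by (intro nn_integral_cong) (auto simp: indicator_def norm_mult mult_ac)
    also have "\<dots> = (\<integral>\<^sup>+z. (ennreal (cmod (H (w + z)) powr p) * indicator ?S z) * indicator {0..1} t \<partial>lborel)"
      by (rule nn_integral_complex_rotate[of "\<lambda>z. (ennreal (cmod (H (w + z)) powr p) * indicator ?S z) * indicator {0..1} t"]) auto
    finally show "(\<integral>\<^sup>+z. ennreal (cmod (H (w + z * cis (2 * pi * t))) powr p) * indicator {0..1} t * indicator ?S z \<partial>lborel) =
      (\<integral>\<^sup>+z\<in>?S. ennreal (cmod (H (w + z)) powr p) \<partial>lborel) * indicator {0..1} t"
      by (simp add: nn_integral_multc)
  qed
  also have "\<dots> = (\<integral>\<^sup>+z\<in>?S. ennreal (cmod (H (w + z)) powr p) \<partial>lborel)"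
    by (simp add: nn_integral_cmult_indicator)
  finally show ?thesis by (simp add: \<rho>_def)
qed simp


section \<open>Reproducing kernels\<close>

text \<open>The kernel \<open>exp (\<alpha> cnj w z)\<close>, scaled to have weighted modulus 1 at
  \<open>w\<close>. Completing the square shows that the weighted modulus is then the Gaussian
  \<open>exp (- (\<alpha> / 2) |z - w|^2)\<close>, so in weighted modulus all kernels are translates
  of one another.\<close>

definition fock_kernel :: "real \<Rightarrow> complex \<Rightarrow> complex \<Rightarrow> complex"
  where "fock_kernel \<alpha> w z = exp (of_real \<alpha> * cnj w * z - of_real (\<alpha> / 2 * (cmod w)\<^sup>2))"

lemma fock_kernel_nonzero[simp]: "fock_kernel \<alpha> w z \<noteq> 0"
  by (simp add: fock_kernel_def)

lemma has_field_derivative_fock_kernel: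
  "(fock_kernel \<alpha> w has_field_derivative of_real \<alpha> * cnj w * fock_kernel \<alpha> w z) (at z)"
  unfolding fock_kernel_def[abs_def] by (auto intro!: derivative_eq_intros)

lemma holomorphic_fock_kernel: "fock_kernel \<alpha> w holomorphic_on A"
  unfolding fock_kernel_def[abs_def] by (intro holomorphic_intros)

lemma continuous_fock_kernel: "continuous_on A (fock_kernel \<alpha> w)"
  using holomorphic_fock_kernel holomorphic_on_imp_continuous_on by blast

lemma norm_fock_kernel:
  "cmod (fock_kernel \<alpha> w z) = exp (\<alpha> / 2 * (cmod z)\<^sup>2) * exp (- (\<alpha> / 2) * (cmod (z - w))\<^sup>2)"
proof -
  have "Re (of_real \<alpha> * cnj w * z - of_real (\<alpha> / 2 * (cmod w)\<^sup>2)) =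
      \<alpha> / 2 * (cmod z)\<^sup>2 + - (\<alpha> / 2) * (cmod (z - w))\<^sup>2"
    unfolding cmod_power2 by (simp add: power2_eq_square algebra_simps)
  then show ?thesis unfolding fock_kernel_def norm_exp_eq_Re by (simp only: exp_add)
qed

lemma norm_fock_kernel_weighted:
  "cmod (fock_kernel \<alpha> w z) * exp (- (\<alpha> / 2) * (cmod z)\<^sup>2) = exp (- (\<alpha> / 2) * (cmod (z - w))\<^sup>2)"
  unfolding norm_fock_kernel by (simp add: mult.assoc mult.left_commute flip: exp_add)

lemma fock_weight_powr:
  assumes "0 \<le> (x :: real)"
  shows "x powr p * exp (- (p * \<alpha> / 2) * r) = (x * exp (- (\<alpha> / 2) * r)) powr p"
  using assms by (simp add: powr_mult exp_powr_real mult_ac)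

text \<open>A condition on an indexed family, so that points, coefficients and vectors can share the
  index. Distance 1 makes the balls of radius 1/2, and the annuli inside them, disjoint.\<close>

definition separated :: "'i set \<Rightarrow> ('i \<Rightarrow> complex) \<Rightarrow> bool"
  where "separated I w \<longleftrightarrow> (\<forall>i\<in>I. \<forall>j\<in>I. i \<noteq> j \<longrightarrow> 1 \<le> dist (w i) (w j))"

text \<open>On the ball of radius 1/2 about \<open>w i\<close>, the \<open>i\<close>-th term is at
  most \<open>exp (\<alpha> / 8)\<close> times a Gaussian in \<open>\<zeta> - z\<close> with half
  the exponent, because \<open>(x + 1/2)^2 \<le> 2 x^2 + 1/2\<close>. The balls are disjoint, so the
  whole sum is bounded by a single integral over the plane.\<close>

lemma gaussian_sum_bound:
  assumes \<alpha>: "\<alpha> > 0"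
  shows "\<exists>B>0. \<forall>(I :: 'i set) w z. finite I \<longrightarrow> separated I w \<longrightarrow>
    (\<Sum>i\<in>I. exp (- (\<alpha> / 2) * (cmod (z - w i))\<^sup>2)) \<le> B"
proof -
  define Q where "Q = (\<integral>\<^sup>+z. ennreal (exp (- (\<alpha> / 4) * (cmod z)\<^sup>2)) \<partial>lborel)"
  have Q: "Q < \<infinity>" unfolding Q_def by (rule nn_integral_gaussian_complex_finite) (use \<alpha> in simp)
  define v where "v = unit_ball_vol 2 * (1/2 :: real)\<^sup>2"
  have v: "v > 0" by (simp add: v_def unit_ball_vol_pos)
  have vol: "emeasure lborel (ball (w :: complex) (1/2)) = ennreal v" for w
    by (simp add: emeasure_ball v_def)
  define B where "B = exp (\<alpha> / 8) * enn2real Q / v + 1"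
  have "(\<Sum>i\<in>I. exp (- (\<alpha> / 2) * (cmod (z - w i))\<^sup>2)) \<le> B"
    if fin: "finite I" and sep: "separated I w" for I :: "'i set" and w z
  proof -
    let ?G = "\<lambda>\<zeta>. exp (- (\<alpha> / 4) * (cmod \<zeta>)\<^sup>2)"
    have le: "exp (- (\<alpha> / 2) * (cmod (z - w i))\<^sup>2) \<le> exp (\<alpha> / 8) * ?G (\<zeta> - z)" if "\<zeta> \<in> ball (w i) (1/2)" for i \<zeta>
    proof -
      have "cmod (\<zeta> - z) \<le> cmod (z - w i) + 1/2"
        using that norm_triangle_ineq[of "\<zeta> - w i" "w i - z"] by (simp add: dist_norm norm_minus_commute)
      then have "(cmod (\<zeta> - z))\<^sup>2 \<le> (cmod (z - w i) + 1/2)\<^sup>2" by (intro power_mono) auto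
      also have "\<dots> \<le> 2 * (cmod (z - w i))\<^sup>2 + 1/2"
        using zero_le_power2[of "cmod (z - w i) - 1/2"] by (simp add: power2_eq_square algebra_simps)
      finally have "\<alpha> * (cmod (\<zeta> - z))\<^sup>2 \<le> \<alpha> * (2 * (cmod (z - w i))\<^sup>2 + 1/2)"
        using \<alpha> by (intro mult_left_mono) auto
      then show ?thesis unfolding exp_add[symmetric] exp_le_cancel_iff by (simp add: algebra_simps)
    qed
    have disj: "disjoint_family_on (\<lambda>i. ball (w i) (1/2)) I"
      unfolding disjoint_family_on_def
    proof (intro ballI impI)
      fix i j assume "i \<in> I" "j \<in> I" "i \<noteq> j"
      then have "1 \<le> dist (w i) (w j)" using sep by (auto simp: separated_def)
      then show "ball (w i) (1/2) \<inter> ball (w j) (1/2) = {}"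
        by (intro disjoint_ballI) simp
    qed
    have "ennreal (v * (\<Sum>i\<in>I. exp (- (\<alpha> / 2) * (cmod (z - w i))\<^sup>2))) =
        (\<Sum>i\<in>I. \<integral>\<^sup>+\<zeta>\<in>ball (w i) (1/2). ennreal (exp (- (\<alpha> / 2) * (cmod (z - w i))\<^sup>2)) \<partial>lborel)"
    proof -
      have "(\<integral>\<^sup>+\<zeta>\<in>ball (w i) (1/2). ennreal c \<partial>lborel) = ennreal (v * c)" for i c
        using v by (subst nn_integral_cmult_indicator) (simp_all add: vol ennreal_mult'' mult.commute[of v])
      then show ?thesis using v by (simp only: sum_distrib_left) (simp add: sum_ennreal)
    qed
    also have "\<dots> \<le> (\<Sum>i\<in>I. \<integral>\<^sup>+\<zeta>\<in>ball (w i) (1/2). ennreal (exp (\<alpha> / 8) * ?G (\<zeta> - z)) \<partial>lborel)"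
      using le by (intro sum_mono nn_integral_mono) (auto simp: indicator_def intro!: ennreal_leI)
    also have "\<dots> = (\<integral>\<^sup>+\<zeta>. (\<Sum>i\<in>I. ennreal (exp (\<alpha> / 8) * ?G (\<zeta> - z)) * indicator (ball (w i) (1/2)) \<zeta>) \<partial>lborel)"
      by (rule nn_integral_sum[symmetric]) (intro borel_measurable_times_ennreal borel_measurable_indicator, auto)
    also have "\<dots> \<le> (\<integral>\<^sup>+\<zeta>. ennreal (exp (\<alpha> / 8) * ?G (\<zeta> - z)) \<partial>lborel)"
    proof (intro nn_integral_mono)
      fix \<zeta>
      have "(\<Sum>i\<in>I. indicator (ball (w i) (1/2)) \<zeta> :: ennreal) = indicator (\<Union>i\<in>I. ball (w i) (1/2)) \<zeta>"
        by (rule indicator_UN_disjoint[OF fin disj, symmetric])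
      also have "\<dots> \<le> 1" by (simp add: indicator_def)
      finally show "(\<Sum>i\<in>I. ennreal (exp (\<alpha> / 8) * ?G (\<zeta> - z)) * indicator (ball (w i) (1/2)) \<zeta>) \<le>
          ennreal (exp (\<alpha> / 8) * ?G (\<zeta> - z))"
        unfolding sum_distrib_left[symmetric] by (metis mult.right_neutral mult_left_mono zero_le)
    qed
    also have "\<dots> = ennreal (exp (\<alpha> / 8)) * (\<integral>\<^sup>+\<zeta>. ennreal (?G (- z + \<zeta>)) \<partial>lborel)"
      by (simp add: ennreal_mult nn_integral_cmult)
    also have "(\<integral>\<^sup>+\<zeta>. ennreal (?G (- z + \<zeta>)) \<partial>lborel) = Q"
      unfolding Q_def by (rule nn_integral_lborel_translate[of "\<lambda>\<zeta>. ennreal (?G \<zeta>)"]) simp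
    also have "Q = ennreal (enn2real Q)" using Q by (simp add: ennreal_enn2real_if less_top)
    finally have "v * (\<Sum>i\<in>I. exp (- (\<alpha> / 2) * (cmod (z - w i))\<^sup>2)) \<le> exp (\<alpha> / 8) * enn2real Q"
      by (simp add: ennreal_mult'[symmetric] ennreal_le_iff)
    then show ?thesis using v by (simp add: B_def field_simps)
  qed
  moreover have "B > 0" using v by (simp add: B_def add_nonneg_pos)
  ultimately show ?thesis by blast
qed

text \<open>Weighted kernels are Gaussians whose sum is at most \<open>B\<close>, so Jensen's
  inequality in the index \<open>i\<close> bounds the \<open>p\<close>-th power by a sum of
  \<open>|b_i|^p\<close> times Gaussians, whose integrals do not depend on the centres. This is the
  upper half of the comparison with the sequence space.\<close>

lemma fock_kernel_sum_bound:
  assumes p: "1 < p" and \<alpha>: "\<alpha> > 0"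
  shows "\<exists>C>0. \<forall>(I :: 'i set) w b. finite I \<longrightarrow> separated I w \<longrightarrow>
    fock_integral p \<alpha> (\<lambda>z. \<Sum>i\<in>I. b i * fock_kernel \<alpha> (w i) z) \<le> ennreal (C * (\<Sum>i\<in>I. cmod (b i) powr p))"
proof -
  obtain B where B: "B > 0" "\<And>(I :: 'i set) w z. finite I \<Longrightarrow> separated I w \<Longrightarrow>
    (\<Sum>i\<in>I. exp (- (\<alpha> / 2) * (cmod (z - w i))\<^sup>2)) \<le> B"
    using gaussian_sum_bound[OF \<alpha>] by blast
  define Q where "Q = (\<integral>\<^sup>+z. ennreal (exp (- (\<alpha> / 2) * (cmod z)\<^sup>2)) \<partial>lborel)"
  have Q: "Q < \<infinity>" unfolding Q_def by (rule nn_integral_gaussian_complex_finite) (use \<alpha> in simp)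
  define D where "D = 2 * (2 * B) powr (p - 1)"
  define C where "C = D * (enn2real Q + 1)"
  have D: "D > 0" using B by (simp add: D_def)
  have "fock_integral p \<alpha> (\<lambda>z. \<Sum>i\<in>I. b i * fock_kernel \<alpha> (w i) z) \<le> ennreal (C * (\<Sum>i\<in>I. cmod (b i) powr p))"
    if fin: "finite I" and sep: "separated I w" for I :: "'i set" and w b
  proof -
    let ?G = "\<lambda>\<zeta>. exp (- (\<alpha> / 2) * (cmod \<zeta>)\<^sup>2)"
    have "cmod (\<Sum>i\<in>I. b i * fock_kernel \<alpha> (w i) z) powr p * exp (- (p * \<alpha> / 2) * (cmod z)\<^sup>2) \<le>
        D * (\<Sum>i\<in>I. cmod (b i) powr p * ?G (z - w i))" for z
    proof -
      define s where "s = (\<Sum>i\<in>I. cmod (b i) * ?G (z - w i))"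
      let ?R = "\<Sum>i\<in>I. cmod (b i) powr p * ?G (z - w i)"
      have s0: "s \<ge> 0" by (auto simp: s_def intro!: sum_nonneg)
      have "cmod (\<Sum>i\<in>I. b i * fock_kernel \<alpha> (w i) z) * ?G z \<le> (\<Sum>i\<in>I. cmod (b i * fock_kernel \<alpha> (w i) z)) * ?G z"
        by (intro mult_right_mono norm_sum) auto
      also have "\<dots> = s"
        unfolding s_def sum_distrib_right
        by (intro sum.cong refl) (simp only: norm_mult mult.assoc norm_fock_kernel_weighted)
      finally have "cmod (\<Sum>i\<in>I. b i * fock_kernel \<alpha> (w i) z) powr p * exp (- (p * \<alpha> / 2) * (cmod z)\<^sup>2) \<le> s powr p"
        unfolding fock_weight_powr[OF norm_ge_zero] using p by (intro powr_mono2) auto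
      also have "s powr p \<le> D * ?R"
      proof (cases "s = 0")
        case True
        then show ?thesis using D p by (auto intro!: mult_nonneg_nonneg sum_nonneg)
      next
        case False
        \<comment> \<open>With this threshold the additive part \<open>l * B\<close> equals
          \<open>s / 2\<close> and is absorbed on the left.\<close>
        define l where "l = s / (2 * B)"
        have l: "l > 0" using False s0 B by (simp add: l_def)
        have "s \<le> (\<Sum>i\<in>I. (l powr (1 - p) * cmod (b i) powr p + l) * ?G (z - w i))"
          unfolding s_def using l p by (intro sum_mono mult_right_mono le_powr_add) auto
        also have "\<dots> = l powr (1 - p) * ?R + l * (\<Sum>i\<in>I. ?G (z - w i))"
          by (simp add: sum_distrib_left sum.distrib algebra_simps)
        also have "l * (\<Sum>i\<in>I. ?G (z - w i)) \<le> l * B"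
          using l B(2)[OF fin sep] by (intro mult_left_mono) auto
        also have "l * B = s / 2" using B by (simp add: l_def)
        finally have "s \<le> 2 * l powr (1 - p) * ?R" by simp
        then have "s powr (p - 1) * s \<le> s powr (p - 1) * (2 * l powr (1 - p) * ?R)"
          by (intro mult_left_mono) auto
        moreover have "s powr (p - 1) * s = s powr p" using False s0 by (simp add: powr_diff)
        moreover have "s powr (p - 1) * (2 * l powr (1 - p) * ?R) = D * ?R"
        proof -
          have "s powr (p - 1) = (2 * B) powr (p - 1) * l powr (p - 1)"
            using B l by (subst powr_mult[symmetric]) (auto simp: l_def)
          moreover have "l powr (p - 1) * l powr (1 - p) = 1"
            using l by (simp add: powr_add[symmetric])
          ultimately show ?thesis by (simp add: D_def algebra_simps)
        qed
        ultimately show ?thesis by (simp only:)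
      qed
      finally show ?thesis .
    qed
    then have "fock_integral p \<alpha> (\<lambda>z. \<Sum>i\<in>I. b i * fock_kernel \<alpha> (w i) z) \<le>
        (\<integral>\<^sup>+z. ennreal (D * (\<Sum>i\<in>I. cmod (b i) powr p * ?G (z - w i))) \<partial>lborel)"
      unfolding fock_integral_def by (intro nn_integral_mono ennreal_leI)
    also have "\<dots> = (\<integral>\<^sup>+z. (\<Sum>i\<in>I. ennreal (D * cmod (b i) powr p) * ennreal (?G (- w i + z))) \<partial>lborel)"
      using D by (simp add: sum_distrib_left ennreal_mult'[symmetric] mult.assoc add.commute)
    also have "\<dots> = (\<Sum>i\<in>I. ennreal (D * cmod (b i) powr p) * (\<integral>\<^sup>+z. ennreal (?G (- w i + z)) \<partial>lborel))"
      by (subst nn_integral_sum) (auto simp: nn_integral_cmult)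
    also have "\<dots> = (\<Sum>i\<in>I. ennreal (D * cmod (b i) powr p) * Q)"
      unfolding Q_def by (subst nn_integral_lborel_translate[of "\<lambda>\<zeta>. ennreal (?G \<zeta>)"]) auto
    also have "\<dots> \<le> (\<Sum>i\<in>I. ennreal (D * cmod (b i) powr p) * ennreal (enn2real Q + 1))"
    proof (intro sum_mono mult_left_mono)
      have "Q = ennreal (enn2real Q)" using Q by (simp add: ennreal_enn2real_if less_top)
      also have "\<dots> \<le> ennreal (enn2real Q + 1)" by (intro ennreal_leI) simp
      finally show "Q \<le> ennreal (enn2real Q + 1)" .
    qed simp
    also have "\<dots> = ennreal (C * (\<Sum>i\<in>I. cmod (b i) powr p))"
    proof -
      have "ennreal (D * cmod (b i) powr p) * ennreal (enn2real Q + 1) = ennreal (C * cmod (b i) powr p)" for i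
        using D by (simp add: C_def ennreal_mult'[symmetric] mult_ac del: ennreal_plus)
      moreover have "0 \<le> C" using D by (simp add: C_def)
      ultimately show ?thesis by (simp only: sum_distrib_left) (simp add: sum_ennreal)
    qed
    finally show ?thesis .
  qed
  moreover have "C > 0" using D by (simp add: C_def add_nonneg_pos)
  ultimately show ?thesis by blast
qed

section \<open>Local lower bounds for primitives\<close>

definition annulus :: "complex \<Rightarrow> complex set"
  where "annulus w = {z. 1/4 < cmod (z - w) \<and> cmod (z - w) < 1/2}"

lemma annulus_measurable[measurable]: "annulus w \<in> sets borel"
  unfolding annulus_def by measurable

lemma emeasure_annulus: "\<exists>m>0. \<forall>w. emeasure lborel (annulus w) = ennreal m"
proof -
  obtain m where m: "m > 0" "emeasure lborel {z :: complex. 1/4 < cmod z \<and> cmod z < 1/2} = ennreal m"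
    using emeasure_annulus_pos by blast
  have "emeasure lborel (annulus w) = ennreal m" for w
  proof -
    have "emeasure lborel (annulus w) = (\<integral>\<^sup>+z. indicator (annulus w) z \<partial>lborel)" by simp
    also have "\<dots> = (\<integral>\<^sup>+z. indicator {z. 1/4 < cmod z \<and> cmod z < 1/2} (- w + z) \<partial>lborel)"
      by (intro nn_integral_cong) (simp add: annulus_def indicator_def)
    also have "\<dots> = (\<integral>\<^sup>+z. indicator {z. 1/4 < cmod z \<and> cmod z < 1/2} z \<partial>lborel)"
      by (rule nn_integral_lborel_translate) measurable
    finally show ?thesis using m by simp
  qed
  then show ?thesis using m by blast
qed

text \<open>The quotient \<open>H\<close> of \<open>u\<close> by the kernel solves
  \<open>H' + \<alpha> cnj w H = h\<close>, so the mean value estimate with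
  \<open>c = \<alpha> cnj w\<close> sees exactly \<open>h w\<close> at the centre. Multiplying back
  by the kernel costs \<open>exp (- (p * \<alpha> / 2) * (1/2)\<^sup>2)\<close>, a lower bound on
  the annulus for the \<open>p\<close>-th power of the Gaussian. The estimate is insensitive to the
  constant of integration in \<open>u\<close>.\<close>

lemma primitive_lower_bound:
  assumes p: "1 < p" and \<alpha>: "\<alpha> > 0"
  shows "\<exists>c>0. \<forall>w h u. (\<forall>z. (u has_field_derivative h z * fock_kernel \<alpha> w z) (at z)) \<longrightarrow>
    ennreal (c * (cmod (h w) / (\<alpha> * cmod w + 4)) powr p) \<le>
    (\<integral>\<^sup>+z\<in>annulus w. ennreal (cmod (u z) powr p * exp (- (p * \<alpha> / 2) * (cmod z)\<^sup>2)) \<partial>lborel)"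
proof -
  obtain m where m: "m > 0" "emeasure lborel {z :: complex. 1/4 < cmod z \<and> cmod z < 1/2} = ennreal m"
    using emeasure_annulus_pos by blast
  let ?S = "{z :: complex. 1/4 < cmod z \<and> cmod z < 1/2}"
  define c where "c = exp (- (p * \<alpha> / 2) * (1/2)\<^sup>2) * m * (1/2) powr p"
  have "ennreal (c * (cmod (h w) / (\<alpha> * cmod w + 4)) powr p) \<le>
    (\<integral>\<^sup>+z\<in>annulus w. ennreal (cmod (u z) powr p * exp (- (p * \<alpha> / 2) * (cmod z)\<^sup>2)) \<partial>lborel)"
    if u: "\<And>z. (u has_field_derivative h z * fock_kernel \<alpha> w z) (at z)" for w h u
  proof -
    define H where "H z = u z / fock_kernel \<alpha> w z" for z
    have hu: "u holomorphic_on UNIV" using u by (auto simp: holomorphic_on_open)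
    then have H: "H holomorphic_on UNIV" unfolding H_def[abs_def]
      by (intro holomorphic_intros holomorphic_fock_kernel) auto
    have cu: "continuous_on UNIV u" using hu by (rule holomorphic_on_imp_continuous_on)
    have [measurable]: "u \<in> borel_measurable borel" by (rule borel_measurable_continuous_onI[OF cu])
    have cH: "continuous_on UNIV H" using H by (rule holomorphic_on_imp_continuous_on)
    have [measurable]: "H \<in> borel_measurable borel" by (rule borel_measurable_continuous_onI[OF cH])
    have "(H has_field_derivative h w - of_real \<alpha> * cnj w * H w) (at w)"
      unfolding H_def[abs_def]
      by (rule derivative_eq_intros u has_field_derivative_fock_kernel refl)+ (auto simp: field_simps)
    then have dH: "of_real \<alpha> * cnj w * H w + deriv H w = h w"
      using DERIV_imp_deriv by fastforce
    have nc: "cmod (of_real \<alpha> * cnj w) = \<alpha> * cmod w" using \<alpha> by (simp add: norm_mult)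
    have "ennreal (c * (cmod (h w) / (\<alpha> * cmod w + 4)) powr p) =
        ennreal (exp (- (p * \<alpha> / 2) * (1/2)\<^sup>2)) * ennreal (m * ((cmod (h w) / (\<alpha> * cmod w + 4)) / 2) powr p)"
    proof -
      define \<rho> where "\<rho> = cmod (h w) / (\<alpha> * cmod w + 4)"
      have "\<rho> \<ge> 0" using \<alpha> by (simp add: \<rho>_def)
      then have "(\<rho> / 2) powr p = (1/2) powr p * \<rho> powr p"
        using powr_mult[of "1/2" \<rho> p] by simp
      then show ?thesis unfolding \<rho>_def[symmetric] using m
        by (simp only: c_def) (simp add: ennreal_mult'[symmetric] mult_ac)
    qed
    also have "\<dots> \<le> ennreal (exp (- (p * \<alpha> / 2) * (1/2)\<^sup>2)) * (\<integral>\<^sup>+z\<in>?S. ennreal (cmod (H (w + z)) powr p) \<partial>lborel)"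
      using annulus_lower_bound[OF p H m(2,1), of "of_real \<alpha> * cnj w" w] unfolding dH nc
      by (intro mult_left_mono) auto
    also have "\<dots> = (\<integral>\<^sup>+z\<in>?S. ennreal (exp (- (p * \<alpha> / 2) * (1/2)\<^sup>2)) * ennreal (cmod (H (w + z)) powr p) \<partial>lborel)"
      by (subst nn_integral_cmult[symmetric]) (auto simp: mult.assoc)
    also have "\<dots> \<le> (\<integral>\<^sup>+z\<in>?S. ennreal (cmod (u (w + z)) powr p * exp (- (p * \<alpha> / 2) * (cmod (w + z))\<^sup>2)) \<partial>lborel)"
    proof (intro nn_integral_mono)
      fix z
      have "ennreal (exp (- (p * \<alpha> / 2) * (1/2)\<^sup>2)) * ennreal (cmod (H (w + z)) powr p) \<le>
        ennreal (cmod (u (w + z)) powr p * exp (- (p * \<alpha> / 2) * (cmod (w + z))\<^sup>2))" if z: "z \<in> ?S"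
      proof -
        have "cmod (u (w + z)) powr p * exp (- (p * \<alpha> / 2) * (cmod (w + z))\<^sup>2) =
            (cmod (H (w + z)) * (cmod (fock_kernel \<alpha> w (w + z)) * exp (- (\<alpha> / 2) * (cmod (w + z))\<^sup>2))) powr p"
          unfolding fock_weight_powr[OF norm_ge_zero] by (simp add: H_def norm_divide)
        also have "\<dots> = cmod (H (w + z)) powr p * exp (- (p * \<alpha> / 2) * (cmod z)\<^sup>2)"
          unfolding norm_fock_kernel_weighted fock_weight_powr[OF norm_ge_zero] by simp
        also have "\<dots> \<ge> cmod (H (w + z)) powr p * exp (- (p * \<alpha> / 2) * (1/2)\<^sup>2)"
        proof -
          have "(cmod z)\<^sup>2 \<le> (1/2)\<^sup>2" using z by (intro power_mono) auto
          then show ?thesis using p \<alpha> by (intro mult_left_mono) (auto intro!: mult_left_mono)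
        qed
        finally show ?thesis by (simp add: ennreal_mult'[symmetric] mult.commute)
      qed
      then show "ennreal (exp (- (p * \<alpha> / 2) * (1/2)\<^sup>2)) * ennreal (cmod (H (w + z)) powr p) * indicator ?S z \<le>
        ennreal (cmod (u (w + z)) powr p * exp (- (p * \<alpha> / 2) * (cmod (w + z))\<^sup>2)) * indicator ?S z"
        by (simp add: indicator_def)
    qed
    also have "\<dots> = (\<integral>\<^sup>+z. (\<lambda>z. ennreal (cmod (u z) powr p * exp (- (p * \<alpha> / 2) * (cmod z)\<^sup>2)) * indicator (annulus w) z) (w + z) \<partial>lborel)"
      by (intro nn_integral_cong) (simp add: annulus_def indicator_def)
    also have "\<dots> = (\<integral>\<^sup>+z\<in>annulus w. ennreal (cmod (u z) powr p * exp (- (p * \<alpha> / 2) * (cmod z)\<^sup>2)) \<partial>lborel)"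
      by (rule nn_integral_lborel_translate) measurable
    finally show ?thesis .
  qed
  moreover have "c > 0" using m by (simp add: c_def)
  ultimately show ?thesis by blast
qed


section \<open>Boundedness of the integration operator\<close>

lemma fock_norm_le:
  assumes "fock_integral p \<alpha> f \<le> ennreal K" "0 \<le> K" "0 < p"
  shows "fock_norm p \<alpha> f \<le> ennreal (K powr (1 / p))"
proof -
  have "fock_integral p \<alpha> f \<noteq> \<infinity>" using assms(1) by (auto simp: top_unique)
  moreover have "enn2real (fock_integral p \<alpha> f) \<le> K"
    using assms(1,2) by (rule enn2real_leI[rotated])
  ultimately show ?thesis using assms(3)
    by (auto simp: fock_norm_def intro!: ennreal_leI powr_mono2)
qed

lemma fock_integral_le:
  assumes "fock_norm p \<alpha> f \<le> ennreal M" "0 < p"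
  shows "fock_integral p \<alpha> f \<le> ennreal (M powr p)"
proof -
  let ?I = "fock_integral p \<alpha> f"
  have fin: "?I \<noteq> \<infinity>" using assms(1) by (auto simp: fock_norm_def top_unique)
  \<comment> \<open>The second alternative covers negative \<open>M\<close>, for which
    \<open>ennreal M\<close> is 0.\<close>
  then have 1: "enn2real ?I powr (1 / p) \<le> M \<or> enn2real ?I powr (1 / p) = 0"
    using assms(1) by (auto simp: fock_norm_def ennreal_le_iff2)
  have "enn2real ?I = (enn2real ?I powr (1 / p)) powr p"
    using assms(2) by (simp add: powr_powr)
  also have "\<dots> \<le> M powr p" using 1 assms(2) by (auto intro: powr_mono2)
  finally show ?thesis using fin by (metis ennreal_enn2real_if ennreal_leI infinity_ennreal_def)
qed

lemma fock_norm_mono: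
  assumes "fock_integral p \<alpha> f \<le> fock_integral p \<alpha> h" "0 < p"
  shows "fock_norm p \<alpha> f \<le> fock_norm p \<alpha> h"
proof (cases "fock_integral p \<alpha> h = \<infinity>")
  case False
  then have h: "fock_integral p \<alpha> h = ennreal (enn2real (fock_integral p \<alpha> h))"
    by (simp add: ennreal_enn2real_if)
  have "fock_norm p \<alpha> f \<le> ennreal (enn2real (fock_integral p \<alpha> h) powr (1 / p))"
    using assms h by (intro fock_norm_le) auto
  then show ?thesis using False by (simp add: fock_norm_def)
qed (simp add: fock_norm_def)

section \<open>Finite combinations of vectors with entire coefficients\<close>

lemma entire_sum_scaleC:
  assumes "\<And>i. i \<in> I \<Longrightarrow> F i holomorphic_on UNIV"
  shows "entire (\<lambda>z. \<Sum>i\<in>I. F i z *\<^sub>C x i)"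
  unfolding entire_def
proof (intro allI exI)
  fix z
  have "inverse (w - z) *\<^sub>C ((\<Sum>i\<in>I. F i w *\<^sub>C x i) - (\<Sum>i\<in>I. F i z *\<^sub>C x i)) =
      (\<Sum>i\<in>I. ((F i w - F i z) / (w - z)) *\<^sub>C x i)" for w
    by (simp add: sum_subtractf[symmetric] complex_vector.scale_sum_right scaleC_scaleC
        complex_vector.scale_left_diff_distrib[symmetric] divide_inverse mult.commute)
  moreover have "((\<lambda>w. \<Sum>i\<in>I. ((F i w - F i z) / (w - z)) *\<^sub>C x i) \<longlongrightarrow> (\<Sum>i\<in>I. deriv (F i) z *\<^sub>C x i)) (at z)"
  proof (intro tendsto_sum bounded_linear.tendsto[OF bounded_linear_scaleC_left])
    fix i assume "i \<in> I"
    then have "(F i has_field_derivative deriv (F i) z) (at z)"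
      by (intro holomorphic_derivI[OF assms open_UNIV UNIV_I])
    then show "((\<lambda>w. (F i w - F i z) / (w - z)) \<longlongrightarrow> deriv (F i) z) (at z)"
      by (simp add: has_field_derivative_iff)
  qed
  ultimately show "((\<lambda>w. inverse (w - z) *\<^sub>C ((\<Sum>i\<in>I. F i w *\<^sub>C x i) - (\<Sum>i\<in>I. F i z *\<^sub>C x i)))
      \<longlongrightarrow> (\<Sum>i\<in>I. deriv (F i) z *\<^sub>C x i)) (at z)" by simp
qed

text \<open>The fundamental theorem of calculus along the segment, one coefficient at a time;
  \<open>u i 0 = 0\<close> selects the right primitive.\<close>

lemma J_sum_scaleC:
  fixes x :: "'i \<Rightarrow> 'a :: complex_banach"
  assumes u: "\<And>i z. i \<in> I \<Longrightarrow> (u i has_field_derivative deriv g z * F i z) (at z)"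
    and u0: "\<And>i. i \<in> I \<Longrightarrow> u i 0 = 0"
    and fin: "finite I"
  shows "J g (\<lambda>z. \<Sum>i\<in>I. F i z *\<^sub>C x i) z = (\<Sum>i\<in>I. u i z *\<^sub>C x i)"
proof -
  have 1: "((\<lambda>t. (z * (deriv g (linepath 0 z t) * F i (linepath 0 z t))) *\<^sub>C x i) has_integral u i z *\<^sub>C x i) {0..1}"
    if i: "i \<in> I" for i
  proof -
    have "((\<lambda>t. z * (deriv g (linepath 0 z t) * F i (linepath 0 z t))) has_integral u i (linepath 0 z 1) - u i (linepath 0 z 0)) {0..1}"
    proof (rule fundamental_theorem_of_calculus)
      fix t :: real
      have "((u i \<circ> linepath 0 z) has_vector_derivative (z - 0) * (deriv g (linepath 0 z t) * F i (linepath 0 z t))) (at t within {0..1})"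
        by (rule field_vector_diff_chain_within[OF has_vector_derivative_linepath_within DERIV_subset[OF u[OF i]]]) simp
      then show "((\<lambda>t. u i (linepath 0 z t)) has_vector_derivative z * (deriv g (linepath 0 z t) * F i (linepath 0 z t))) (at t within {0..1})"
        by (simp add: o_def)
    qed simp
    then have "((\<lambda>t. z * (deriv g (linepath 0 z t) * F i (linepath 0 z t))) has_integral u i z) {0..1}"
      by (simp add: u0[OF i])
    from has_integral_linear[OF this bounded_linear_scaleC_left[of "x i"]] show ?thesis by (simp add: o_def)
  qed
  have "((\<lambda>t. \<Sum>i\<in>I. (z * (deriv g (linepath 0 z t) * F i (linepath 0 z t))) *\<^sub>C x i) has_integral (\<Sum>i\<in>I. u i z *\<^sub>C x i)) {0..1}"
    by (rule has_integral_sum[OF fin 1])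
  then have "((\<lambda>t. vector_derivative (linepath 0 z) (at t within {0..1}) *\<^sub>C
      deriv g (linepath 0 z t) *\<^sub>C (\<Sum>i\<in>I. F i (linepath 0 z t) *\<^sub>C x i)) has_integral (\<Sum>i\<in>I. u i z *\<^sub>C x i)) {0..1}"
    by (rule has_integral_eq[rotated])
      (simp add: vector_derivative_linepath_within complex_vector.scale_sum_right scaleC_scaleC mult.assoc)
  then show ?thesis unfolding J_def path_integral_def by (rule integral_unique)
qed

text \<open>Sign patterns are paired so that the two sums of a pair add up to twice
  \<open>v j\<close>, up to sign; one of them is therefore at least as large as \<open>v j\<close>.
  This extracts a single term in any normed space, without an estimate for the others.\<close>

lemma sum_signs_lower_bound:
  fixes v :: "'i \<Rightarrow> 'a :: real_normed_vector"
  assumes "finite I" "j \<in> I" "0 \<le> p"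
  shows "2 ^ card I * norm (v j) powr p \<le> 2 * (\<Sum>A\<in>Pow I. norm (\<Sum>i\<in>I. if i \<in> A then v i else - v i) powr p)"
proof -
  define S where "S A = (\<Sum>i\<in>I. if i \<in> A then v i else - v i)" for A
  \<comment> \<open>\<open>\<sigma>\<close> flips all signs except the one of \<open>v j\<close>\<close>
  define \<sigma> where "\<sigma> A = {i \<in> I. (i \<in> A) = (i = j)}" for A
  have bij: "bij_betw \<sigma> (Pow I) (Pow I)"
    by (rule bij_betwI[where g = \<sigma>]) (auto simp: \<sigma>_def)
  have "norm (v j) powr p \<le> norm (S A) powr p + norm (S (\<sigma> A)) powr p" for A
  proof -
    have "S A + S (\<sigma> A) = (\<Sum>i\<in>I. if i = j then 2 *\<^sub>R (if j \<in> A then v j else - v j) else 0)"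
      unfolding S_def sum.distrib[symmetric] by (intro sum.cong) (auto simp: \<sigma>_def scaleR_2)
    also have "\<dots> = 2 *\<^sub>R (if j \<in> A then v j else - v j)" using assms by simp
    finally have "2 * norm (v j) = norm (S A + S (\<sigma> A))" by simp
    also have "\<dots> \<le> norm (S A) + norm (S (\<sigma> A))" by (rule norm_triangle_ineq)
    finally have "norm (v j) \<le> norm (S A) \<or> norm (v j) \<le> norm (S (\<sigma> A))" by linarith
    then have "norm (v j) powr p \<le> norm (S A) powr p \<or> norm (v j) powr p \<le> norm (S (\<sigma> A)) powr p"
      using powr_mono2[OF assms(3) norm_ge_zero] by blast
    then show ?thesis
      using powr_ge_zero[of "norm (S A)" p] powr_ge_zero[of "norm (S (\<sigma> A))" p] by linarith
  qed
  then have "(\<Sum>A\<in>Pow I. norm (v j) powr p) \<le> (\<Sum>A\<in>Pow I. norm (S A) powr p + norm (S (\<sigma> A)) powr p)"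
    by (intro sum_mono) auto
  also have "\<dots> = 2 * (\<Sum>A\<in>Pow I. norm (S A) powr p)"
    using sum.reindex_bij_betw[OF bij, of "\<lambda>A. norm (S A) powr p"] by (simp add: sum.distrib)
  finally show ?thesis using assms(1) by (simp add: card_Pow S_def)
qed

text \<open>Hoelder's inequality with exponents \<open>2 / (2 - p)\<close> and \<open>2 / p\<close>,
  up to a factor 2. Since \<open>1 - p / 2\<close> and \<open>p / 2\<close> add up to 1, each term
  is, up to the power of \<open>L\<close>, at most the larger of
  \<open>(\<rho> i)\<^sup>2 / L\<close> and \<open>(t i)\<^sup>2\<close>, hence at most their
  sum.\<close>

lemma weighted_powr_sum_bound:
  fixes \<rho> t :: "'i \<Rightarrow> real"
  assumes p: "0 < p" "p < 2" and nn: "\<And>i. i \<in> I \<Longrightarrow> 0 \<le> \<rho> i" "\<And>i. i \<in> I \<Longrightarrow> 0 \<le> t i"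
    and L: "L = (\<Sum>i\<in>I. (\<rho> i)\<^sup>2)" "L > 0" and t: "(\<Sum>i\<in>I. (t i)\<^sup>2) \<le> 1"
  shows "(\<Sum>i\<in>I. \<rho> i powr (2 - p) * t i powr p) \<le> 2 * L powr (1 - p / 2)"
proof -
  have sq: "(y\<^sup>2) powr a = y powr (2 * a)" if "0 \<le> y" for y a :: real
    using that by (cases "y = 0") (auto simp: powr_powr simp flip: powr_numeral)
  have "\<rho> i powr (2 - p) * t i powr p \<le> L powr (1 - p / 2) * ((\<rho> i)\<^sup>2 / L + (t i)\<^sup>2)" if i: "i \<in> I" for i
  proof -
    define m where "m = max ((\<rho> i)\<^sup>2 / L) ((t i)\<^sup>2)"
    have m: "m \<ge> 0" by (simp add: m_def le_max_iff_disj)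
    have "\<rho> i powr (2 - p) = ((\<rho> i)\<^sup>2) powr (1 - p / 2)" using nn[OF i] by (simp add: sq)
    also have "\<dots> = (L * ((\<rho> i)\<^sup>2 / L)) powr (1 - p / 2)" using L(2) by simp
    also have "\<dots> = L powr (1 - p / 2) * ((\<rho> i)\<^sup>2 / L) powr (1 - p / 2)" by (rule powr_mult)
    also have "\<dots> \<le> L powr (1 - p / 2) * m powr (1 - p / 2)"
      using p L(2) by (intro mult_left_mono powr_mono2) (auto simp: m_def)
    finally have 1: "\<rho> i powr (2 - p) \<le> L powr (1 - p / 2) * m powr (1 - p / 2)" .
    have "t i powr p = ((t i)\<^sup>2) powr (p / 2)" using nn[OF i] by (simp add: sq)
    also have "\<dots> \<le> m powr (p / 2)" using p by (intro powr_mono2) (auto simp: m_def)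
    finally have 2: "t i powr p \<le> m powr (p / 2)" .
    have "\<rho> i powr (2 - p) * t i powr p \<le> L powr (1 - p / 2) * m powr (1 - p / 2) * m powr (p / 2)"
      by (intro mult_mono 1 2) auto
    also have "\<dots> = L powr (1 - p / 2) * m"
      using m by (cases "m = 0") (auto simp: mult.assoc simp flip: powr_add)
    also have "m \<le> (\<rho> i)\<^sup>2 / L + (t i)\<^sup>2" using L(2) by (simp add: m_def)
    finally show ?thesis by (simp add: mult_left_mono)
  qed
  then have "(\<Sum>i\<in>I. \<rho> i powr (2 - p) * t i powr p) \<le> (\<Sum>i\<in>I. L powr (1 - p / 2) * ((\<rho> i)\<^sup>2 / L + (t i)\<^sup>2))"
    by (rule sum_mono)
  also have "\<dots> = L powr (1 - p / 2) * (1 + (\<Sum>i\<in>I. (t i)\<^sup>2))"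
    using L by (simp add: sum_distrib_left[symmetric] sum.distrib sum_divide_distrib[symmetric])
  also have "\<dots> \<le> L powr (1 - p / 2) * 2" using t by (intro mult_left_mono) auto
  finally show ?thesis by simp
qed

lemma dual_unit_ball_scaleC_sum:
  assumes "\<phi> \<in> dual_unit_ball"
  shows "\<phi> (\<Sum>i\<in>I. a i *\<^sub>C x i) = (\<Sum>i\<in>I. a i * \<phi> (x i))"
proof -
  from assms have "linear \<phi>" "\<And>c x. \<phi> (c *\<^sub>C x) = c * \<phi> x"
    by (auto simp: dual_unit_ball_def bounded_linear.linear)
  then show ?thesis by (simp add: linear_sum)
qed

lemma dual_unit_ball_norm_le:
  assumes "\<phi> \<in> dual_unit_ball"
  shows "cmod (\<phi> x) \<le> norm x"
proof -
  from assms have "bounded_linear \<phi>" "onorm \<phi> \<le> 1" by (auto simp: dual_unit_ball_def)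
  then show ?thesis using onorm[of \<phi> x] mult_right_mono[of "onorm \<phi>" 1 "norm x"] by auto
qed

text \<open>A functional turns the vectors into coefficients \<open>b i * \<phi> (x i)\<close> of a
  scalar kernel sum, to which Hoelder and the l2 bound for \<open>\<phi> (x i)\<close> apply. Only
  the moduli of \<open>b\<close> are prescribed, which leaves room for arbitrary signs.\<close>

lemma kernel_test_function_weak_norm:
  fixes x :: "nat \<Rightarrow> 'a :: complex_banach"
  assumes p: "1 < p" "p < 2"
    and C: "\<And>(I :: nat set) w b. finite I \<Longrightarrow> separated I w \<Longrightarrow>
      fock_integral p \<alpha> (\<lambda>z. \<Sum>i\<in>I. b i * fock_kernel \<alpha> (w i) z) \<le> ennreal (C * (\<Sum>i\<in>I. cmod (b i) powr p))"
      "C > 0"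
    and x: "hilbertian n x" and w: "separated {..<n} w"
    and \<rho>: "\<And>i. 0 \<le> \<rho> i" and L: "L = (\<Sum>i<n. (\<rho> i)\<^sup>2)" "L > 0"
    and b: "\<And>i. cmod (b i) = \<rho> i powr ((2 - p) / p)"
  shows "weak_fock_norm p \<alpha> (\<lambda>z. \<Sum>i<n. (b i * fock_kernel \<alpha> (w i) z) *\<^sub>C x i) \<le>
    ennreal ((2 * C * L powr (1 - p / 2)) powr (1 / p))"
  unfolding weak_fock_norm_def
proof (rule SUP_least)
  fix \<phi> :: "'a \<Rightarrow> complex" assume \<phi>: "\<phi> \<in> dual_unit_ball"
  have "\<phi> \<circ> (\<lambda>z. \<Sum>i<n. (b i * fock_kernel \<alpha> (w i) z) *\<^sub>C x i) =
      (\<lambda>z. \<Sum>i<n. (b i * \<phi> (x i)) * fock_kernel \<alpha> (w i) z)"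
    by (auto simp: fun_eq_iff dual_unit_ball_scaleC_sum[OF \<phi>] mult_ac)
  moreover have "fock_integral p \<alpha> (\<lambda>z. \<Sum>i<n. (b i * \<phi> (x i)) * fock_kernel \<alpha> (w i) z) \<le>
      ennreal (C * (\<Sum>i<n. cmod (b i * \<phi> (x i)) powr p))"
    by (rule C(1)[OF _ w]) simp
  moreover have "C * (\<Sum>i<n. cmod (b i * \<phi> (x i)) powr p) \<le> 2 * C * L powr (1 - p / 2)"
  proof -
    have "(\<Sum>i<n. cmod (b i * \<phi> (x i)) powr p) = (\<Sum>i<n. \<rho> i powr (2 - p) * cmod (\<phi> (x i)) powr p)"
      using p by (simp add: norm_mult b powr_mult powr_powr)
    also have "\<dots> \<le> 2 * L powr (1 - p / 2)"
      by (rule weighted_powr_sum_bound[OF _ p(2) _ _ L]) (use p \<rho> hilbertian_dual_bound[OF x \<phi>] in auto)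
    finally show ?thesis using C(2) by (simp add: mult_left_mono)
  qed
  ultimately show "fock_norm p \<alpha> (\<phi> \<circ> (\<lambda>z. \<Sum>i<n. (b i * fock_kernel \<alpha> (w i) z) *\<^sub>C x i)) \<le>
      ennreal ((2 * C * L powr (1 - p / 2)) powr (1 / p))"
    using p C(2) by (intro fock_norm_le) (auto intro: order_trans ennreal_leI)
qed

lemma separated_annuli_disjoint:
  assumes "separated I w"
  shows "disjoint_family_on (\<lambda>i. annulus (w i)) I"
  unfolding disjoint_family_on_def
proof (intro ballI impI)
  fix i j assume "i \<in> I" "j \<in> I" "i \<noteq> j"
  then have "1 \<le> dist (w i) (w j)" using assms by (auto simp: separated_def)
  then have "ball (w i) (1/2) \<inter> ball (w j) (1/2) = {}" by (intro disjoint_ballI) simp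
  moreover have "annulus v \<subseteq> ball v (1/2)" for v
    by (auto simp: annulus_def dist_norm norm_minus_commute)
  ultimately show "annulus (w i) \<inter> annulus (w j) = {}" by blast
qed

lemma nn_integral_sum_disjoint_le:
  assumes "finite I" "disjoint_family_on A I" "\<And>i. i \<in> I \<Longrightarrow> A i \<in> sets M" "f \<in> borel_measurable M"
  shows "(\<Sum>i\<in>I. \<integral>\<^sup>+z\<in>A i. f z \<partial>M) \<le> (\<integral>\<^sup>+z. f z \<partial>M)"
proof -
  have "(\<Sum>i\<in>I. \<integral>\<^sup>+z\<in>A i. f z \<partial>M) = (\<integral>\<^sup>+z. (\<Sum>i\<in>I. f z * indicator (A i) z) \<partial>M)"
    using assms by (intro nn_integral_sum[symmetric]) auto
  also have "\<dots> \<le> (\<integral>\<^sup>+z. f z \<partial>M)"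
  proof (rule nn_integral_mono)
    fix z
    have "(\<Sum>i\<in>I. indicator (A i) z :: ennreal) = indicator (\<Union>i\<in>I. A i) z"
      by (rule indicator_UN_disjoint[OF assms(1,2), symmetric])
    also have "\<dots> \<le> 1" by (simp add: indicator_def)
    finally show "(\<Sum>i\<in>I. f z * indicator (A i) z) \<le> f z"
      unfolding sum_distrib_left[symmetric] by (metis mult.right_neutral mult_left_mono zero_le)
  qed
  finally show ?thesis .
qed

text \<open>The strong norms are summed over all sign patterns. On the annulus about
  \<open>w i\<close> this sum dominates the \<open>i\<close>-th primitive, and the annuli are
  disjoint, so all \<open>i\<close> count at once. Up to constants the outcome is
  \<open>L \<le> L powr (1 - p / 2)\<close>, which caps \<open>L\<close> independently of the
  points.\<close>

lemma bounded_J_square_sum: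
  fixes g :: "complex \<Rightarrow> complex"
  assumes p: "1 < p" "p < 2" and \<alpha>: "0 < \<alpha>" and g: "g holomorphic_on UNIV"
    and inf: "\<nexists>B :: 'a :: complex_banach set. finite B \<and> complex_vector.span B = UNIV"
    and bdd: "bounded_operator (J g)
            (weak_fock p \<alpha> :: (complex \<Rightarrow> 'a) set) (weak_fock_norm p \<alpha>)
            (fock p \<alpha> :: (complex \<Rightarrow> 'a) set) (fock_norm p \<alpha>)"
  shows "\<exists>K. \<forall>(n :: nat) w. separated {..<n} w \<longrightarrow> (\<Sum>i<n. (cmod (deriv g (w i)) / (\<alpha> * cmod (w i) + 4))\<^sup>2) \<le> K"
proof -
  obtain C1 where C1: "C1 > 0" "\<And>(I :: nat set) w b. finite I \<Longrightarrow> separated I w \<Longrightarrow>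
      fock_integral p \<alpha> (\<lambda>z. \<Sum>i\<in>I. b i * fock_kernel \<alpha> (w i) z) \<le> ennreal (C1 * (\<Sum>i\<in>I. cmod (b i) powr p))"
    using fock_kernel_sum_bound[OF p(1) \<alpha>] by blast
  obtain c where c: "c > 0" "\<And>w h u. (\<And>z. (u has_field_derivative h z * fock_kernel \<alpha> w z) (at z)) \<Longrightarrow>
    ennreal (c * (cmod (h w) / (\<alpha> * cmod w + 4)) powr p) \<le>
    (\<integral>\<^sup>+z\<in>annulus w. ennreal (cmod (u z) powr p * exp (- (p * \<alpha> / 2) * (cmod z)\<^sup>2)) \<partial>lborel)"
    using primitive_lower_bound[OF p(1) \<alpha>] by blast
  obtain C0 where C0: "\<And>f. f \<in> (weak_fock p \<alpha> :: (complex \<Rightarrow> 'a) set) \<Longrightarrow>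
      fock_norm p \<alpha> (J g f) \<le> ennreal C0 * weak_fock_norm p \<alpha> f"
    using bdd unfolding bounded_operator_def by blast
  \<comment> \<open>The constant of a bounded operator may be negative; \<open>ennreal\<close> then
    sends it to 0, so its positive part serves as well.\<close>
  define C where "C = max C0 0"
  have C: "fock_norm p \<alpha> (J g f) \<le> ennreal C * weak_fock_norm p \<alpha> f" if "f \<in> weak_fock p \<alpha>" for f :: "complex \<Rightarrow> 'a"
    using order_trans[OF C0[OF that]] by (simp add: C_def ennreal_leI mult_right_mono)
  have C_nonneg: "C \<ge> 0" by (simp add: C_def)
  \<comment> \<open>The final inequality for \<open>L powr (p / 2)\<close>, solved for
    \<open>L\<close>.\<close>
  define K where "K = (C powr p * (4 * C1) / ((2/5) powr p * c)) powr (2 / p)"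
  have "(\<Sum>i<n. (cmod (deriv g (w i)) / (\<alpha> * cmod (w i) + 4))\<^sup>2) \<le> K" if w: "separated {..<n} w" for n :: nat and w
  proof -
    define \<rho> where "\<rho> i = cmod (deriv g (w i)) / (\<alpha> * cmod (w i) + 4)" for i
    have \<rho>: "\<rho> i \<ge> 0" for i using \<alpha> by (simp add: \<rho>_def)
    define L where "L = (\<Sum>i<n. (\<rho> i)\<^sup>2)"
    have "L \<le> K"
    proof (cases "L = 0")
      case False
      then have L: "L > 0" by (simp add: L_def less_le sum_nonneg)
      obtain x :: "nat \<Rightarrow> 'a" where x: "hilbertian n x" "\<And>i. i < n \<Longrightarrow> 2/5 \<le> norm (x i)"
        using dvoretzky_rogers[OF inf] by blast
      \<comment> \<open>with these weights \<open>\<Sum>i. (a i * \<rho> i) powr p\<close> is \<open>L\<close>, whereas the weak norm to the power \<open>p\<close> is only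
        of order \<open>L powr (1 - p / 2)\<close>\<close>
      define a where "a i = \<rho> i powr ((2 - p) / p)" for i
      define e where "e A i = (if i \<in> A then 1 else -1 :: complex)" for A and i :: nat
      have dg: "deriv g holomorphic_on UNIV" using g by (intro holomorphic_deriv) auto
      have "\<exists>u. (\<forall>z. (u has_field_derivative deriv g z * fock_kernel \<alpha> (w i) z) (at z)) \<and> u 0 = 0" for i
      proof -
        have "(\<lambda>z. deriv g z * fock_kernel \<alpha> (w i) z) holomorphic_on UNIV"
          by (intro holomorphic_intros dg holomorphic_fock_kernel)
        then obtain v where v: "\<And>z. (v has_field_derivative deriv g z * fock_kernel \<alpha> (w i) z) (at z)"
          using holomorphic_convex_primitive[of UNIV "{}" "\<lambda>z. deriv g z * fock_kernel \<alpha> (w i) z"]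
          by (auto simp: holomorphic_on_imp_continuous_on holomorphic_on_open field_differentiable_def)
        have "((\<lambda>z. v z - v 0) has_field_derivative deriv g z * fock_kernel \<alpha> (w i) z) (at z)" for z
          using DERIV_diff[OF v DERIV_const] by simp
        then show ?thesis by (intro exI[of _ "\<lambda>z. v z - v 0"]) auto
      qed
      then obtain u where u: "\<And>i z. (u i has_field_derivative deriv g z * fock_kernel \<alpha> (w i) z) (at z)"
        "\<And>i. u i 0 = 0" by metis
      define f where "f A z = (\<Sum>i<n. ((e A i * of_real (a i)) * fock_kernel \<alpha> (w i) z) *\<^sub>C x i)" for A z
      \<comment> \<open>The operator bound combined with the weak norm bound, both raised to the
        power \<open>p\<close>.\<close>
      define M where "M = C powr p * (2 * C1 * L powr (1 - p / 2))"
      have wn: "weak_fock_norm p \<alpha> (f A) \<le> ennreal ((2 * C1 * L powr (1 - p / 2)) powr (1 / p))" for A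
        unfolding f_def
        by (rule kernel_test_function_weak_norm[OF p C1(2,1) x(1) w \<rho> L_def L]) (auto simp: norm_mult a_def e_def)
      have fw: "f A \<in> weak_fock p \<alpha>" for A
      proof -
        have "entire (f A)" unfolding f_def
          by (rule entire_sum_scaleC) (intro holomorphic_intros holomorphic_fock_kernel)
        then show ?thesis using wn[of A] by (auto simp: weak_fock_def intro: le_less_trans)
      qed
      have JM: "fock_integral p \<alpha> (J g (f A)) \<le> ennreal M" for A
      proof -
        have "fock_norm p \<alpha> (J g (f A)) \<le> ennreal C * ennreal ((2 * C1 * L powr (1 - p / 2)) powr (1 / p))"
          by (rule order_trans[OF C[OF fw]]) (intro mult_left_mono wn, simp)
        also have "\<dots> = ennreal (C * (2 * C1 * L powr (1 - p / 2)) powr (1 / p))"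
          using C_nonneg by (simp add: ennreal_mult')
        finally have "fock_integral p \<alpha> (J g (f A)) \<le> ennreal ((C * (2 * C1 * L powr (1 - p / 2)) powr (1 / p)) powr p)"
          by (rule fock_integral_le) (use p in simp)
        also have "(C * (2 * C1 * L powr (1 - p / 2)) powr (1 / p)) powr p = M"
          using p C1 unfolding M_def powr_mult by (simp add: powr_powr)
        finally show ?thesis .
      qed
      have Jf: "J g (f A) z = (\<Sum>i<n. if i \<in> A then (of_real (a i) * u i z) *\<^sub>C x i else - ((of_real (a i) * u i z) *\<^sub>C x i))" for A z
      proof -
        have "J g (f A) z = (\<Sum>i<n. (e A i * of_real (a i) * u i z) *\<^sub>C x i)"
          unfolding f_def[abs_def]
        proof (rule J_sum_scaleC)
          fix i z
          show "((\<lambda>z. e A i * of_real (a i) * u i z) has_field_derivative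
              deriv g z * (e A i * of_real (a i) * fock_kernel \<alpha> (w i) z)) (at z)"
            using DERIV_cmult[OF u(1)[of i z], of "e A i * of_real (a i)"] by (simp add: mult_ac)
        qed (auto simp: u)
        also have "\<dots> = (\<Sum>i<n. if i \<in> A then (of_real (a i) * u i z) *\<^sub>C x i else - ((of_real (a i) * u i z) *\<^sub>C x i))"
          by (intro sum.cong) (auto simp: e_def complex_vector.scale_minus_left)
        finally show ?thesis .
      qed
      have cu: "continuous_on UNIV (u i)" for i
        by (rule DERIV_continuous_on) (rule u(1))
      have [measurable]: "u i \<in> borel_measurable borel" for i
        by (rule borel_measurable_continuous_onI[OF cu])
      have mJ[measurable]: "(\<lambda>z. norm (J g (f A) z)) \<in> borel_measurable borel" for A
      proof (rule borel_measurable_continuous_onI)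
        have "continuous_on UNIV (\<lambda>z. (of_real (a i) * u i z) *\<^sub>C x i)" for i
          by (intro bounded_linear.continuous_on[OF bounded_linear_scaleC_left] continuous_intros cu)
        then have "continuous_on UNIV (\<lambda>z. if i \<in> A then (of_real (a i) * u i z) *\<^sub>C x i else - ((of_real (a i) * u i z) *\<^sub>C x i))" for i
          by (cases "i \<in> A") (auto intro: continuous_on_minus)
        then show "continuous_on UNIV (\<lambda>z. norm (J g (f A) z))"
          unfolding Jf by (intro continuous_on_norm continuous_on_sum)
      qed
      let ?W = "\<lambda>z. exp (- (p * \<alpha> / 2) * (cmod z)\<^sup>2)"
      have "ennreal (2 ^ n * ((2/5) powr p * c) * L) = (\<Sum>i<n. ennreal (2 ^ n * ((2/5) powr p * a i powr p)) * ennreal (c * \<rho> i powr p))"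
      proof -
        have "2 ^ n * ((2/5) powr p * a i powr p) * (c * \<rho> i powr p) = 2 ^ n * ((2/5) powr p * c) * (\<rho> i)\<^sup>2" for i
        proof -
          have "a i powr p * \<rho> i powr p = (\<rho> i)\<^sup>2"
            using p \<rho>[of i] by (cases "\<rho> i = 0") (auto simp: a_def powr_powr simp flip: powr_add)
          then show ?thesis by (simp add: mult_ac)
        qed
        then have "(\<Sum>i<n. 2 ^ n * ((2/5) powr p * a i powr p) * (c * \<rho> i powr p)) = 2 ^ n * ((2/5) powr p * c) * L"
          unfolding L_def sum_distrib_left by (intro sum.cong refl)
        moreover have "(\<Sum>i<n. ennreal (2 ^ n * ((2/5) powr p * a i powr p)) * ennreal (c * \<rho> i powr p)) =
            ennreal (\<Sum>i<n. 2 ^ n * ((2/5) powr p * a i powr p) * (c * \<rho> i powr p))"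
          using c(1) by (simp add: ennreal_mult'[symmetric])
        ultimately show ?thesis by simp
      qed
      also have "\<dots> \<le> (\<Sum>i<n. ennreal (2 ^ n * ((2/5) powr p * a i powr p)) *
          (\<integral>\<^sup>+z\<in>annulus (w i). ennreal (cmod (u i z) powr p * ?W z) \<partial>lborel))"
        using c(2)[OF u(1)] by (intro sum_mono mult_left_mono) (auto simp: \<rho>_def)
      also have "\<dots> = (\<Sum>i<n. \<integral>\<^sup>+z\<in>annulus (w i). ennreal (2 ^ n * ((2/5) powr p * a i powr p) * (cmod (u i z) powr p * ?W z)) \<partial>lborel)"
        by (subst nn_integral_cmult[symmetric]) (auto simp: ennreal_mult'[symmetric] mult.assoc[symmetric] simp del: mult.assoc)
      \<comment> \<open>Each primitive is replaced pointwise by the sum over signs; the factor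
        \<open>2 ^ n\<close> counts the patterns and cancels at the end.\<close>
      also have "\<dots> \<le> (\<Sum>i<n. \<integral>\<^sup>+z\<in>annulus (w i). (\<Sum>A\<in>Pow {..<n}. ennreal (2 * (norm (J g (f A) z) powr p * ?W z))) \<partial>lborel)"
      proof (intro sum_mono nn_integral_mono mult_right_mono)
        fix i z assume i: "i \<in> {..<n}"
        have "(2/5) powr p \<le> norm (x i) powr p" using p x(2)[of i] i by (intro powr_mono2) auto
        then have "2 ^ n * ((2/5) powr p * a i powr p) * (cmod (u i z) powr p * ?W z) \<le>
            2 ^ n * (norm (x i) powr p * a i powr p) * (cmod (u i z) powr p * ?W z)"
          by (intro mult_right_mono mult_left_mono) auto
        also have "\<dots> = 2 ^ card {..<n} * norm ((of_real (a i) * u i z) *\<^sub>C x i) powr p * ?W z"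
          by (simp add: norm_scaleC norm_mult powr_mult a_def mult_ac)
        also have "\<dots> \<le> 2 * (\<Sum>A\<in>Pow {..<n}. norm (J g (f A) z) powr p) * ?W z"
          unfolding Jf by (intro mult_right_mono sum_signs_lower_bound i) (use p in auto)
        also have "\<dots> = (\<Sum>A\<in>Pow {..<n}. 2 * (norm (J g (f A) z) powr p * ?W z))"
          by (simp add: sum_distrib_left sum_distrib_right mult_ac)
        finally show "ennreal (2 ^ n * ((2/5) powr p * a i powr p) * (cmod (u i z) powr p * ?W z)) \<le>
            (\<Sum>A\<in>Pow {..<n}. ennreal (2 * (norm (J g (f A) z) powr p * ?W z)))"
          by (subst sum_ennreal) (auto intro: ennreal_leI)
      qed simp
      also have "\<dots> \<le> (\<integral>\<^sup>+z. (\<Sum>A\<in>Pow {..<n}. ennreal (2 * (norm (J g (f A) z) powr p * ?W z))) \<partial>lborel)"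
        by (rule nn_integral_sum_disjoint_le[OF _ separated_annuli_disjoint[OF w]]) measurable
      also have "\<dots> = (\<Sum>A\<in>Pow {..<n}. 2 * fock_integral p \<alpha> (J g (f A)))"
        unfolding fock_integral_def
        by (subst nn_integral_sum) (auto simp: ennreal_mult' nn_integral_cmult)
      also have "\<dots> \<le> (\<Sum>A\<in>Pow {..<n}. 2 * ennreal M)"
        by (intro sum_mono mult_left_mono JM) simp
      also have "\<dots> = ennreal (2 ^ n * (2 * M))"
        by (simp add: card_Pow ennreal_mult' ennreal_power[symmetric] power_mult_distrib)
      finally have "2 ^ n * ((2/5) powr p * c) * L \<le> 2 ^ n * (2 * M)"
        by (subst (asm) ennreal_le_iff) (use C1 in \<open>auto simp: M_def\<close>)
      then have "((2/5) powr p * c) * L \<le> 2 * M" by (simp add: mult.assoc)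
      then have "((2/5) powr p * c) * (L powr (p / 2) * L powr (1 - p / 2)) \<le> C powr p * (4 * C1) * L powr (1 - p / 2)"
        using L by (simp add: M_def mult_ac flip: powr_add)
      then have "((2/5) powr p * c) * L powr (p / 2) \<le> C powr p * (4 * C1)"
        using L by (simp add: mult.assoc[symmetric] del: mult.assoc)
      then have "L powr (p / 2) \<le> C powr p * (4 * C1) / ((2/5) powr p * c)"
        using c(1) by (simp add: field_simps)
      then have "(L powr (p / 2)) powr (2 / p) \<le> K"
        unfolding K_def using p by (intro powr_mono2) auto
      then show ?thesis using p L by (simp add: powr_powr)
    qed (simp add: K_def)
    then show ?thesis by (simp add: L_def \<rho>_def)
  qed
  then show ?thesis by blast
qed


section \<open>Growth of the symbol\<close>

text \<open>Lattice points with coordinates \<open>1 \<le> b \<le> a \<le> m\<close> have modulus at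
  most \<open>2 a\<close>, so \<open>\<alpha> |w| + 4 \<le> (2 \<alpha> + 4) a\<close>. The
  \<open>a\<close> points of column \<open>a\<close> each contribute at least a fixed multiple of
  \<open>1 / a^2\<close>, together \<open>1 / a\<close>, which produces the harmonic series.\<close>

lemma lattice_harmonic_lower_bound:
  assumes "\<alpha> > 0" "d > 0"
  shows "\<exists>(n :: nat) w. separated {..<n} w \<and>
    (d / (2 * \<alpha> + 4))\<^sup>2 * (\<Sum>a=1..m. 1 / real a) \<le> (\<Sum>i<n. (d / (\<alpha> * cmod (w i) + 4))\<^sup>2)"
proof -
  define P where "P = (SIGMA a:{1..m}. {1..a})"
  define v where "v q = Complex (real (fst q)) (real (snd q))" for q :: "nat \<times> nat"
  have "finite P" by (simp add: P_def)
  then obtain h where h: "bij_betw h {..<card P} P"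
    using ex_bij_betw_nat_finite by (metis atLeast0LessThan)
  have "1 \<le> dist (v q) (v r)" if "q \<noteq> r" for q r
  proof (cases "fst q = fst r")
    case True
    then have "1 \<le> \<bar>Im (v q - v r)\<bar>" using that by (auto simp: v_def prod_eq_iff)
    also have "\<dots> \<le> cmod (v q - v r)" by (rule abs_Im_le_cmod)
    finally show ?thesis by (simp add: dist_norm)
  next
    case False
    then have "1 \<le> \<bar>Re (v q - v r)\<bar>" by (auto simp: v_def)
    also have "\<dots> \<le> cmod (v q - v r)" by (rule abs_Re_le_cmod)
    finally show ?thesis by (simp add: dist_norm)
  qed
  moreover have "h i \<noteq> h j" if "i < card P" "j < card P" "i \<noteq> j" for i j
    using h that by (auto simp: bij_betw_def inj_on_def)
  ultimately have sep: "separated {..<card P} (v \<circ> h)"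
    by (simp add: separated_def)
  have "(d / (2 * \<alpha> + 4))\<^sup>2 * (\<Sum>a=1..m. 1 / real a) =
      (\<Sum>a=1..m. \<Sum>b=1..a. (d / ((2 * \<alpha> + 4) * real a))\<^sup>2)"
    by (auto simp: sum_distrib_left power_divide power_mult_distrib power2_eq_square intro!: sum.cong)
  also have "\<dots> \<le> (\<Sum>a=1..m. \<Sum>b=1..a. (d / (\<alpha> * cmod (v (a, b)) + 4))\<^sup>2)"
  proof (intro sum_mono power_mono divide_left_mono)
    fix a b assume ab: "a \<in> {1..m}" "b \<in> {1..a}"
    have "cmod (v (a, b)) \<le> real a + real b" unfolding v_def by (rule order_trans[OF cmod_le]) auto
    then have "\<alpha> * cmod (v (a, b)) \<le> \<alpha> * (2 * real a)" using ab assms by (intro mult_left_mono) auto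
    moreover have "4 \<le> 4 * real a" using ab by simp
    ultimately show "\<alpha> * cmod (v (a, b)) + 4 \<le> (2 * \<alpha> + 4) * real a" by (simp add: algebra_simps)
    show "0 < (2 * \<alpha> + 4) * real a * (\<alpha> * cmod (v (a, b)) + 4)"
      using ab assms by (intro mult_pos_pos add_nonneg_pos add_pos_pos) auto
    show "0 \<le> d" "0 \<le> d / ((2 * \<alpha> + 4) * real a)" using assms by auto
  qed
  also have "\<dots> = (\<Sum>q\<in>P. (d / (\<alpha> * cmod (v q) + 4))\<^sup>2)"
    unfolding P_def by (subst sum.Sigma) auto
  also have "\<dots> = (\<Sum>i<card P. (d / (\<alpha> * cmod ((v \<circ> h) i) + 4))\<^sup>2)"
    using sum.reindex_bij_betw[OF h, of "\<lambda>q. (d / (\<alpha> * cmod (v q) + 4))\<^sup>2"] by simp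
  finally show ?thesis using sep by blast
qed

text \<open>Cauchy's estimate on a large circle of radius \<open>r\<close> about \<open>z\<close>
  divides a bound of size \<open>c (\<alpha> + 1) r\<close> by \<open>r\<close>; as \<open>c\<close>
  is arbitrary, the derivative vanishes.\<close>

lemma holomorphic_sublinear_imp_constant:
  assumes h: "h holomorphic_on UNIV" and \<alpha>: "\<alpha> > 0"
    and small: "\<And>c. c > 0 \<Longrightarrow> \<exists>R. \<forall>w. R \<le> cmod w \<longrightarrow> cmod (h w) \<le> c * (\<alpha> * cmod w + 4)"
  shows "h constant_on UNIV"
proof -
  have "deriv h z = 0" for z
  proof -
    have bound: "cmod (deriv h z) \<le> c * (\<alpha> + 1)" if "c > 0" for c
    proof -
      obtain R where R: "\<And>w. R \<le> cmod w \<Longrightarrow> cmod (h w) \<le> c * (\<alpha> * cmod w + 4)"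
        using small[OF \<open>c > 0\<close>] by blast
      \<comment> \<open>Large enough for the circle to lie where the bound with \<open>c\<close>
        holds, and to absorb \<open>\<alpha> * cmod z + 4\<close>.\<close>
      define r where "r = 1 + \<bar>R\<bar> + cmod z + (\<alpha> * cmod z + 4)"
      have r: "r > 0" "R \<le> r - cmod z" "\<alpha> * cmod z + 4 \<le> r"
        using mult_nonneg_nonneg[of \<alpha> "cmod z"] \<alpha> norm_ge_zero[of z] unfolding r_def by linarith+
      have "cmod ((deriv ^^ 1) h z) \<le> fact 1 * (c * (\<alpha> * (cmod z + r) + 4)) / r ^ 1"
      proof (rule Cauchy_inequality)
        fix x assume x: "cmod (z - x) = r"
        have "R \<le> cmod x" using r(2) x norm_triangle_ineq4[of z x] by linarith
        then have "cmod (h x) \<le> c * (\<alpha> * cmod x + 4)" by (rule R)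
        also have "cmod x \<le> cmod z + r" using x norm_triangle_ineq2[of x z] by (simp add: norm_minus_commute)
        finally show "cmod (h x) \<le> c * (\<alpha> * (cmod z + r) + 4)"
          using \<open>c > 0\<close> \<alpha> by (simp add: mult_left_mono)
      qed (use r h in \<open>auto intro: holomorphic_on_subset holomorphic_on_imp_continuous_on\<close>)
      also have "\<dots> \<le> c * ((\<alpha> + 1) * r) / r"
      proof -
        have "\<alpha> * (cmod z + r) + 4 \<le> (\<alpha> + 1) * r" using r(3) by (simp add: algebra_simps)
        then show ?thesis using \<open>c > 0\<close> r(1)
          unfolding fact_1 mult_1 power_one_right by (intro divide_right_mono mult_left_mono) auto
      qed
      finally show ?thesis using r(1) by simp
    qed
    have "cmod (deriv h z) \<le> 0 + e" if "e > 0" for e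
      using bound[of "e / (\<alpha> + 1)"] that \<alpha> by simp
    then have "cmod (deriv h z) \<le> 0" by (rule field_le_epsilon)
    then show ?thesis by simp
  qed
  then have "(h has_field_derivative 0) (at z within UNIV)" for z
    using holomorphic_derivI[OF h open_UNIV UNIV_I, of z] by simp
  then obtain d where "\<And>z. z \<in> UNIV \<Longrightarrow> h z = d"
    using has_field_derivative_zero_constant[OF convex_UNIV, of h] by blast
  then show ?thesis by (auto simp: constant_on_def)
qed

text \<open>If \<open>deriv g\<close> is constant, its value is not 0 and the lattice gives
  divergence. Otherwise the quotient exceeds some \<open>c > 0\<close> at points of arbitrarily
  large modulus; chosen with moduli growing in steps of at least 1, they are separated, and each
  contributes at least \<open>c\<^sup>2\<close>.\<close>

lemma unbounded_square_sum:
  assumes \<alpha>: "\<alpha> > 0" and g: "g holomorphic_on UNIV" "\<not> g constant_on UNIV"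
  shows "\<exists>(n :: nat) w. separated {..<n} w \<and> K < (\<Sum>i<n. (cmod (deriv g (w i)) / (\<alpha> * cmod (w i) + 4))\<^sup>2)"
proof (cases "deriv g constant_on UNIV")
  case True
  then obtain d where d: "\<And>z. deriv g z = d" by (auto simp: constant_on_def)
  have "d \<noteq> 0"
  proof
    assume "d = 0"
    then have "(g has_field_derivative 0) (at z within UNIV)" for z
      using holomorphic_derivI[OF g(1) open_UNIV UNIV_I, of z] d by simp
    then obtain c where "\<And>z. z \<in> UNIV \<Longrightarrow> g z = c"
      using has_field_derivative_zero_constant[OF convex_UNIV, of g] by blast
    then show False using g(2) by (auto simp: constant_on_def)
  qed
  define \<kappa> where "\<kappa> = (cmod d / (2 * \<alpha> + 4))\<^sup>2"
  have \<kappa>: "\<kappa> > 0" using \<alpha> \<open>d \<noteq> 0\<close> by (simp add: \<kappa>_def)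
  have "\<exists>m. K / \<kappa> < (\<Sum>a=1..m. 1 / real a)"
  proof (rule ccontr)
    assume "\<not> ?thesis"
    then have le: "(\<Sum>a=1..m. 1 / real a) \<le> K / \<kappa>" for m by (auto simp: not_less)
    have "summable (\<lambda>n. inverse (real n))"
    proof (rule bounded_imp_summable)
      fix m
      have "(\<Sum>a\<le>m. inverse (real a)) = (\<Sum>a=1..m. 1 / real a)"
        by (rule sum.mono_neutral_cong_right) (auto simp: inverse_eq_divide)
      then show "(\<Sum>a\<le>m. inverse (real a)) \<le> K / \<kappa>" using le[of m] by simp
    qed simp
    then show False using not_summable_harmonic by blast
  qed
  then obtain m where "K / \<kappa> < (\<Sum>a=1..m. 1 / real a)" by blast
  then have "K < \<kappa> * (\<Sum>a=1..m. 1 / real a)" using \<kappa> by (simp add: field_simps)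
  moreover obtain n :: nat and w where "separated {..<n} w"
    "\<kappa> * (\<Sum>a=1..m. 1 / real a) \<le> (\<Sum>i<n. (cmod d / (\<alpha> * cmod (w i) + 4))\<^sup>2)"
    using lattice_harmonic_lower_bound[OF \<alpha>, of "cmod d" m] \<open>d \<noteq> 0\<close> unfolding \<kappa>_def by auto
  ultimately show ?thesis by (auto simp: d intro: less_le_trans)
next
  case False
  have "deriv g holomorphic_on UNIV" using g(1) by (intro holomorphic_deriv) auto
  then obtain c where c: "c > 0" "\<And>R. \<exists>w. R \<le> cmod w \<and> c * (\<alpha> * cmod w + 4) < cmod (deriv g w)"
    using holomorphic_sublinear_imp_constant[OF _ \<alpha>, of "deriv g"] False by (meson not_le)
  have "\<exists>w. \<forall>k. (c * (\<alpha> * cmod (w k) + 4) < cmod (deriv g (w k))) \<and> cmod (w k) + 1 \<le> cmod (w (Suc k))"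
    by (rule dependent_nat_choice) (use c(2) in blast)+
  then obtain w where w: "\<And>k. c * (\<alpha> * cmod (w k) + 4) < cmod (deriv g (w k))"
    "\<And>k. cmod (w k) + 1 \<le> cmod (w (Suc k))" by blast
  have incr: "cmod (w i) + 1 \<le> cmod (w j)" if "i < j" for i j
    using that
  proof (induction rule: less_Suc_induct)
    case (1 i) then show ?case by (rule w(2))
  qed linarith
  have sep: "separated {..<n} w" for n
    unfolding separated_def
  proof (intro ballI impI)
    fix i j :: nat assume "i \<noteq> j"
    then have "1 \<le> \<bar>cmod (w i) - cmod (w j)\<bar>"
      using incr[of i j] incr[of j i] by (cases "i < j") auto
    then show "1 \<le> dist (w i) (w j)"
      using norm_triangle_ineq3[of "w i" "w j"] by (simp add: dist_norm)
  qed
  obtain n :: nat where n: "K / c\<^sup>2 < real n" using reals_Archimedean2 by blast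
  have "K < (\<Sum>i<n. c\<^sup>2)" using n c(1) by (simp add: field_simps)
  also have "\<dots> \<le> (\<Sum>i<n. (cmod (deriv g (w i)) / (\<alpha> * cmod (w i) + 4))\<^sup>2)"
  proof (intro sum_mono power_mono)
    fix i
    have "0 < \<alpha> * cmod (w i) + 4" using \<alpha> by (simp add: add_nonneg_pos)
    then show "c \<le> cmod (deriv g (w i)) / (\<alpha> * cmod (w i) + 4)"
      using w(1)[of i] by (simp add: pos_le_divide_eq)
  qed (use c in simp)
  finally show ?thesis using sep by blast
qed


section \<open>Strictness of the inclusion\<close>

lemma bounded_linear_scaleC_right: "bounded_linear (\<lambda>x :: 'a :: complex_normed_vector. c *\<^sub>C x)"
  by (rule bounded_linear_intro[where K = "cmod c"])
    (simp_all add: scaleC_add_right norm_scaleC scaleR_scaleC scaleC_scaleC mult.commute)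

lemma entire_imp_continuous_on:
  assumes "entire f"
  shows "continuous_on UNIV f"
  unfolding continuous_on_eq_continuous_at[OF open_UNIV]
proof
  fix z
  obtain D where D: "((\<lambda>w. inverse (w - z) *\<^sub>C (f w - f z)) \<longlongrightarrow> D) (at z)"
    using assms unfolding entire_def by blast
  have "((\<lambda>w. cmod (w - z) * norm (inverse (w - z) *\<^sub>C (f w - f z))) \<longlongrightarrow> cmod (z - z) * norm D) (at z)"
    by (intro tendsto_intros D)
  then have "((\<lambda>w. cmod (w - z) * norm (inverse (w - z) *\<^sub>C (f w - f z))) \<longlongrightarrow> 0) (at z)" by simp
  then have "((\<lambda>w. norm (f w - f z)) \<longlongrightarrow> 0) (at z)"
    by (rule Lim_transform_eventually)
      (auto simp: eventually_at_filter norm_scaleC norm_inverse intro!: always_eventually)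
  then show "isCont f z" unfolding isCont_def
    by (rule LIM_zero_cancel[OF tendsto_norm_zero_cancel])
qed

text \<open>By the mean value inequality a majorant for the derivatives also bounds the difference
  quotients on a punctured unit ball about \<open>z\<close>. The M-test then makes their series
  uniformly convergent there, so the limit at \<open>z\<close> may be taken term by term.\<close>

lemma entire_suminf_scaleC:
  fixes y :: "nat \<Rightarrow> 'a :: complex_banach"
  assumes F: "\<And>k. F k holomorphic_on UNIV" and y: "\<And>k. norm (y k) \<le> 1"
    and M: "\<And>r. summable (M r)"
      "\<And>k z r. cmod z \<le> r \<Longrightarrow> cmod (F k z) \<le> M r k"
      "\<And>k z r. cmod z \<le> r \<Longrightarrow> cmod (deriv (F k) z) \<le> M r k"
  shows "summable (\<lambda>k. norm (F k z *\<^sub>C y k))" and "entire (\<lambda>z. \<Sum>k. F k z *\<^sub>C y k)"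
proof -
  have le: "norm (a *\<^sub>C y k) \<le> b" if "cmod a \<le> b" for a b k
    using mult_mono[OF that y[of k]] norm_ge_zero[of a] that by (simp add: norm_scaleC)
  show 1: "summable (\<lambda>k. norm (F k z *\<^sub>C y k))" for z
    by (rule summable_comparison_test'[OF M(1)[of "cmod z"], of 0]) (auto intro!: le M(2))
  then have s: "summable (\<lambda>k. F k z *\<^sub>C y k)" for z by (rule summable_norm_cancel)
  show "entire (\<lambda>z. \<Sum>k. F k z *\<^sub>C y k)"
    unfolding entire_def
  proof (intro allI exI)
    fix z
    define q where "q k w = ((F k w - F k z) / (w - z)) *\<^sub>C y k" for k w
    let ?A = "ball z 1 - {z}"
    have "norm (q k w) \<le> M (cmod z + 1) k" if "w \<in> ?A" for k w
    proof -
      have "cmod (F k w - F k z) \<le> M (cmod z + 1) k * cmod (w - z)"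
      proof (rule field_differentiable_bound[OF convex_ball[of z 1]])
        fix v assume v: "v \<in> ball z 1"
        show "(F k has_field_derivative deriv (F k) v) (at v within ball z 1)"
          using holomorphic_derivI[OF F open_UNIV UNIV_I] by (rule has_field_derivative_at_within)
        have "cmod v \<le> cmod z + 1"
          using v norm_triangle_ineq2[of v z] by (simp add: dist_norm norm_minus_commute)
        then show "cmod (deriv (F k) v) \<le> M (cmod z + 1) k" by (rule M(3))
      qed (use that in auto)
      then have "cmod ((F k w - F k z) / (w - z)) \<le> M (cmod z + 1) k"
        using that by (simp add: norm_divide pos_divide_le_eq)
      then show ?thesis unfolding q_def by (rule le)
    qed
    then have "uniform_limit ?A (\<lambda>n w. \<Sum>k<n. q k w) (\<lambda>w. \<Sum>k. q k w) sequentially"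
      by (rule Weierstrass_m_test[OF _ M(1)])
    moreover have "\<forall>\<^sub>F n in sequentially. ((\<lambda>w. \<Sum>k<n. q k w) \<longlongrightarrow> (\<Sum>k<n. deriv (F k) z *\<^sub>C y k)) (at z within ?A)"
    proof (rule always_eventually, rule allI)
      fix n
      have "((\<lambda>w. \<Sum>k<n. q k w) \<longlongrightarrow> (\<Sum>k<n. deriv (F k) z *\<^sub>C y k)) (at z)"
        unfolding q_def
      proof (intro tendsto_sum bounded_linear.tendsto[OF bounded_linear_scaleC_left])
        fix k
        have "(F k has_field_derivative deriv (F k) z) (at z)"
          by (rule holomorphic_derivI[OF F open_UNIV UNIV_I])
        then show "((\<lambda>w. (F k w - F k z) / (w - z)) \<longlongrightarrow> deriv (F k) z) (at z)"
          by (simp add: has_field_derivative_iff)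
      qed
      then show "((\<lambda>w. \<Sum>k<n. q k w) \<longlongrightarrow> (\<Sum>k<n. deriv (F k) z *\<^sub>C y k)) (at z within ?A)"
        by (rule tendsto_within_subset) simp
    qed
    moreover have "(\<lambda>n. \<Sum>k<n. deriv (F k) z *\<^sub>C y k) \<longlonglongrightarrow> (\<Sum>k. deriv (F k) z *\<^sub>C y k)"
    proof (rule summable_LIMSEQ, rule summable_norm_cancel)
      show "summable (\<lambda>k. norm (deriv (F k) z *\<^sub>C y k))"
        by (rule summable_comparison_test'[OF M(1)[of "cmod z"], of 0]) (auto intro!: le M(3))
    qed
    ultimately have "((\<lambda>w. \<Sum>k. q k w) \<longlongrightarrow> (\<Sum>k. deriv (F k) z *\<^sub>C y k)) (at z within ?A)"
      by (intro swap_uniform_limit[where F = sequentially]) auto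
    moreover have "at z within ?A = at z"
    proof -
      have "at z within ?A = at z within ball z 1" by (simp add: at_within_def)
      then show ?thesis by (simp add: at_within_open[of z "ball z 1"])
    qed
    moreover have "(\<Sum>k. q k w) = inverse (w - z) *\<^sub>C ((\<Sum>k. F k w *\<^sub>C y k) - (\<Sum>k. F k z *\<^sub>C y k))" for w
    proof -
      have "q k w = inverse (w - z) *\<^sub>C (F k w *\<^sub>C y k - F k z *\<^sub>C y k)" for k
        by (simp add: q_def complex_vector.scale_left_diff_distrib[symmetric] scaleC_scaleC divide_inverse mult.commute)
      then show ?thesis
        by (simp add: suminf_diff[OF s s] bounded_linear.suminf[OF bounded_linear_scaleC_right] summable_diff[OF s s])
    qed
    ultimately show "((\<lambda>w. inverse (w - z) *\<^sub>C ((\<Sum>k. F k w *\<^sub>C y k) - (\<Sum>k. F k z *\<^sub>C y k)))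
      \<longlongrightarrow> (\<Sum>k. deriv (F k) z *\<^sub>C y k)) (at z)" by simp
  qed
qed

section \<open>Kernels at sparse points\<close>

lemma abs_square_diff_ge:
  assumes "k \<noteq> l"
  shows "real k + real l \<le> \<bar>(real k)\<^sup>2 - (real l)\<^sup>2\<bar>"
proof -
  have "1 \<le> \<bar>real k - real l\<bar>" using assms by linarith
  then have "1 * (real k + real l) \<le> \<bar>real k - real l\<bar> * (real k + real l)"
    by (intro mult_right_mono) auto
  also have "\<dots> = \<bar>(real k)\<^sup>2 - (real l)\<^sup>2\<bar>"
    by (simp add: power2_eq_square square_diff_square_factored abs_mult mult.commute)
  finally show ?thesis by simp
qed

text \<open>The gap between the points \<open>R k^2\<close> and \<open>R l^2\<close> is at least
  \<open>R (k + l)\<close>, so on the annulus about \<open>w k\<close> the other weighted kernels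
  decay geometrically in \<open>k + l\<close>. The factor \<open>(1/4) ^ k\<close> in their total
  matches the lower bound for a non-zero \<open>y k\<close>, so the diagonal term keeps at least
  half of its size.\<close>

lemma sparse_kernel_sum_lower_bound:
  fixes y :: "nat \<Rightarrow> 'a :: complex_banach"
  assumes \<alpha>: "\<alpha> > 0" and R: "1 \<le> R" "exp (- (\<alpha> / 2) * (R - 1/2)\<^sup>2) \<le> exp (- \<alpha> / 8) / 40"
    and y1: "\<And>l. norm (y l) \<le> 1" and y2: "y k \<noteq> 0 \<Longrightarrow> 2/5 * (1/4) ^ k \<le> norm (y k)"
    and w: "\<And>l. w l = complex_of_real (R * (real l)\<^sup>2)"
    and s: "summable (\<lambda>l. norm (fock_kernel \<alpha> (w l) z *\<^sub>C y l))"
    and z: "z \<in> annulus (w k)"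
  shows "exp (- \<alpha> / 8) / 2 * norm (y k) \<le>
    norm (\<Sum>l. fock_kernel \<alpha> (w l) z *\<^sub>C y l) * exp (- (\<alpha> / 2) * (cmod z)\<^sup>2)"
proof (cases "y k = 0")
  case False
  define \<theta> where "\<theta> = exp (- (\<alpha> / 2) * (R - 1/2)\<^sup>2)"
  define E where "E = exp (- (\<alpha> / 2) * (cmod z)\<^sup>2)"
  define a where "a l = fock_kernel \<alpha> (w l) z *\<^sub>C y l" for l
  define b where "b l = (if l = k then 0 else a l)" for l
  \<comment> \<open>Dividing by \<open>E\<close> removes the weight, so that the series can be
    estimated before it is multiplied by \<open>E\<close> again.\<close>
  define D where "D = 4 * \<theta> * (1/4) ^ k / E"
  have E: "E > 0" by (simp add: E_def)
  have aE: "norm (a l) * E = exp (- (\<alpha> / 2) * (cmod (z - w l))\<^sup>2) * norm (y l)" for l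
    unfolding a_def E_def norm_scaleC norm_fock_kernel_weighted[symmetric] by (simp only: mult_ac)
  have zk: "cmod (z - w k) < 1/2" using z by (simp add: annulus_def)
  have "exp (- \<alpha> / 8) \<le> 1" using \<alpha> by simp
  then have \<theta>: "0 < \<theta>" "\<theta> \<le> 1/4" using R(2) unfolding \<theta>_def by (simp, linarith)
  have off: "exp (- (\<alpha> / 2) * (cmod (z - w l))\<^sup>2) \<le> 4 * \<theta> * (1/4) ^ k * (1/2) ^ l" if l: "l \<noteq> k" for l
  proof -
    have kl: "1 \<le> real k + real l" using l by linarith
    have "cmod (w k - w l) = R * \<bar>(real k)\<^sup>2 - (real l)\<^sup>2\<bar>"
      using R(1) unfolding w of_real_diff[symmetric] norm_of_real
      by (simp add: right_diff_distrib[symmetric] abs_mult)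
    then have "R * (real k + real l) \<le> cmod (w k - w l)"
      using mult_left_mono[OF abs_square_diff_ge[OF l[symmetric]], of R] R(1) by simp
    also have "\<dots> \<le> cmod (z - w l) + 1/2"
      using norm_triangle_ineq4[of "z - w l" "z - w k"] zk by simp
    finally have "R * (real k + real l) - 1/2 \<le> cmod (z - w l)" by simp
    \<comment> \<open>The displacement of \<open>z\<close> from \<open>w k\<close> costs 1/2 once,
      which is absorbed by lowering \<open>R\<close> because \<open>k + l\<close> is at least
      1.\<close>
    moreover have "(R - 1/2) * s \<le> c" if "R * s - 1/2 \<le> c" "1 \<le> s" for s c
      using that by (simp add: left_diff_distrib)
    ultimately have 1: "(R - 1/2) * (real k + real l) \<le> cmod (z - w l)" using kl by blast
    have "(R - 1/2)\<^sup>2 * (real k + real l) \<le> (R - 1/2)\<^sup>2 * (real k + real l)\<^sup>2"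
      using kl by (intro mult_left_mono) (auto simp: power2_eq_square)
    also have "\<dots> = ((R - 1/2) * (real k + real l))\<^sup>2" by (simp add: power_mult_distrib)
    also have "\<dots> \<le> (cmod (z - w l))\<^sup>2" using 1 R(1) by (intro power_mono) auto
    finally have "\<alpha> / 2 * ((R - 1/2)\<^sup>2 * (real k + real l)) \<le> \<alpha> / 2 * (cmod (z - w l))\<^sup>2"
      using \<alpha> by (intro mult_left_mono) auto
    then have "exp (- (\<alpha> / 2) * (cmod (z - w l))\<^sup>2) \<le> exp (real (k + l) * (- (\<alpha> / 2) * (R - 1/2)\<^sup>2))"
      by (simp add: algebra_simps)
    also have "\<dots> = \<theta> ^ (k + l)" unfolding \<theta>_def by (rule exp_of_nat_mult)
    \<comment> \<open>One factor \<open>\<theta>\<close> is kept for its smallness, the others only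
      need to be at most 1/4. The exponent is positive since \<open>k\<close> and \<open>l\<close>
      differ.\<close>
    also have "\<dots> = \<theta> * \<theta> ^ (k + l - 1)" using l by (cases "k + l") auto
    also have "\<dots> \<le> \<theta> * (1/4) ^ (k + l - 1)" using \<theta> by (intro mult_left_mono power_mono) auto
    also have "(1/4 :: real) ^ (k + l - 1) = 4 * (1/4) ^ (k + l)"
      using l by (cases "k + l") auto
    also have "\<theta> * (4 * (1/4) ^ (k + l)) = 4 * \<theta> * (1/4) ^ k * (1/4) ^ l" by (simp add: power_add)
    also have "\<dots> \<le> 4 * \<theta> * (1/4) ^ k * (1/2) ^ l"
      using \<theta> by (intro mult_left_mono power_mono) auto
    finally show ?thesis .
  qed
  have b: "norm (b l) \<le> D * (1/2) ^ l" for l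
  proof (cases "l = k")
    case False
    have "norm (a l) * E \<le> 4 * \<theta> * (1/4) ^ k * (1/2) ^ l * 1"
      unfolding aE using off[OF False] y1[of l] \<theta> by (intro mult_mono) auto
    then show ?thesis using False E by (simp add: b_def D_def field_simps)
  qed (use E \<theta> in \<open>simp add: b_def D_def\<close>)
  have geo: "(\<lambda>l. D * (1/2) ^ l) sums (D * 2)"
    using sums_mult[OF geometric_sums[of "1/2 :: real"], of D] by simp
  have sb: "summable (\<lambda>l. norm (b l))"
    by (rule summable_comparison_test'[OF sums_summable[OF geo], of 0]) (use b in auto)
  have sa: "summable a" using s unfolding a_def[symmetric] by (rule summable_norm_cancel)
  have "(\<lambda>l. a l - b l) sums (a k)"
    using sums_single[of k a] by (rule sums_cong[THEN iffD1, rotated]) (simp add: b_def)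
  then have "suminf a - suminf b = a k"
    using suminf_diff[OF sa summable_norm_cancel[OF sb]] by (simp add: sums_iff)
  then have "norm (a k) - norm (suminf b) \<le> norm (suminf a)"
    by (metis add_diff_cancel diff_add_cancel norm_diff_ineq diff_le_eq norm_triangle_sub)
  moreover have "norm (suminf b) \<le> D * 2"
  proof -
    have "norm (suminf b) \<le> (\<Sum>l. norm (b l))" by (rule summable_norm[OF sb])
    also have "\<dots> \<le> (\<Sum>l. D * (1/2) ^ l)" by (rule suminf_le[OF b sb sums_summable[OF geo]])
    finally show ?thesis using geo by (simp add: sums_iff)
  qed
  ultimately have "(norm (a k) - D * 2) * E \<le> norm (suminf a) * E"
    using E by (intro mult_right_mono) auto
  moreover have "(norm (a k) - D * 2) * E = exp (- (\<alpha> / 2) * (cmod (z - w k))\<^sup>2) * norm (y k) - 8 * \<theta> * (1/4) ^ k"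
    using E by (simp add: left_diff_distrib aE D_def)
  moreover have "exp (- \<alpha> / 8) * norm (y k) \<le> exp (- (\<alpha> / 2) * (cmod (z - w k))\<^sup>2) * norm (y k)"
  proof (intro mult_right_mono)
    have "(cmod (z - w k))\<^sup>2 \<le> (1/2)\<^sup>2" using zk by (intro power_mono) auto
    then show "exp (- \<alpha> / 8) \<le> exp (- (\<alpha> / 2) * (cmod (z - w k))\<^sup>2)"
      using \<alpha> mult_left_mono[of "(cmod (z - w k))\<^sup>2" "1/4" \<alpha>] by (simp add: power2_eq_square)
  qed simp
  moreover have "8 * \<theta> * (1/4) ^ k \<le> exp (- \<alpha> / 8) / 2 * norm (y k)"
  proof -
    \<comment> \<open>The constant 40 is chosen so that \<open>8 / 40 = 1/2 * 2/5\<close>.\<close>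
    have "8 * \<theta> * (1/4) ^ k \<le> 8 * (exp (- \<alpha> / 8) / 40) * (1/4) ^ k"
      using R(2) by (intro mult_right_mono mult_left_mono) (auto simp: \<theta>_def)
    also have "\<dots> = exp (- \<alpha> / 8) / 2 * (2/5 * (1/4) ^ k)" by simp
    also have "\<dots> \<le> exp (- \<alpha> / 8) / 2 * norm (y k)" using y2[OF False] by (intro mult_left_mono) auto
    finally show ?thesis .
  qed
  ultimately show ?thesis unfolding a_def E_def by linarith
qed simp

text \<open>Dvoretzky-Rogers blocks, enumerated by the pairing function. The geometric lower bound
  protects the \<open>k\<close>-th vector against the tails of the other kernels; it holds because
  vectors of block \<open>j\<close> have norm at least \<open>2/5 * (1/4) ^ j\<close> and their
  indices \<open>k\<close> are at least \<open>j\<close>.\<close>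

lemma weakly_not_strongly_summable_sequence:
  assumes p: "1 < p" "p < 2"
    and inf: "\<nexists>B :: 'a :: complex_banach set. finite B \<and> complex_vector.span B = UNIV"
  shows "\<exists>y :: nat \<Rightarrow> 'a. (\<forall>k. norm (y k) \<le> 1) \<and> (\<forall>k. y k \<noteq> 0 \<longrightarrow> 2/5 * (1/4) ^ k \<le> norm (y k)) \<and>
    (\<forall>\<phi>\<in>dual_unit_ball. \<forall>N. (\<Sum>k<N. cmod (\<phi> (y k)) powr p) \<le> 4) \<and>
    (\<forall>K. \<exists>N. K < (\<Sum>k<N. norm (y k) powr p))"
proof -
  have "\<exists>x :: nat \<Rightarrow> 'a. hilbertian (4 ^ j) x \<and> (\<forall>i<4 ^ j. 2/5 \<le> norm (x i))" for j :: nat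
    by (rule dvoretzky_rogers[OF inf])
  then obtain x :: "nat \<Rightarrow> nat \<Rightarrow> 'a" where x: "\<And>j. hilbertian (4 ^ j) (x j)"
    "\<And>j i. i < 4 ^ j \<Longrightarrow> 2/5 \<le> norm (x j i)" by metis
  \<comment> \<open>block \<open>j\<close> has \<open>4 ^ j\<close> vectors and \<open>c j powr p = 4 ^ (-j)\<close>: its strong sum stays bounded below,
    its weak sum is of order \<open>(4 ^ j) powr (- p / 2)\<close>\<close>
  define c where "c j = (4 :: real) powr (- real j / p)" for j
  have c0: "c j > 0" for j by (simp add: c_def)
  have c1: "c j \<le> 1" for j using powr_mono[of "- real j / p" 0 "4 :: real"] p by (simp add: c_def)
  have c2: "(1/4) ^ j \<le> c j" for j
  proof -
    have "real j / p \<le> real j" using p by (simp add: divide_le_eq mult_le_cancel_left1)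
    then have "(4 :: real) powr (- real j) \<le> c j" unfolding c_def by (intro powr_mono) auto
    then show ?thesis by (simp add: powr_minus powr_realpow power_one_over inverse_eq_divide)
  qed
  have cp: "c j powr p = 1 / 4 ^ j" for j
  proof -
    have "c j powr p = 4 powr (- real j)" using p unfolding c_def powr_powr by simp
    then show ?thesis by (simp add: powr_minus powr_realpow inverse_eq_divide)
  qed
  \<comment> \<open>Block \<open>j\<close> fills only the first \<open>4 ^ j\<close> places of its
    row of the pairing; the others hold 0, hence the proviso \<open>y k \<noteq> 0\<close>.\<close>
  define Y where "Y q = (if snd q < 4 ^ fst q then complex_of_real (c (fst q)) *\<^sub>C x (fst q) (snd q) else 0)" for q
  define y where "y k = Y (prod_decode k)" for k
  have yY: "y (prod_encode q) = Y q" for q by (simp add: y_def)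
  have nY: "norm (Y (j, i)) = c j * norm (x j i)" if "i < 4 ^ j" for i j
    using that c0[of j] by (simp add: Y_def norm_scaleC)
  have "norm (Y q) \<le> 1" for q
    using nY[of "snd q" "fst q"] hilbertian_norm_le[OF x(1), of "snd q" "fst q"] c0[of "fst q"] c1[of "fst q"]
    by (cases "snd q < 4 ^ fst q") (auto simp: Y_def mult_le_one)
  then have y1: "norm (y k) \<le> 1" for k by (simp add: y_def)
  have y2: "2/5 * (1/4) ^ k \<le> norm (y k)" if "y k \<noteq> 0" for k
  proof -
    obtain j i where ji: "prod_decode k = (j, i)" by (cases "prod_decode k")
    then have k: "k = prod_encode (j, i)" by (metis prod_decode_inverse)
    have i: "i < 4 ^ j" using that ji by (auto simp: y_def Y_def split: if_splits)
    have "(1/4 :: real) ^ k \<le> (1/4) ^ j" using le_prod_encode_1[of j i] k by (intro power_decreasing) auto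
    then have "(1/4) ^ k \<le> c j" using c2[of j] by linarith
    then have "(1/4) ^ k * (2/5) \<le> c j * norm (x j i)" using x(2)[OF i] c0[of j] by (intro mult_mono) auto
    then show ?thesis using nY[OF i] by (simp add: y_def ji)
  qed
  have y3: "(\<Sum>k<N. cmod (\<phi> (y k)) powr p) \<le> 4" if \<phi>: "\<phi> \<in> dual_unit_ball" for \<phi> N
  proof -
    have sc: "\<phi> (a *\<^sub>C v) = a * \<phi> v" "\<phi> 0 = 0" for a v
      using \<phi> by (auto simp: dual_unit_ball_def intro: linear_0 bounded_linear.linear)
    \<comment> \<open>An index below \<open>N\<close> decodes to a block number below
      \<open>N\<close>, so all non-zero terms lie in the first \<open>N\<close> blocks.\<close>
    let ?S = "SIGMA j:{..<N}. {..<4 ^ j :: nat}"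
    have inj: "inj_on prod_decode {..<N}" by (meson inj_prod_decode inj_on_subset subset_UNIV)
    have "(\<Sum>k<N. cmod (\<phi> (y k)) powr p) = (\<Sum>q\<in>prod_decode ` {..<N}. cmod (\<phi> (Y q)) powr p)"
      by (simp add: sum.reindex[OF inj] y_def)
    also have "\<dots> = (\<Sum>q\<in>prod_decode ` {..<N} \<inter> ?S. cmod (\<phi> (Y q)) powr p)"
    proof (rule sum.mono_neutral_right)
      show "\<forall>q\<in>prod_decode ` {..<N} - prod_decode ` {..<N} \<inter> ?S. cmod (\<phi> (Y q)) powr p = 0"
      proof
        fix q assume q: "q \<in> prod_decode ` {..<N} - prod_decode ` {..<N} \<inter> ?S"
        then obtain k where k: "k < N" "q = prod_decode k" by auto
        have "k = prod_encode (fst q, snd q)" using k by simp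
        then have "fst q < N" using le_prod_encode_1[of "fst q" "snd q"] k(1) by linarith
        then have "\<not> snd q < 4 ^ fst q" using q by (cases q) auto
        then show "cmod (\<phi> (Y q)) powr p = 0" by (simp add: Y_def sc)
      qed
    qed auto
    also have "\<dots> \<le> (\<Sum>q\<in>?S. cmod (\<phi> (Y q)) powr p)" by (rule sum_mono2) auto
    also have "\<dots> = (\<Sum>j<N. \<Sum>i<4 ^ j. cmod (\<phi> (Y (j, i))) powr p)" by (subst sum.Sigma) auto
    also have "\<dots> \<le> (\<Sum>j<N. 2 * (1/2) ^ j)"
    proof (rule sum_mono)
      fix j
      have "(\<Sum>i<4 ^ j. cmod (\<phi> (Y (j, i))) powr p) = (\<Sum>i<4 ^ j. 1 / 4 ^ j * cmod (\<phi> (x j i)) powr p)"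
        using c0[of j] by (intro sum.cong) (auto simp: Y_def sc norm_mult powr_mult cp[symmetric])
      also have "\<dots> = 1 / 4 ^ j * (\<Sum>i<4 ^ j. 1 powr (2 - p) * cmod (\<phi> (x j i)) powr p)"
        by (simp add: sum_distrib_left)
      also have "\<dots> \<le> 1 / 4 ^ j * (2 * (4 ^ j) powr (1 - p / 2))"
        by (intro mult_left_mono weighted_powr_sum_bound)
          (use p hilbertian_dual_bound[OF x(1) \<phi>] in auto)
      also have "\<dots> = 2 * (4 ^ j) powr (- (p / 2))"
      proof -
        have "1 / u * (2 * u powr (1 - p / 2)) = 2 * u powr (- (p / 2))" if "u > 0" for u :: real
          using powr_add[of u 1 "- (p / 2)"] that by simp
        then show ?thesis by simp
      qed
      \<comment> \<open>As \<open>p > 1\<close>, the block sums are dominated by a geometric series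
        of ratio 1/2, whence the total \<open>2 * 2 = 4\<close>.\<close>
      also have "\<dots> \<le> 2 * (4 ^ j) powr (- (1/2))"
        using p by (intro mult_left_mono powr_mono) auto
      also have "(4 ^ j :: real) powr (- (1/2)) = (1/2) ^ j"
      proof -
        have "(4 ^ j :: real) = (2\<^sup>2) ^ j" by simp
        also have "\<dots> = (2 ^ j)\<^sup>2" by (simp only: power_mult[symmetric] mult.commute)
        finally have "(4 ^ j :: real) = (2 ^ j)\<^sup>2" .
        then show ?thesis by (simp add: powr_minus powr_half_sqrt power_one_over inverse_eq_divide)
      qed
      finally show "(\<Sum>i<4 ^ j. cmod (\<phi> (Y (j, i))) powr p) \<le> 2 * (1/2) ^ j" .
    qed
    also have "\<dots> = 2 * (\<Sum>j<N. (1/2) ^ j)" by (simp add: sum_distrib_left)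
    also have "(\<Sum>j<N. (1/2 :: real) ^ j) \<le> 2" by (simp add: sum_gp_strict)
    finally show ?thesis by simp
  qed
  have y4: "\<exists>N. K < (\<Sum>k<N. norm (y k) powr p)" for K
  proof -
    obtain M :: nat where M: "K / (2/5) powr p < real M" using reals_Archimedean2 by blast
    let ?S = "SIGMA j:{..<M}. {..<4 ^ j :: nat}"
    have "finite (prod_encode ` ?S)" by auto
    then obtain N where N: "prod_encode ` ?S \<subseteq> {..<N}" using finite_nat_iff_bounded by blast
    have "K < real M * (2/5) powr p" using M by (simp add: divide_less_eq)
    also have "\<dots> = (\<Sum>j<M. (2/5) powr p)" by simp
    also have "\<dots> \<le> (\<Sum>j<M. \<Sum>i<4 ^ j. norm (Y (j, i)) powr p)"
    proof (rule sum_mono)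
      fix j
      have "(2/5) powr p = (\<Sum>i<(4 :: nat) ^ j. 1 / 4 ^ j * (2/5) powr p)" by simp
      also have "\<dots> \<le> (\<Sum>i<4 ^ j. norm (Y (j, i)) powr p)"
      proof (rule sum_mono)
        fix i :: nat assume "i \<in> {..<4 ^ j}"
        then have i: "i < 4 ^ j" by simp
        have "1 / 4 ^ j * (2/5) powr p \<le> c j powr p * norm (x j i) powr p"
          unfolding cp using x(2)[OF i] p by (intro mult_left_mono powr_mono2) auto
        then show "1 / 4 ^ j * (2/5) powr p \<le> norm (Y (j, i)) powr p"
          using c0[of j] by (simp add: nY[OF i] powr_mult)
      qed
      finally show "(2/5) powr p \<le> (\<Sum>i<4 ^ j. norm (Y (j, i)) powr p)" .
    qed
    also have "\<dots> = (\<Sum>q\<in>?S. norm (Y q) powr p)" by (subst sum.Sigma) auto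
    also have "\<dots> = (\<Sum>k\<in>prod_encode ` ?S. norm (y k) powr p)"
      by (subst sum.reindex) (auto simp: yY intro: inj_on_subset[OF inj_prod_encode])
    also have "\<dots> \<le> (\<Sum>k<N. norm (y k) powr p)" using N by (intro sum_mono2) auto
    finally show ?thesis by blast
  qed
  show ?thesis using y1 y2 y3 y4 by blast
qed

text \<open>With \<open>v = R k^2\<close> the exponent has a negative quadratic term in
  \<open>v\<close>, which beats the linear growth on any disc. The \<open>+ 1\<close> in
  \<open>r + 1\<close> pays for differentiation, whose factor \<open>\<alpha> v\<close> is at most
  \<open>exp (\<alpha> v)\<close>.\<close>

lemma sparse_kernel_majorant:
  assumes \<alpha>: "\<alpha> > 0" and R: "1 \<le> R" and w: "\<And>k. w k = complex_of_real (R * (real k)\<^sup>2)"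
    and M: "\<And>r k. M r k = exp (\<alpha> * (R * (real k)\<^sup>2) * (r + 1) - \<alpha> / 2 * (R * (real k)\<^sup>2)\<^sup>2)"
  shows "summable (M r)"
    and "cmod z \<le> r \<Longrightarrow> cmod (fock_kernel \<alpha> (w k) z) \<le> M r k"
    and "cmod z \<le> r \<Longrightarrow> cmod (deriv (fock_kernel \<alpha> (w k)) z) \<le> M r k"
proof -
  show "summable (M r)"
  proof (rule summable_comparison_test_ev)
    have "\<forall>\<^sub>F k in sequentially. 2 * (r + 2) \<le> real k"
      using filterlim_real_sequentially by (simp add: filterlim_at_top)
    then show "\<forall>\<^sub>F k in sequentially. norm (M r k) \<le> exp (- \<alpha>) ^ k"
    proof eventually_elim
      case (elim k)
      define v where "v = R * (real k)\<^sup>2"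
      have "real k \<le> (real k)\<^sup>2" by (cases "k = 0") (auto simp: power2_eq_square)
      also have "\<dots> \<le> v" using R by (simp add: v_def mult_le_cancel_right1)
      finally have v: "real k \<le> v" .
      have "\<alpha> * v * (r + 1) - \<alpha> / 2 * v\<^sup>2 = \<alpha> * v * ((r + 1) - v / 2)"
        by (simp add: algebra_simps power2_eq_square)
      \<comment> \<open>From \<open>2 * (r + 2) \<le> real k\<close> and
        \<open>real k \<le> v\<close> the bracket is at most \<open>- 1\<close>.\<close>
      also have "\<dots> \<le> \<alpha> * v * (- 1)" using v elim \<alpha> by (intro mult_left_mono) auto
      also have "\<dots> \<le> real k * (- \<alpha>)" using v \<alpha> by simp
      finally show ?case by (simp add: M v_def[symmetric] exp_of_nat_mult[symmetric])
    qed
    show "summable (\<lambda>k. exp (- \<alpha>) ^ k)" using \<alpha> by (intro summable_geometric) simp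
  qed
  assume z: "cmod z \<le> r"
  define v where "v = R * (real k)\<^sup>2"
  have v: "v \<ge> 0" using R by (simp add: v_def)
  have F: "cmod (fock_kernel \<alpha> (w k) z) \<le> exp (\<alpha> * v * r - \<alpha> / 2 * v\<^sup>2)"
  proof -
    have "Re z \<le> r" using z complex_Re_le_cmod[of z] by linarith
    then have "\<alpha> * v * Re z \<le> \<alpha> * v * r" using \<alpha> v by (intro mult_left_mono) auto
    then show ?thesis using v
      by (simp add: fock_kernel_def norm_exp_eq_Re w v_def[symmetric] del: of_real_mult of_real_power)
  qed
  have e: "exp (\<alpha> * v) * exp (\<alpha> * v * r - \<alpha> / 2 * v\<^sup>2) = M r k"
    by (simp add: M v_def exp_add[symmetric] algebra_simps)
  have "1 * cmod (fock_kernel \<alpha> (w k) z) \<le> exp (\<alpha> * v) * exp (\<alpha> * v * r - \<alpha> / 2 * v\<^sup>2)"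
    using F v \<alpha> by (intro mult_mono) auto
  then show "cmod (fock_kernel \<alpha> (w k) z) \<le> M r k" unfolding e by simp
  have "cmod (deriv (fock_kernel \<alpha> (w k)) z) = (\<alpha> * v) * cmod (fock_kernel \<alpha> (w k) z)"
    using \<alpha> v DERIV_imp_deriv[OF has_field_derivative_fock_kernel] unfolding w v_def[symmetric]
    by (simp add: norm_mult)
  also have "\<dots> \<le> exp (\<alpha> * v) * exp (\<alpha> * v * r - \<alpha> / 2 * v\<^sup>2)"
  proof (intro mult_mono F)
    show "\<alpha> * v \<le> exp (\<alpha> * v)" using exp_ge_add_one_self[of "\<alpha> * v"] by linarith
  qed auto
  finally show "cmod (deriv (fock_kernel \<alpha> (w k)) z) \<le> M r k" unfolding e .
qed

text \<open>Fatou's lemma along the partial sums.\<close>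

lemma fock_integral_suminf_le:
  assumes p: "0 < p" and F: "\<And>n. continuous_on UNIV (\<lambda>z. \<Sum>k<n. a k z :: complex)"
    and s: "\<And>z. summable (\<lambda>k. a k z)"
    and B: "\<And>n. fock_integral p \<alpha> (\<lambda>z. \<Sum>k<n. a k z) \<le> B"
  shows "fock_integral p \<alpha> (\<lambda>z. \<Sum>k. a k z) \<le> B"
proof -
  define u where "u n z = ennreal (cmod (\<Sum>k<n. a k z) powr p * exp (- (p * \<alpha> / 2) * (cmod z)\<^sup>2))" for n z
  have [measurable]: "(\<lambda>z. \<Sum>k<n. a k z) \<in> borel_measurable borel" for n
    by (rule borel_measurable_continuous_onI[OF F])
  have lim: "(\<lambda>n. u n z) \<longlonglongrightarrow> ennreal (cmod (\<Sum>k. a k z) powr p * exp (- (p * \<alpha> / 2) * (cmod z)\<^sup>2))" for z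
    unfolding u_def using p
    by (intro tendsto_ennrealI tendsto_mult tendsto_const tendsto_powr' tendsto_norm summable_LIMSEQ s) auto
  have "fock_integral p \<alpha> (\<lambda>z. \<Sum>k. a k z) = (\<integral>\<^sup>+z. liminf (\<lambda>n. u n z) \<partial>lborel)"
    unfolding fock_integral_def
    by (rule nn_integral_cong, rule lim_imp_Liminf[OF trivial_limit_sequentially lim, symmetric])
  also have "\<dots> \<le> liminf (\<lambda>n. \<integral>\<^sup>+z. u n z \<partial>lborel)"
    unfolding u_def by (rule nn_integral_liminf) measurable
  also have "\<dots> \<le> B"
    using B by (intro Liminf_le) (auto simp: u_def fock_integral_def intro: always_eventually)
  finally show ?thesis .
qed

text \<open>One series of kernels at sparse points serves both claims. A functional turns it into a
  scalar kernel series whose coefficients are \<open>p\<close>-summable uniformly in the functional.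
  On the annulus about \<open>w k\<close> its weighted norm is at least a fixed multiple of the norm
  of \<open>y k\<close>, and these norms are not \<open>p\<close>-summable.\<close>

lemma exists_weak_fock_not_fock:
  assumes p: "1 < p" "p < 2" and \<alpha>: "0 < \<alpha>"
    and inf: "\<nexists>B :: 'a :: complex_banach set. finite B \<and> complex_vector.span B = UNIV"
  shows "\<exists>f :: complex \<Rightarrow> 'a. f \<in> weak_fock p \<alpha> \<and> f \<notin> fock p \<alpha>"
proof -
  obtain y :: "nat \<Rightarrow> 'a" where y: "\<And>k. norm (y k) \<le> 1" "\<And>k. y k \<noteq> 0 \<Longrightarrow> 2/5 * (1/4) ^ k \<le> norm (y k)"
    "\<And>\<phi> N. \<phi> \<in> dual_unit_ball \<Longrightarrow> (\<Sum>k<N. cmod (\<phi> (y k)) powr p) \<le> 4"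
    "\<And>K. \<exists>N. K < (\<Sum>k<N. norm (y k) powr p)"
    using weakly_not_strongly_summable_sequence[OF p inf] by metis
  define \<epsilon> where "\<epsilon> = exp (- \<alpha> / 8) / 40"
  \<comment> \<open>\<open>R - 1/2 = 1 + t\<close> has square at least
    \<open>t = (2 / \<alpha>) |ln \<epsilon>|\<close>, so the Gaussian at distance
    \<open>R - 1/2\<close> is at most \<open>\<epsilon>\<close>.\<close>
  define R where "R = 3/2 + 2 / \<alpha> * \<bar>ln \<epsilon>\<bar>"
  have \<epsilon>: "\<epsilon> > 0" by (simp add: \<epsilon>_def)
  have R1: "1 \<le> R" using \<alpha> by (simp add: R_def add_increasing2)
  have R2: "exp (- (\<alpha> / 2) * (R - 1/2)\<^sup>2) \<le> exp (- \<alpha> / 8) / 40"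
  proof -
    define t where "t = 2 / \<alpha> * \<bar>ln \<epsilon>\<bar>"
    have t: "t \<ge> 0" using \<alpha> by (simp add: t_def)
    have Rt: "R - 1/2 = 1 + t" by (simp add: R_def t_def)
    have "t \<le> (R - 1/2)\<^sup>2" using t unfolding Rt by (simp add: power2_eq_square algebra_simps)
    then have "\<alpha> / 2 * t \<le> \<alpha> / 2 * (R - 1/2)\<^sup>2" using \<alpha> by (intro mult_left_mono) auto
    moreover have "\<alpha> / 2 * t = \<bar>ln \<epsilon>\<bar>" using \<alpha> by (simp add: t_def)
    ultimately have "- (\<alpha> / 2) * (R - 1/2)\<^sup>2 \<le> ln \<epsilon>" by linarith
    then have "exp (- (\<alpha> / 2) * (R - 1/2)\<^sup>2) \<le> exp (ln \<epsilon>)" by (simp only: exp_le_cancel_iff)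
    also have "\<dots> = \<epsilon>" using \<epsilon> by simp
    finally show ?thesis by (simp only: \<epsilon>_def)
  qed
  define w where "w k = complex_of_real (R * (real k)\<^sup>2)" for k
  define M where "M r k = exp (\<alpha> * (R * (real k)\<^sup>2) * (r + 1) - \<alpha> / 2 * (R * (real k)\<^sup>2)\<^sup>2)" for r k
  note maj = sparse_kernel_majorant[OF \<alpha> R1 w_def M_def]
  define f where "f z = (\<Sum>k. fock_kernel \<alpha> (w k) z *\<^sub>C y k)" for z
  have sn: "summable (\<lambda>k. norm (fock_kernel \<alpha> (w k) z *\<^sub>C y k))" for z
    by (rule entire_suminf_scaleC(1)[where F = "\<lambda>k. fock_kernel \<alpha> (w k)" and M = M, OF holomorphic_fock_kernel y(1) maj])
  have ent: "entire f" unfolding f_def[abs_def]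
    by (rule entire_suminf_scaleC(2)[where F = "\<lambda>k. fock_kernel \<alpha> (w k)" and M = M, OF holomorphic_fock_kernel y(1) maj])
  have sep: "separated I w" for I
    unfolding separated_def
  proof (intro ballI impI)
    fix k l :: nat assume kl: "k \<noteq> l"
    then have "1 \<le> real k + real l" by linarith
    also have "\<dots> \<le> \<bar>(real k)\<^sup>2 - (real l)\<^sup>2\<bar>" by (rule abs_square_diff_ge[OF kl])
    also have "\<dots> \<le> R * \<bar>(real k)\<^sup>2 - (real l)\<^sup>2\<bar>" using R1 by (simp add: mult_le_cancel_right1)
    also have "\<dots> = dist (w k) (w l)"
      using R1 unfolding w_def dist_norm of_real_diff[symmetric] norm_of_real
      by (simp add: right_diff_distrib[symmetric] abs_mult)
    finally show "1 \<le> dist (w k) (w l)" .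
  qed
  obtain C where C: "C > 0" "\<And>(I :: nat set) w b. finite I \<Longrightarrow> separated I w \<Longrightarrow>
      fock_integral p \<alpha> (\<lambda>z. \<Sum>i\<in>I. b i * fock_kernel \<alpha> (w i) z) \<le> ennreal (C * (\<Sum>i\<in>I. cmod (b i) powr p))"
    using fock_kernel_sum_bound[OF p(1) \<alpha>] by blast
  have "weak_fock_norm p \<alpha> f \<le> ennreal ((C * 4) powr (1 / p))"
    unfolding weak_fock_norm_def
  proof (rule SUP_least)
    fix \<phi> :: "'a \<Rightarrow> complex" assume \<phi>: "\<phi> \<in> dual_unit_ball"
    then have bl: "bounded_linear \<phi>" and sc: "\<And>a v. \<phi> (a *\<^sub>C v) = a * \<phi> v"
      by (auto simp: dual_unit_ball_def)
    have "(\<lambda>k. \<phi> (fock_kernel \<alpha> (w k) z *\<^sub>C y k)) sums \<phi> (f z)" for z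
      unfolding f_def by (intro bounded_linear.sums[OF bl] summable_sums summable_norm_cancel[OF sn])
    then have sums: "(\<lambda>k. \<phi> (y k) * fock_kernel \<alpha> (w k) z) sums \<phi> (f z)" for z
      by (simp add: sc mult.commute)
    have "fock_integral p \<alpha> (\<lambda>z. \<Sum>k. \<phi> (y k) * fock_kernel \<alpha> (w k) z) \<le> ennreal (C * 4)"
    proof (rule fock_integral_suminf_le)
      show "continuous_on UNIV (\<lambda>z. \<Sum>k<n. \<phi> (y k) * fock_kernel \<alpha> (w k) z)" for n
        by (intro continuous_intros continuous_fock_kernel)
      show "summable (\<lambda>k. \<phi> (y k) * fock_kernel \<alpha> (w k) z)" for z
        using sums by (rule sums_summable)
      fix n
      have "fock_integral p \<alpha> (\<lambda>z. \<Sum>k<n. \<phi> (y k) * fock_kernel \<alpha> (w k) z) \<le>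
          ennreal (C * (\<Sum>k<n. cmod (\<phi> (y k)) powr p))"
        by (rule C(2)[OF _ sep]) simp
      also have "\<dots> \<le> ennreal (C * 4)" using y(3)[OF \<phi>, of n] C(1) by (intro ennreal_leI mult_left_mono) auto
      finally show "fock_integral p \<alpha> (\<lambda>z. \<Sum>k<n. \<phi> (y k) * fock_kernel \<alpha> (w k) z) \<le> ennreal (C * 4)" .
    qed (use p in simp)
    moreover have "\<phi> \<circ> f = (\<lambda>z. \<Sum>k. \<phi> (y k) * fock_kernel \<alpha> (w k) z)"
      using sums by (auto simp: fun_eq_iff sums_iff)
    ultimately show "fock_norm p \<alpha> (\<phi> \<circ> f) \<le> ennreal ((C * 4) powr (1 / p))"
      using p C(1) by (intro fock_norm_le) auto
  qed
  then have "weak_fock_norm p \<alpha> f < \<infinity>" by (simp add: le_less_trans)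
  then have weak: "f \<in> weak_fock p \<alpha>" using ent by (simp add: weak_fock_def)
  have cf: "continuous_on UNIV (\<lambda>z. norm (f z))"
    by (intro continuous_on_norm entire_imp_continuous_on ent)
  have [measurable]: "(\<lambda>z. norm (f z)) \<in> borel_measurable borel"
    by (rule borel_measurable_continuous_onI[OF cf])
  obtain m where m: "m > 0" "\<And>w. emeasure lborel (annulus w) = ennreal m" using emeasure_annulus by blast
  have "fock_integral p \<alpha> f = \<infinity>"
  proof (rule ccontr)
    assume fin: "fock_integral p \<alpha> f \<noteq> \<infinity>"
    define I where "I = enn2real (fock_integral p \<alpha> f)"
    have I: "fock_integral p \<alpha> f = ennreal I" using fin by (simp add: I_def ennreal_enn2real_if)
    \<comment> \<open>The share of the integral guaranteed on the annulus about \<open>w k\<close>,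
      per unit of \<open>norm (y k) powr p\<close>.\<close>
    define \<delta> where "\<delta> = (exp (- \<alpha> / 8) / 2) powr p * m"
    have \<delta>: "\<delta> > 0" using m by (simp add: \<delta>_def)
    obtain N where N: "I / \<delta> < (\<Sum>k<N. norm (y k) powr p)" using y(4) by blast
    have "ennreal (\<delta> * (\<Sum>k<N. norm (y k) powr p)) =
        (\<Sum>k<N. \<integral>\<^sup>+z\<in>annulus (w k). ennreal ((exp (- \<alpha> / 8) / 2 * norm (y k)) powr p) \<partial>lborel)"
    proof -
      have "(\<integral>\<^sup>+z\<in>annulus (w k). ennreal ((exp (- \<alpha> / 8) / 2 * norm (y k)) powr p) \<partial>lborel) =
          ennreal (\<delta> * norm (y k) powr p)" for k
        unfolding powr_mult[of "exp (- \<alpha> / 8) / 2"] using m(1)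
        by (subst nn_integral_cmult_indicator) (simp_all add: m(2) \<delta>_def ennreal_mult'[symmetric] mult_ac)
      then show ?thesis using \<delta> by (simp add: sum_distrib_left)
    qed
    also have "\<dots> \<le> (\<Sum>k<N. \<integral>\<^sup>+z\<in>annulus (w k). ennreal (norm (f z) powr p * exp (- (p * \<alpha> / 2) * (cmod z)\<^sup>2)) \<partial>lborel)"
    proof (intro sum_mono nn_integral_mono)
      fix k z
      have "(exp (- \<alpha> / 8) / 2 * norm (y k)) powr p \<le> norm (f z) powr p * exp (- (p * \<alpha> / 2) * (cmod z)\<^sup>2)"
        if z: "z \<in> annulus (w k)"
        unfolding fock_weight_powr[OF norm_ge_zero] f_def
        using sparse_kernel_sum_lower_bound[OF \<alpha> R1 R2 y(1) y(2) w_def sn z] p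
        by (intro powr_mono2) auto
      then show "ennreal ((exp (- \<alpha> / 8) / 2 * norm (y k)) powr p) * indicator (annulus (w k)) z \<le>
        ennreal (norm (f z) powr p * exp (- (p * \<alpha> / 2) * (cmod z)\<^sup>2)) * indicator (annulus (w k)) z"
        by (cases "z \<in> annulus (w k)") (auto intro: ennreal_leI)
    qed
    also have "\<dots> \<le> fock_integral p \<alpha> f"
      unfolding fock_integral_def
      by (rule nn_integral_sum_disjoint_le[OF _ separated_annuli_disjoint[OF sep]]) measurable
    finally have "\<delta> * (\<Sum>k<N. norm (y k) powr p) \<le> I"
      unfolding I by (subst (asm) ennreal_le_iff) (simp_all add: I_def)
    then show False using N \<delta> by (simp add: field_simps)
  qed
  then have "f \<notin> fock p \<alpha>" by (simp add: fock_def fock_norm_def)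
  then show ?thesis using weak by blast
qed

section \<open>The elementary directions and the conclusion\<close>

lemma fock_subset_weak_fock:
  assumes "0 < p"
  shows "fock p \<alpha> \<subseteq> weak_fock p \<alpha>"
proof
  fix f :: "complex \<Rightarrow> 'a :: complex_banach" assume f: "f \<in> fock p \<alpha>"
  have "weak_fock_norm p \<alpha> f \<le> fock_norm p \<alpha> f"
    unfolding weak_fock_norm_def
  proof (rule SUP_least)
    fix \<phi> :: "'a \<Rightarrow> complex" assume \<phi>: "\<phi> \<in> dual_unit_ball"
    have "fock_integral p \<alpha> (\<phi> \<circ> f) \<le> fock_integral p \<alpha> f"
      unfolding fock_integral_def using assms dual_unit_ball_norm_le[OF \<phi>]
      by (intro nn_integral_mono ennreal_leI mult_right_mono powr_mono2) auto
    then show "fock_norm p \<alpha> (\<phi> \<circ> f) \<le> fock_norm p \<alpha> f" using assms by (rule fock_norm_mono)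
  qed
  then show "f \<in> weak_fock p \<alpha>" using f by (auto simp: fock_def weak_fock_def intro: le_less_trans)
qed

lemma bounded_J_of_constant:
  assumes "g constant_on UNIV"
  shows "bounded_operator (J g) (weak_fock p \<alpha>) (weak_fock_norm p \<alpha>) (fock p \<alpha>) (fock_norm p \<alpha>)"
proof -
  obtain c where c: "g = (\<lambda>z. c)" using assms by (auto simp: constant_on_def)
  have J0: "J g f = (\<lambda>z. 0 :: 'a :: complex_banach)" for f
    by (simp add: J_def path_integral_def c fun_eq_iff)
  have "fock_norm p \<alpha> (\<lambda>z. 0 :: 'a) = 0" by (simp add: fock_norm_def fock_integral_def)
  moreover have "entire (\<lambda>z. 0 :: 'a)" by (auto simp: entire_def)
  ultimately show ?thesis by (auto simp: bounded_operator_def fock_def J0)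
qed

theorem theorem4p3:
  fixes p \<alpha> :: real and g :: "complex \<Rightarrow> complex"
  assumes "1 < p" and "p < 2" and "0 < \<alpha>"
    and "g holomorphic_on UNIV"
    and "\<nexists>B :: 'a :: complex_banach set. finite B \<and> complex_vector.span B = UNIV"
  shows "(bounded_operator (J g)
            (weak_fock p \<alpha> :: (complex \<Rightarrow> 'a) set) (weak_fock_norm p \<alpha>)
            (fock p \<alpha> :: (complex \<Rightarrow> 'a) set) (fock_norm p \<alpha>)
          \<longleftrightarrow> g constant_on UNIV)
    \<and> (fock p \<alpha> :: (complex \<Rightarrow> 'a) set) \<subset> weak_fock p \<alpha>"
proof (intro conjI iffI)
  assume "bounded_operator (J g)
            (weak_fock p \<alpha> :: (complex \<Rightarrow> 'a) set) (weak_fock_norm p \<alpha>)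
            (fock p \<alpha> :: (complex \<Rightarrow> 'a) set) (fock_norm p \<alpha>)"
  then obtain K where K: "\<And>(n :: nat) w. separated {..<n} w \<Longrightarrow>
      (\<Sum>i<n. (cmod (deriv g (w i)) / (\<alpha> * cmod (w i) + 4))\<^sup>2) \<le> K"
    using bounded_J_square_sum[OF assms] by blast
  show "g constant_on UNIV"
    using unbounded_square_sum[OF assms(3,4), of K] K by (meson not_le)
next
  assume "g constant_on UNIV"
  then show "bounded_operator (J g)
            (weak_fock p \<alpha> :: (complex \<Rightarrow> 'a) set) (weak_fock_norm p \<alpha>)
            (fock p \<alpha> :: (complex \<Rightarrow> 'a) set) (fock_norm p \<alpha>)"
    by (rule bounded_J_of_constant)
next
  have "0 < p" using assms(1) by simp
  then show "(fock p \<alpha> :: (complex \<Rightarrow> 'a) set) \<subset> weak_fock p \<alpha>"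
    using fock_subset_weak_fock exists_weak_fock_not_fock[OF assms(1-3,5)] by blast
qed

end
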